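(* Let $\alpha$ be a weak composition of length $k$ and $\varphi$ any flag. Then $\mathrm{SSKT}(\alpha,\varphi)$, with the key-tableau raising operators $e_i$, their inverse lowering operators $f_i$, and weight $\mathsf{wt}$, is a Demazure crystal (of type $\mathfrak{gl}_n$ for any $n\ge\varphi(k)$), with character $$\kappa_{(\alpha,\varphi)}=\pi_{\varphi(1)\downarrow1}\,\pi_{\varphi(2)\downarrow2}\cdots\pi_{\varphi(k)\downarrow k}(\kappa_\alpha).$$
   Context: Tableaux: fillings by positive integers of finite sets of boxes (row $r$, column $c\in\mathbb{Z}_{>0}$), rows left-justified, French notation (rows indexed upward); $T_{rc}$ is an entry; shape = weak composition of row lengths. Weight of a word $u$: $\mathsf{wt}(u)=(\beta_1,\beta_2,\dots)$ with $\beta_i$ the multiplicity of $i$; $\mathsf{wt}(T)$ is the weight of the word $\cdots r^{(2)}r^{(1)}$ ($r^{(i)}$ = row $i$ read left to right). A flag is a weakly increasing $\varphi:\mathbb{Z}_{>0}\to\mathbb{Z}_{>0}$ with $\varphi(m)\ge m$. A key tableau: (a) rows weakly decreasing; (b) columns with distinct entries; (c) if boxes $(i,j),(k,j)$ with $i<k$ have $T_{ij}>T_{kj}$ then $(i,j+1)$ is a box with $T_{i,j+1}>T_{kj}$. $\varphi$-flagged: $T_{ij}\le\varphi(i)$. $\mathrm{SSKT}(\alpha,\varphi)$: $\varphi$-flagged key tableaux of shape $\alpha$; $\kappa_{(\alpha,\varphi)}=\sum_{T\in\mathrm{SSKT}(\alpha,\varphi)}x^{\mathsf{wt}(T)}$.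 The length $\ell(\alpha)$ is the least $k$ with $\alpha_i=0$ for $i>k$. Raising operators on key tableaux: for a word $\rho=\rho_1\cdots\rho_m$, $m_i(\rho,j)$ = number of $i+1$'s minus number of $i$'s in $\rho_j\cdots\rho_m$, $m_i(\rho)=\max_jm_i(\rho,j)$; $\mathsf{col}(T)$ reads entries down each column, columns right to left. If $m_i(\mathsf{col}(T))\le0$, $e_i(T)=0$; otherwise with $q$ the largest index with $m_i(\mathsf{col}(T),q)=m_i(\mathsf{col}(T))$, change to $i$ all entries $i+1$ to the right of $\mathsf{col}(T)_q$ in its row, then change to $i+1$ all entries $i$ in the same columns. $f_i$ is defined by $f_i(U)=T$ iff $e_i(T)=U$. Crystals: a $\mathfrak{gl}_n$-crystal is a finite set with $e_i,f_i:\mathcal B\to\mathcal B\sqcup\{0\}$ ($1\le i<n$) and $\mathsf{wt}:\mathcal B\to\mathbb{Z}^n$, $e_i(b)=c\iff f_i(c)=b$, then $\mathsf{wt}(c)=\mathsf{wt}(b)+\mathbf e_i-\mathbf e_{i+1}$; isomorphisms are weight-preserving bijections commuting with $e_i,f_i$; character $\sum_bx^{\mathsf{wt}(b)}$. $\mathrm{RF}_n(w)$ (for $w\in S_\infty$) is the set of factorizations $(r^{(n)}|\cdots|r^{(1)})$ of reduced words for $w$ into $n$ consecutive possibly empty strictly increasing subwords, with Morse–Schilling crystal: take elements $b$ of $r^{(i)}$ in decreasing order, pairing each with the smallest unpaired $a\in r^{(i+1)}$, $a>b$; $R_i$, $L_i$ = unpaired letters of $r^{(i)}$, $r^{(i+1)}$.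 $f_i=0$ if $R_i=\varnothing$, else remove $b=\min R_i$ from $r^{(i)}$ and add $b-t$ to $r^{(i+1)}$, $t=\min\{j\ge0:b-j-1\notin r^{(i)}\}$; $e_i=0$ if $L_i=\varnothing$, else remove $a=\max L_i$ from $r^{(i+1)}$ and add $a+s$ to $r^{(i)}$, $s=\min\{j\ge0:a+j+1\notin r^{(i+1)}\}$; $\mathsf{wt}=(\ell(r^{(1)}),\dots,\ell(r^{(n)}))$. $\mathfrak D_iX=\{b:e_i^k(b)\in X\text{ some }k\ge0\}$. For a highest weight $u$ ($e_i(u)=0$ for all $i$) and $\sigma\in S_n$ with reduced word $i_1\cdots i_m$, $\mathfrak D_\sigma\{u\}=\mathfrak D_{i_1}\cdots\mathfrak D_{i_m}\{u\}$ is a Demazure subcrystal (operators leaving it set to $0$). A Demazure crystal is a crystal isomorphic to a Demazure subcrystal of some $\mathrm{RF}_n(w)$. Polynomials: $\partial_i f=(f-s_if)/(x_i-x_{i+1})$ where $s_i$ swaps $x_i,x_{i+1}$; $\pi_if=\partial_i(x_if)$; $\pi_w=\pi_{i_1}\cdots\pi_{i_m}$ for a reduced word of $w$. $S_\infty$ acts on weak compositions on the right by permuting entries ($\alpha\cdot s_i$ swaps $\alpha_i,\alpha_{i+1}$). $\kappa_\alpha=\pi_wx^\lambda$ where $w$ is of minimal length with $\alpha\cdot w=\lambda$ a partition. $\pi_{t\downarrow s}=\pi_{t-1}\pi_{t-2}\cdots\pi_s$ for $t>s$ and $\pi_{t\downarrow t}=\mathrm{id}$. *)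

theory Defs
  imports "HOL-Combinatorics.Permutations" "HOL-Library.Poly_Mapping"
begin

section \<open>Weak compositions and flags\<close>

text \<open>Sequences indexed by the positive integers are functions on \<^typ>\<open>nat\<close>; index \<open>0\<close> is a dummy.\<close>

definition weak_composition :: "(nat \<Rightarrow> nat) \<Rightarrow> bool" where
  "weak_composition \<alpha> \<longleftrightarrow> \<alpha> 0 = 0 \<and> finite {i. \<alpha> i \<noteq> 0}"

definition comp_length :: "(nat \<Rightarrow> nat) \<Rightarrow> nat" where
  "comp_length \<alpha> = (LEAST k. \<forall>i>k. \<alpha> i = 0)"

definition is_partition :: "(nat \<Rightarrow> nat) \<Rightarrow> bool" where
  "is_partition \<mu> \<longleftrightarrow> weak_composition \<mu> \<and> (\<forall>i\<ge>1. \<mu> (Suc i) \<le> \<mu> i)"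

definition is_flag :: "(nat \<Rightarrow> nat) \<Rightarrow> bool" where
  "is_flag \<phi> \<longleftrightarrow> (\<forall>i j. 1 \<le> i \<and> i \<le> j \<longrightarrow> \<phi> i \<le> \<phi> j) \<and> (\<forall>m\<ge>1. m \<le> \<phi> m)"


section \<open>Permutations and reduced words\<close>

definition S_infinity :: "(nat \<Rightarrow> nat) set" where
  "S_infinity = {w. w permutes {1..} \<and> finite {i. w i \<noteq> i}}"

definition word_perm :: "nat list \<Rightarrow> nat \<Rightarrow> nat" where
  "word_perm is = foldr (\<lambda>i v. transpose i (Suc i) \<circ> v) is id"

definition word_for :: "(nat \<Rightarrow> nat) \<Rightarrow> nat list \<Rightarrow> bool" where
  "word_for w is \<longleftrightarrow> (\<forall>i\<in>set is. 1 \<le> i) \<and> word_perm is = w"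

definition perm_length :: "(nat \<Rightarrow> nat) \<Rightarrow> nat" where
  "perm_length w = (LEAST m. \<exists>is. word_for w is \<and> length is = m)"

definition reduced_word :: "(nat \<Rightarrow> nat) \<Rightarrow> nat list \<Rightarrow> bool" where
  "reduced_word w is \<longleftrightarrow> word_for w is \<and> length is = perm_length w"


section \<open>Key tableaux\<close>

text \<open>A tableau assigns to row \<open>r\<close> and column \<open>c\<close> its entry, and \<open>0\<close> where there is no box.\<close>

type_synonym tableau = "nat \<Rightarrow> nat \<Rightarrow> nat"

definition boxes :: "tableau \<Rightarrow> (nat \<times> nat) set" where
  "boxes T = {(r, c). T r c \<noteq> 0}"

definition is_tableau :: "tableau \<Rightarrow> bool" where
  "is_tableau T \<longleftrightarrow> finite (boxes T) \<and>
     (\<forall>(r, c)\<in>boxes T. 1 \<le> r \<and> 1 \<le> c \<and> (\<forall>c'\<in>{1..c}. (r, c') \<in> boxes T))"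

definition shape :: "tableau \<Rightarrow> nat \<Rightarrow> nat" where
  "shape T r = card {c. (r, c) \<in> boxes T}"

definition height :: "tableau \<Rightarrow> nat" where
  "height T = Max (insert 0 (fst ` boxes T))"

definition width :: "tableau \<Rightarrow> nat" where
  "width T = Max (insert 0 (snd ` boxes T))"

definition key_tableau :: "tableau \<Rightarrow> bool" where
  "key_tableau T \<longleftrightarrow> is_tableau T \<and>
     (\<forall>r c c'. (r, c) \<in> boxes T \<and> (r, c') \<in> boxes T \<and> c \<le> c' \<longrightarrow> T r c' \<le> T r c) \<and>
     (\<forall>c i k. (i, c) \<in> boxes T \<and> (k, c) \<in> boxes T \<and> i \<noteq> k \<longrightarrow> T i c \<noteq> T k c) \<and>
     (\<forall>i j k. (i, j) \<in> boxes T \<and> (k, j) \<in> boxes T \<and> i < k \<and> T i j > T k j \<longrightarrow>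
        (i, Suc j) \<in> boxes T \<and> T i (Suc j) > T k j)"

definition flagged :: "(nat \<Rightarrow> nat) \<Rightarrow> tableau \<Rightarrow> bool" where
  "flagged \<phi> T \<longleftrightarrow> (\<forall>(i, j)\<in>boxes T. T i j \<le> \<phi> i)"

definition SSKT :: "(nat \<Rightarrow> nat) \<Rightarrow> (nat \<Rightarrow> nat) \<Rightarrow> tableau set" where
  "SSKT \<alpha> \<phi> = {T. key_tableau T \<and> shape T = \<alpha> \<and> flagged \<phi> T}"

definition row_reading :: "tableau \<Rightarrow> nat list" where
  "row_reading T = [T r c. r \<leftarrow> rev [1..<Suc (height T)], c \<leftarrow> [1..<Suc (shape T r)]]"

definition tableau_wt :: "tableau \<Rightarrow> nat \<Rightarrow> nat" where
  "tableau_wt T i = count_list (row_reading T) i"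


subsection \<open>Raising and lowering operators\<close>

text \<open>Rows are indexed upward, so reading down a column visits rows in decreasing order.\<close>

definition col_boxes :: "tableau \<Rightarrow> (nat \<times> nat) list" where
  "col_boxes T = [(r, c). c \<leftarrow> rev [1..<Suc (width T)], r \<leftarrow> rev [1..<Suc (height T)],
                          (r, c) \<in> boxes T]"

definition col_reading :: "tableau \<Rightarrow> nat list" where
  "col_reading T = map (\<lambda>(r, c). T r c) (col_boxes T)"

text \<open>Positions in words are counted from \<open>0\<close>. The empty suffix, of excess \<open>0\<close>, is admitted in the
  maximum to cover the empty word; this affects neither whether the maximum is positive nor, if it
  is, where it is attained.\<close>

definition suffix_excess :: "nat \<Rightarrow> nat list \<Rightarrow> nat \<Rightarrow> int" where
  "suffix_excess i \<rho> j = int (count_list (drop j \<rho>) (Suc i)) - int (count_list (drop j \<rho>) i)"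

definition max_excess :: "nat \<Rightarrow> nat list \<Rightarrow> int" where
  "max_excess i \<rho> = Max (suffix_excess i \<rho> ` {0..length \<rho>})"

definition excess_pos :: "nat \<Rightarrow> nat list \<Rightarrow> nat" where
  "excess_pos i \<rho> = Max {q. q < length \<rho> \<and> suffix_excess i \<rho> q = max_excess i \<rho>}"

text \<open>\<^const>\<open>None\<close> plays the role of the crystal \<open>0\<close>. The entries \<open>i + 1\<close> weakly to the right of
  the distinguished box of row \<open>r\<^sub>0\<close> are exchanged with the entries \<open>i\<close> in their columns.\<close>

definition tableau_e :: "nat \<Rightarrow> tableau \<Rightarrow> tableau option" where
  "tableau_e i T =
     (if max_excess i (col_reading T) \<le> 0 then None
      else let (r\<^sub>0, c\<^sub>0) = col_boxes T ! excess_pos i (col_reading T)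
           in Some (\<lambda>r c.
                if r = r\<^sub>0 \<and> c\<^sub>0 \<le> c \<and> T r c = Suc i then i
                else if T r c = i \<and> c\<^sub>0 \<le> c \<and> T r\<^sub>0 c = Suc i then Suc i
                else T r c))"

definition tableau_f :: "tableau set \<Rightarrow> nat \<Rightarrow> tableau \<Rightarrow> tableau option" where
  "tableau_f B i U =
     (if \<exists>T\<in>B. tableau_e i T = Some U then Some (THE T. T \<in> B \<and> tableau_e i T = Some U) else None)"


section \<open>Crystals\<close>

text \<open>An element of \<open>\<int>\<^sup>n\<close> is a function \<^typ>\<open>nat \<Rightarrow> int\<close> vanishing outside \<open>{1..n}\<close>.\<close>

record 'b crystal =
  elems :: "'b set"
  raise :: "nat \<Rightarrow> 'b \<Rightarrow> 'b option"
  lower :: "nat \<Rightarrow> 'b \<Rightarrow> 'b option"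
  weight :: "'b \<Rightarrow> nat \<Rightarrow> int"

definition unit_wt :: "nat \<Rightarrow> nat \<Rightarrow> int" where
  "unit_wt i j = (if j = i then 1 else 0)"

definition gl_crystal :: "nat \<Rightarrow> 'b crystal \<Rightarrow> bool" where
  "gl_crystal n C \<longleftrightarrow>
     finite (elems C) \<and>
     (\<forall>b\<in>elems C. \<forall>j. j \<notin> {1..n} \<longrightarrow> weight C b j = 0) \<and>
     (\<forall>i\<in>{1..<n}. \<forall>b\<in>elems C.
        set_option (raise C i b) \<subseteq> elems C \<and> set_option (lower C i b) \<subseteq> elems C) \<and>
     (\<forall>i\<in>{1..<n}. \<forall>b\<in>elems C. \<forall>c\<in>elems C.
        (raise C i b = Some c \<longleftrightarrow> lower C i c = Some b) \<and>
        (raise C i b = Some c \<longrightarrow>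
           (\<forall>j. weight C c j = weight C b j + unit_wt i j - unit_wt (Suc i) j)))"

definition crystal_isomorphic :: "nat \<Rightarrow> 'b crystal \<Rightarrow> 'c crystal \<Rightarrow> bool" where
  "crystal_isomorphic n C D \<longleftrightarrow>
     (\<exists>\<theta>. bij_betw \<theta> (elems C) (elems D) \<and>
        (\<forall>b\<in>elems C. weight D (\<theta> b) = weight C b \<and>
           (\<forall>i\<in>{1..<n}. raise D i (\<theta> b) = map_option \<theta> (raise C i b) \<and>
                        lower D i (\<theta> b) = map_option \<theta> (lower C i b))))"

definition restrict_op :: "'b set \<Rightarrow> ('b \<Rightarrow> 'b option) \<Rightarrow> 'b \<Rightarrow> 'b option" where
  "restrict_op X h b = (case h b of None \<Rightarrow> None | Some c \<Rightarrow> if c \<in> X then Some c else None)"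

definition subcrystal :: "'b crystal \<Rightarrow> 'b set \<Rightarrow> 'b crystal" where
  "subcrystal C X = \<lparr>elems = X,
                     raise = (\<lambda>i. restrict_op X (raise C i)),
                     lower = (\<lambda>i. restrict_op X (lower C i)),
                     weight = weight C\<rparr>"

definition raise_pow :: "'b crystal \<Rightarrow> nat \<Rightarrow> nat \<Rightarrow> 'b \<Rightarrow> 'b option" where
  "raise_pow C i k b = ((\<lambda>x. Option.bind x (raise C i)) ^^ k) (Some b)"

definition demazure_op :: "'b crystal \<Rightarrow> nat \<Rightarrow> 'b set \<Rightarrow> 'b set" where
  "demazure_op C i X = {b \<in> elems C. \<exists>k. \<exists>c\<in>X. raise_pow C i k b = Some c}"

definition highest_weight :: "nat \<Rightarrow> 'b crystal \<Rightarrow> 'b \<Rightarrow> bool" where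
  "highest_weight n C u \<longleftrightarrow> u \<in> elems C \<and> (\<forall>i\<in>{1..<n}. raise C i u = None)"

definition demazure_subset :: "nat \<Rightarrow> 'b crystal \<Rightarrow> 'b set \<Rightarrow> bool" where
  "demazure_subset n C X \<longleftrightarrow>
     (\<exists>u \<sigma> is. highest_weight n C u \<and> \<sigma> permutes {1..n} \<and> reduced_word \<sigma> is \<and>
        X = foldr (demazure_op C) is {u})"


subsection \<open>The crystal of reduced factorizations\<close>

text \<open>A factorization is the list of its factors in the order in which they are written, i.e.
  from the \<open>n\<close>-th down to the first.\<close>

type_synonym factorization = "nat list list"

definition factor :: "factorization \<Rightarrow> nat \<Rightarrow> nat list" where
  "factor \<rho> i = \<rho> ! (length \<rho> - i)"

definition set_factor :: "nat \<Rightarrow> nat set \<Rightarrow> factorization \<Rightarrow> factorization" where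
  "set_factor i A \<rho> = \<rho>[length \<rho> - i := sorted_list_of_set A]"

definition RF :: "nat \<Rightarrow> (nat \<Rightarrow> nat) \<Rightarrow> factorization set" where
  "RF n w = {\<rho>. length \<rho> = n \<and> (\<forall>r\<in>set \<rho>. sorted_wrt (<) r) \<and> reduced_word w (concat \<rho>)}"

text \<open>Processes the letters of the first argument in the given order and returns the unpaired
  letters of both arguments.\<close>

fun ms_pairing :: "nat list \<Rightarrow> nat set \<Rightarrow> nat set \<times> nat set" where
  "ms_pairing [] A = ({}, A)"
| "ms_pairing (b # bs) A =
     (if \<exists>a\<in>A. b < a then ms_pairing bs (A - {Min {a \<in> A. b < a}})
      else let (R, L) = ms_pairing bs A in (insert b R, L))"

definition RF_unpaired_R :: "nat \<Rightarrow> factorization \<Rightarrow> nat set" where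
  "RF_unpaired_R i \<rho> = fst (ms_pairing (rev (factor \<rho> i)) (set (factor \<rho> (Suc i))))"

definition RF_unpaired_L :: "nat \<Rightarrow> factorization \<Rightarrow> nat set" where
  "RF_unpaired_L i \<rho> = snd (ms_pairing (rev (factor \<rho> i)) (set (factor \<rho> (Suc i))))"

text \<open>All letters are positive, so truncated subtraction in the definition of \<open>t\<close> is harmless: the
  minimum is at most \<open>b - 1\<close>.\<close>

definition RF_f :: "nat \<Rightarrow> factorization \<Rightarrow> factorization option" where
  "RF_f i \<rho> =
     (if RF_unpaired_R i \<rho> = {} then None
      else let b = Min (RF_unpaired_R i \<rho>);
               t = (LEAST j. b - j - 1 \<notin> set (factor \<rho> i))
           in Some (set_factor i (set (factor \<rho> i) - {b})
                     (set_factor (Suc i) (insert (b - t) (set (factor \<rho> (Suc i)))) \<rho>)))"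

definition RF_e :: "nat \<Rightarrow> factorization \<Rightarrow> factorization option" where
  "RF_e i \<rho> =
     (if RF_unpaired_L i \<rho> = {} then None
      else let a = Max (RF_unpaired_L i \<rho>);
               s = (LEAST j. a + j + 1 \<notin> set (factor \<rho> (Suc i)))
           in Some (set_factor (Suc i) (set (factor \<rho> (Suc i)) - {a})
                     (set_factor i (insert (a + s) (set (factor \<rho> i))) \<rho>)))"

definition RF_wt :: "factorization \<Rightarrow> nat \<Rightarrow> int" where
  "RF_wt \<rho> j = (if j \<in> {1..length \<rho>} then int (length (factor \<rho> j)) else 0)"

definition RF_crystal :: "nat \<Rightarrow> (nat \<Rightarrow> nat) \<Rightarrow> factorization crystal" where
  "RF_crystal n w = \<lparr>elems = RF n w, raise = RF_e, lower = RF_f, weight = RF_wt\<rparr>"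

definition demazure_crystal :: "nat \<Rightarrow> 'b crystal \<Rightarrow> bool" where
  "demazure_crystal n C \<longleftrightarrow> gl_crystal n C \<and>
     (\<exists>w\<in>S_infinity. \<exists>X. demazure_subset n (RF_crystal n w) X \<and>
        crystal_isomorphic n C (subcrystal (RF_crystal n w) X))"

definition SSKT_crystal :: "(nat \<Rightarrow> nat) \<Rightarrow> (nat \<Rightarrow> nat) \<Rightarrow> tableau crystal" where
  "SSKT_crystal \<alpha> \<phi> = \<lparr>elems = SSKT \<alpha> \<phi>,
                       raise = tableau_e,
                       lower = tableau_f (SSKT \<alpha> \<phi>),
                       weight = (\<lambda>T j. int (tableau_wt T j))\<rparr>"


section \<open>Polynomials\<close>

type_synonym mpoly = "(nat \<Rightarrow>\<^sub>0 nat) \<Rightarrow>\<^sub>0 int"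
type_synonym laurent = "(nat \<Rightarrow>\<^sub>0 int) \<Rightarrow>\<^sub>0 int"

definition monomial :: "(nat \<Rightarrow> 'e::zero) \<Rightarrow> (nat \<Rightarrow>\<^sub>0 'e) \<Rightarrow>\<^sub>0 int" where
  "monomial \<beta> = Poly_Mapping.single (Abs_poly_mapping \<beta>) 1"

definition var :: "nat \<Rightarrow> mpoly" where
  "var i = Poly_Mapping.single (Poly_Mapping.single i 1) 1"

definition laurent_of :: "mpoly \<Rightarrow> laurent" where
  "laurent_of p = (\<Sum>m\<in>Poly_Mapping.keys p.
     Poly_Mapping.single (Poly_Mapping.map int m) (Poly_Mapping.lookup p m))"

definition character :: "'b crystal \<Rightarrow> laurent" where
  "character C = (\<Sum>b\<in>elems C. monomial (weight C b))"

definition swap_vars :: "nat \<Rightarrow> mpoly \<Rightarrow> mpoly" where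
  "swap_vars i = Poly_Mapping.map_key (Poly_Mapping.map_key (transpose i (Suc i)))"

definition divided_difference :: "nat \<Rightarrow> mpoly \<Rightarrow> mpoly" where
  "divided_difference i f = (THE g. (var i - var (Suc i)) * g = f - swap_vars i f)"

definition pi_op :: "nat \<Rightarrow> mpoly \<Rightarrow> mpoly" where
  "pi_op i f = divided_difference i (var i * f)"

definition pi_word :: "nat list \<Rightarrow> mpoly \<Rightarrow> mpoly" where
  "pi_word is = foldr pi_op is"

definition pi_perm :: "(nat \<Rightarrow> nat) \<Rightarrow> mpoly \<Rightarrow> mpoly" where
  "pi_perm w = pi_word (SOME is. reduced_word w is)"

definition pi_down :: "nat \<Rightarrow> nat \<Rightarrow> mpoly \<Rightarrow> mpoly" where
  "pi_down t s = pi_word (rev [s..<t])"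

text \<open>The right action of \<^const>\<open>S_infinity\<close> on weak compositions is precomposition.\<close>

definition minimal_sorting :: "(nat \<Rightarrow> nat) \<Rightarrow> (nat \<Rightarrow> nat) \<Rightarrow> bool" where
  "minimal_sorting \<alpha> w \<longleftrightarrow> w \<in> S_infinity \<and> is_partition (\<alpha> \<circ> w) \<and>
     (\<forall>v\<in>S_infinity. is_partition (\<alpha> \<circ> v) \<longrightarrow> perm_length w \<le> perm_length v)"

definition key_poly :: "(nat \<Rightarrow> nat) \<Rightarrow> mpoly" where
  "key_poly \<alpha> = (let w = (SOME w. minimal_sorting \<alpha> w) in pi_perm w (monomial (\<alpha> \<circ> w)))"

definition flagged_key_poly :: "(nat \<Rightarrow> nat) \<Rightarrow> (nat \<Rightarrow> nat) \<Rightarrow> mpoly" where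
  "flagged_key_poly \<alpha> \<phi> = (\<Sum>T\<in>SSKT \<alpha> \<phi>. monomial (tableau_wt T))"

end

theory Submission
  imports Defs
begin

text \<open>
  The product of the \<open>N\<close> commuting transpositions \<open>s\<^sub>1 s\<^sub>3 s\<^sub>5 \<dots>\<close> has as its reduced
  factorizations exactly the words of length \<open>N\<close> (position \<open>p\<close> carries the index of the factor
  containing the corresponding letter), with the usual bracketing crystal structure. A key tableau is
  sent to the word that lists its columns from left to right, each column sorted increasingly. This
  intertwines the raising operators, since \<open>e\<^sub>i\<close> applies the transposition of \<open>i\<close> and \<open>i + 1\<close> to an
  interval of columns all of which, except the last, contain both letters. Given the shape, the columns determine the
  tableau: a greedy filling from right to left is forced.

  The flag only restricts column 1. Along an \<open>i\<close>-string column 1 can change only in the first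
  step below the top, so \<open>SSKT(\<alpha>, \<phi>)\<close> meets every string in nothing, in its top or in everything, and
  increasing a single flag value \<open>\<phi> j\<close> from \<open>t\<close> to \<open>t + 1\<close> is the Demazure operator for \<open>t\<close>; on
  characters this is \<open>\<pi>\<^sub>t\<close>. For the identity flag the same increase in row \<open>t\<close> does nothing if
  \<open>\<alpha> t \<le> \<alpha> (t + 1)\<close> and otherwise amounts to exchanging the two parts of \<open>\<alpha>\<close>. Hence every
  set that occurs is \<open>SSKT(\<beta>, id)\<close> for some rearrangement \<open>\<beta>\<close>, and counting inversions of
  \<open>\<beta>\<close> shows that the words of Demazure operators obtained in this way are reduced.
\<close>

section \<open>The crystal of words\<close>

text \<open>The obstacle is lowering: \<open>tableau_e\<close> is explicit, but a word just below
  that of a tableau must be shown to come from a tableau of the same shape. Finite sets of positive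
  integers are the columns of a key tableau of a given shape exactly when their sizes fit and, for
  every v, the number of entries that are at least v does not grow from one column to the next. This
  criterion sees the shape only through the column sizes, so it also allows the same columns to be
  refilled after permuting the rows of the shape.

  Different flags and shapes are compared on words only. A set of words and t determine the result
  of the Demazure operator for t, so a step that raises an arbitrary flag coincides with the step
  that raises row t of the identity flag for the current rearrangement \<beta>. The indices coming
  from the flag alone may form a non-reduced word; after this replacement a step either changes
  nothing and is dropped, or adds one inversion to \<beta>.

  Odd letters are used for the factorizations so that the shifts s and t in the Morse-Schilling
  operators vanish. The number N of letters is the number of boxes.\<close>

definition wexcess :: "nat \<Rightarrow> nat list \<Rightarrow> int" where
  "wexcess i xs = int (count_list xs (Suc i)) - int (count_list xs i)"

text \<open>Bracketing: an \<open>i\<close> is paired with an \<open>Suc i\<close> to its right.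
  \<open>eps\<close> counts the unpaired \<open>Suc i\<close>, \<open>phi\<close> the unpaired
  \<open>i\<close>; once pairs are deleted, all \<open>Suc i\<close> precede all \<open>i\<close>.
  The truncation in \<open>eps i xs - 1\<close> is the case of an \<open>i\<close> that finds no
  partner.\<close>

fun eps :: "nat \<Rightarrow> nat list \<Rightarrow> nat" where
  "eps i [] = 0"
| "eps i (x # xs) = (if x = Suc i then Suc (eps i xs) else if x = i then eps i xs - 1 else eps i xs)"

fun phi :: "nat \<Rightarrow> nat list \<Rightarrow> nat" where
  "phi i [] = 0"
| "phi i (x # xs) = (if x = i \<and> eps i xs = 0 then Suc (phi i xs) else phi i xs)"

lemma eps_phi: "int (eps i xs) - int (phi i xs) = wexcess i xs"
  by (induction xs) (auto simp: wexcess_def)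

text \<open>The unpaired \<open>i\<close> of \<open>xs\<close> absorb as many unpaired
  \<open>Suc i\<close> of \<open>ys\<close> as they can.\<close>

lemma eps_append: "eps i (xs @ ys) = eps i xs + (eps i ys - phi i xs)"
  by (induction xs) auto

lemma phi_append: "phi i (xs @ ys) = phi i ys + (phi i xs - eps i ys)"
proof -
  have "wexcess i (xs @ ys) = wexcess i xs + wexcess i ys" by (simp add: wexcess_def)
  then show ?thesis
    using eps_phi[of i xs] eps_phi[of i ys] eps_phi[of i "xs @ ys"] eps_append[of i xs ys] by linarith
qed

text \<open>This is the crystal edge from \<open>V\<close> down to \<open>W\<close>: the side
  conditions make the displayed letter the leftmost unpaired \<open>i\<close> of \<open>V\<close>
  and the rightmost unpaired \<open>Suc i\<close> of \<open>W\<close>. As a relation it serves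
  raising and lowering alike.\<close>

definition arrow :: "nat \<Rightarrow> nat list \<Rightarrow> nat list \<Rightarrow> bool" where
  "arrow i V W \<longleftrightarrow> (\<exists>xs ys. V = xs @ i # ys \<and> W = xs @ Suc i # ys \<and> phi i xs = 0 \<and> eps i ys = 0)"

lemma arrow_eps: "arrow i V W \<Longrightarrow> eps i W = Suc (eps i V)"
  by (auto simp: arrow_def eps_append)

lemma arrow_phi: "arrow i V W \<Longrightarrow> phi i V = Suc (phi i W)"
  by (auto simp: arrow_def phi_append)

lemma arrow_count:
  assumes "arrow i V W"
  shows "int (count_list V j) = int (count_list W j) + unit_wt i j - unit_wt (Suc i) j"
  using assms by (auto simp: arrow_def unit_wt_def)

lemma split_unique:
  assumes "xs @ x # ys = xs' @ x # ys'" "phi i xs = 0" "phi i xs' = 0" "eps i ys = 0" "eps i ys' = 0"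
    "x = i \<or> x = Suc i"
  shows "xs = xs' \<and> ys = ys'"
proof -
  \<comment> \<open>Two admissible positions would enclose a segment \<open>zs\<close>. For
    \<open>x = i\<close>, the vanishing of \<open>phi i xs\<close> needs an unpaired
    \<open>Suc i\<close> in \<open>zs\<close>, which \<open>eps i ys' = 0\<close> excludes; for
    \<open>x = Suc i\<close>, the vanishing of \<open>eps i ys'\<close> needs an unpaired
    \<open>i\<close> in \<open>zs\<close>, which \<open>phi i xs = 0\<close> excludes.\<close>
  have aux: False if "xs = us @ x # zs" "ys' = zs @ x # ys" "phi i xs = 0" "phi i us = 0" "eps i ys' = 0"
    for us zs xs ys ys'
    using that assms(6) by (auto simp: phi_append eps_append split: if_splits)
  from assms(1) obtain us where "xs = xs' @ us \<and> us @ x # ys = x # ys' \<or> xs @ us = xs' \<and> x # ys = us @ x # ys'"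
    unfolding append_eq_append_conv2 by blast
  then show ?thesis
  proof (elim disjE conjE)
    assume *: "xs = xs' @ us" "us @ x # ys = x # ys'"
    show ?thesis
    proof (cases us)
      case Nil then show ?thesis using * by simp
    next
      case (Cons z zs)
      then show ?thesis using aux[of xs xs' zs ys' ys] * assms by auto
    qed
  next
    assume *: "xs @ us = xs'" "x # ys = us @ x # ys'"
    show ?thesis
    proof (cases us)
      case Nil then show ?thesis using * by simp
    next
      case (Cons z zs)
      then show ?thesis using aux[of xs' xs zs ys ys'] * assms by auto
    qed
  qed
qed

lemma arrow_unique_target:
  assumes "arrow i V W" "arrow i V W'"
  shows "W = W'"
proof -
  obtain xs ys where 1: "V = xs @ i # ys" "W = xs @ Suc i # ys" "phi i xs = 0" "eps i ys = 0"
    using assms(1) arrow_def by auto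
  obtain xs' ys' where 2: "V = xs' @ i # ys'" "W' = xs' @ Suc i # ys'" "phi i xs' = 0" "eps i ys' = 0"
    using assms(2) arrow_def by auto
  have "xs = xs' \<and> ys = ys'" using 1 2 by (intro split_unique[where x = i and i = i]) auto
  then show ?thesis using 1 2 by simp
qed

lemma arrow_unique_source:
  assumes "arrow i V W" "arrow i V' W"
  shows "V = V'"
proof -
  obtain xs ys where 1: "V = xs @ i # ys" "W = xs @ Suc i # ys" "phi i xs = 0" "eps i ys = 0"
    using assms(1) arrow_def by auto
  obtain xs' ys' where 2: "V' = xs' @ i # ys'" "W = xs' @ Suc i # ys'" "phi i xs' = 0" "eps i ys' = 0"
    using assms(2) arrow_def by auto
  have "xs = xs' \<and> ys = ys'" using 1 2 by (intro split_unique[where x = "Suc i" and i = i]) auto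
  then show ?thesis using 1 2 by simp
qed

section \<open>Factorizations of a product of commuting simple transpositions\<close>

text \<open>The position \<^term>\<open>p\<close> of a word is encoded by the letter \<^term>\<open>2 * p + 1\<close>; these letters commute
  pairwise, so any distribution of them over the factors is a factorization.\<close>

fun occ :: "nat \<Rightarrow> nat \<Rightarrow> nat list \<Rightarrow> nat list" where
  "occ i k [] = []"
| "occ i k (x # xs) = (if x = i then (2 * k + 1) # occ i (Suc k) xs else occ i (Suc k) xs)"

text \<open>These are the letters of factor \<open>Suc i\<close> left over by the pairing. An
  \<open>i\<close> at the front of the word carries the smallest letter, is processed last and takes
  the least remaining partner. If none remains, \<open>Min {}\<close> is unspecified, but it is
  removed from the empty set.\<close>

fun unpL :: "nat \<Rightarrow> nat \<Rightarrow> nat list \<Rightarrow> nat set" where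
  "unpL i k [] = {}"
| "unpL i k (x # xs) = (if x = Suc i then insert (2 * k + 1) (unpL i (Suc k) xs)
     else if x = i then unpL i (Suc k) xs - {Min (unpL i (Suc k) xs)} else unpL i (Suc k) xs)"

fun unpR :: "nat \<Rightarrow> nat \<Rightarrow> nat list \<Rightarrow> nat set" where
  "unpR i k [] = {}"
| "unpR i k (x # xs) = (if x = i \<and> unpL i (Suc k) xs = {} then insert (2 * k + 1) (unpR i (Suc k) xs)
     else unpR i (Suc k) xs)"

lemma in_occ_iff: "y \<in> set (occ i k xs) \<longleftrightarrow> (\<exists>p<length xs. y = 2 * (k + p) + 1 \<and> xs ! p = i)"
  by (induction xs arbitrary: k) (auto simp: Ex_less_Suc2)

lemma occ_bound: "x \<in> set (occ i k xs) \<Longrightarrow> 2 * k + 1 \<le> x"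
  by (auto simp: in_occ_iff)

lemma occ_upper_bound: "x \<in> set (occ i k xs) \<Longrightarrow> x < 2 * (k + length xs) + 1"
  by (auto simp: in_occ_iff)

lemma occ_append: "occ i k (xs @ ys) = occ i k xs @ occ i (k + length xs) ys"
  by (induction xs arbitrary: k) auto

lemma occ_sorted: "sorted_wrt (<) (occ i k xs)"
  by (induction xs arbitrary: k) (auto dest: occ_bound)

lemma sorted_list_of_set_occ: "sorted_list_of_set (set (occ i k xs)) = occ i k xs"
  using occ_sorted[of i k xs] by (simp add: sorted_list_of_set.idem_if_sorted_distinct strict_sorted_iff)

lemma length_occ: "length (occ i k xs) = count_list xs i"
  by (induction xs arbitrary: k) auto

lemma unpL_subset: "unpL i k xs \<subseteq> set (occ (Suc i) k xs)"
proof (induction xs arbitrary: k)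
  case (Cons x xs)
  then show ?case using Cons[of "Suc k"] by auto
qed auto

lemma unpL_bound: "x \<in> unpL i k xs \<Longrightarrow> 2 * k + 1 \<le> x"
  by (rule occ_bound[OF subsetD[OF unpL_subset]])

lemma finite_unpL: "finite (unpL i k xs)"
  by (rule finite_subset[OF unpL_subset]) simp

lemma unpR_subset: "unpR i k xs \<subseteq> set (occ i k xs)"
proof (induction xs arbitrary: k)
  case (Cons x xs)
  then show ?case using Cons[of "Suc k"] by auto
qed auto

lemma unpR_bound: "x \<in> unpR i k xs \<Longrightarrow> 2 * k + 1 \<le> x"
  by (rule occ_bound[OF subsetD[OF unpR_subset]])

lemma finite_unpR: "finite (unpR i k xs)"
  by (rule finite_subset[OF unpR_subset]) simp

lemma card_unpL: "card (unpL i k xs) = eps i xs"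
proof (induction xs arbitrary: k)
  case (Cons x xs)
  have "2 * k + 1 \<notin> unpL i (Suc k) xs" using unpL_bound by force
  moreover have "card (unpL i (Suc k) xs - {Min (unpL i (Suc k) xs)}) = card (unpL i (Suc k) xs) - 1"
    by (cases "unpL i (Suc k) xs = {}") (auto simp: finite_unpL)
  ultimately show ?case using Cons finite_unpL by auto
qed auto

lemma unpL_empty_iff: "unpL i k xs = {} \<longleftrightarrow> eps i xs = 0"
  using card_0_eq[OF finite_unpL[of i k xs]] by (simp add: card_unpL)

lemma unpR_empty_iff: "unpR i k xs = {} \<longleftrightarrow> phi i xs = 0"
  by (induction xs arbitrary: k) (auto simp: unpL_empty_iff)

text \<open>Letters are processed in decreasing order, so the front position of a word is processed
  last; induction along the word therefore needs the effect of appending a letter.\<close>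

lemma ms_pairing_snoc:
  "ms_pairing (bs @ [b]) A = (let (R, L) = ms_pairing bs A in
     if \<exists>a\<in>L. b < a then (R, L - {Min {a \<in> L. b < a}}) else (insert b R, L))"
proof (induction bs arbitrary: A)
  case (Cons c bs)
  show ?case
  proof (cases "\<exists>a\<in>A. c < a")
    case True then show ?thesis using Cons by simp
  next
    case False
    obtain R L where "ms_pairing bs A = (R, L)" by fastforce
    then show ?thesis using Cons[of A] False by (auto simp: Let_def insert_commute)
  qed
qed auto

text \<open>A letter that exceeds none of the processed ones is never a candidate for pairing. This
  is the case of an \<open>Suc i\<close> at the front of a word.\<close>

lemma ms_pairing_insert_small:
  assumes "\<forall>b\<in>set bs. a \<le> b" "a \<notin> A" "finite A" "ms_pairing bs A = (R, L)"
  shows "ms_pairing bs (insert a A) = (R, insert a L)"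
  using assms
proof (induction bs arbitrary: A R L)
  case (Cons b bs)
  have eq: "{x \<in> insert a A. b < x} = {x \<in> A. b < x}" using Cons.prems by auto
  have wexcess: "(\<exists>x\<in>insert a A. b < x) \<longleftrightarrow> (\<exists>x\<in>A. b < x)" using Cons.prems by auto
  show ?case
  proof (cases "\<exists>x\<in>A. b < x")
    case True
    then have "Min {x \<in> A. b < x} \<in> {x \<in> A. b < x}" using Cons.prems by (intro Min_in) auto
    then have "insert a A - {Min {x \<in> A. b < x}} = insert a (A - {Min {x \<in> A. b < x}})"
      using Cons.prems by auto
    moreover have "ms_pairing bs (insert a (A - {Min {x \<in> A. b < x}})) = (R, insert a L)"
      using Cons.prems True by (intro Cons.IH) auto
    ultimately show ?thesis using True wexcess eq by simp
  next
    case False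
    obtain R' L' where RL: "ms_pairing bs A = (R', L')" by fastforce
    then have "ms_pairing bs (insert a A) = (R', insert a L')"
      using Cons.prems by (intro Cons.IH) auto
    then show ?thesis using Cons.prems RL False wexcess by auto
  qed
qed auto

lemma ms_pairing_occ:
  "ms_pairing (rev (occ i k xs)) (set (occ (Suc i) k xs)) = (unpR i k xs, unpL i k xs)"
proof (induction xs arbitrary: k)
  case (Cons x xs)
  let ?L = "unpL i (Suc k) xs"
  have L: "{a \<in> ?L. 2 * k + 1 < a} = ?L" "(\<exists>a\<in>?L. 2 * k + 1 < a) \<longleftrightarrow> ?L \<noteq> {}"
    using unpL_bound[of _ i "Suc k" xs] by force+
  have notin: "2 * k + 1 \<notin> set (occ (Suc i) (Suc k) xs)" using occ_bound by force
  consider "x = i" | "x = Suc i" | "x \<noteq> i" "x \<noteq> Suc i" by blast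
  then show ?case
  proof cases
    case 1
    then show ?thesis using Cons[of "Suc k"] L by (simp add: ms_pairing_snoc)
  next
    case 2
    have "ms_pairing (rev (occ i (Suc k) xs)) (insert (2 * k + 1) (set (occ (Suc i) (Suc k) xs))) =
        (unpR i (Suc k) xs, insert (2 * k + 1) ?L)"
      using notin Cons[of "Suc k"] by (intro ms_pairing_insert_small) (auto dest: occ_bound)
    then show ?thesis using 2 by simp
  next
    case 3
    then show ?thesis using Cons[of "Suc k"] by simp
  qed
qed auto

text \<open>Identifies the letter on which \<open>RF_e\<close> acts, the maximum of
  \<open>unpL\<close>, with the position that \<open>arrow\<close> requires.\<close>

lemma eps_split:
  assumes "eps i xs \<noteq> 0"
  shows "\<exists>us vs. xs = us @ Suc i # vs \<and> phi i us = 0 \<and> eps i vs = 0 \<and>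
    Max (unpL i k xs) = 2 * (k + length us) + 1"
  using assms
proof (induction xs arbitrary: k)
  case (Cons x xs)
  show ?case
  proof (cases "eps i xs = 0")
    case True
    then have "x = Suc i" using Cons.prems by (auto split: if_splits)
    moreover have "unpL i (Suc k) xs = {}" using True unpL_empty_iff by auto
    ultimately show ?thesis using True by (intro exI[of _ "[]"] exI[of _ xs]) auto
  next
    case False
    then obtain us vs where *: "xs = us @ Suc i # vs" "phi i us = 0" "eps i vs = 0"
      "Max (unpL i (Suc k) xs) = 2 * (Suc k + length us) + 1" using Cons.IH by blast
    have ne: "unpL i (Suc k) xs \<noteq> {}" using False unpL_empty_iff by auto
    have e: "eps i xs = Suc (eps i us)" using * by (simp add: eps_append)
    have "phi i (x # us) = 0" using * e Cons.prems by (auto split: if_splits)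
    moreover have "Max (unpL i k (x # xs)) = Max (unpL i (Suc k) xs)"
    proof (cases "x = i")
      case True
      let ?L = "unpL i (Suc k) xs"
      \<comment> \<open>An \<open>Suc i\<close> is still unpaired after the front \<open>i\<close>
        has taken one, so there were two, and removing the minimum does not touch the
        maximum.\<close>
      have "card ?L \<ge> 2" using True Cons.prems card_unpL[of i "Suc k" xs] by auto
      then have "card (?L - {Min ?L}) \<noteq> 0" using ne finite_unpL by (simp add: card_Diff_singleton)
      then have "?L - {Min ?L} \<noteq> {}" by (metis card.empty)
      then obtain y where y: "y \<in> ?L" "y \<noteq> Min ?L" by auto
      have "Min ?L < y" using y Min_le[OF finite_unpL y(1)] by auto
      then have "Min ?L < Max ?L" using Max_ge[OF finite_unpL y(1)] by linarith
      then have "Max (?L - {Min ?L}) = Max ?L" using ne finite_unpL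
        by (intro Max_eqI) auto
      then show ?thesis using True by simp
    next
      case False
      have "2 * k + 1 < Max (unpL i (Suc k) xs)" using * by simp
      then have "Max (insert (2 * k + 1) (unpL i (Suc k) xs)) = Max (unpL i (Suc k) xs)"
        using ne finite_unpL by (simp add: Max_insert)
      then show ?thesis using False by simp
    qed
    ultimately show ?thesis using * by (intro exI[of _ "x # us"] exI[of _ vs]) auto
  qed
qed auto

lemma phi_split:
  assumes "phi i xs \<noteq> 0"
  shows "\<exists>us vs. xs = us @ i # vs \<and> phi i us = 0 \<and> eps i vs = 0 \<and>
    Min (unpR i k xs) = 2 * (k + length us) + 1"
  using assms
proof (induction xs arbitrary: k)
  case (Cons x xs)
  show ?case
  proof (cases "x = i \<and> eps i xs = 0")
    case True
    have "Min (unpR i k (x # xs)) = 2 * k + 1"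
      using True finite_unpR unpR_bound[of _ i "Suc k" xs]
      by (intro Min_eqI) (force simp: unpL_empty_iff)+
    then show ?thesis using True by (intro exI[of _ "[]"] exI[of _ xs]) auto
  next
    case False
    then have "phi i xs \<noteq> 0" using Cons.prems by (auto split: if_splits)
    then obtain us vs where *: "xs = us @ i # vs" "phi i us = 0" "eps i vs = 0"
      "Min (unpR i (Suc k) xs) = 2 * (Suc k + length us) + 1" using Cons.IH by blast
    have e: "eps i xs = eps i us" using * by (simp add: eps_append)
    have "unpR i k (x # xs) = unpR i (Suc k) xs" using False by (auto simp: unpL_empty_iff)
    moreover have "phi i (x # us) = 0" using * e False by auto
    ultimately show ?thesis using * by (intro exI[of _ "x # us"] exI[of _ vs]) auto
  qed
qed auto

lemma arrow_into: "eps i W \<noteq> 0 \<Longrightarrow> \<exists>V. arrow i V W"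
  using eps_split[of i W 0] by (auto simp: arrow_def)

lemma arrow_from: "phi i V \<noteq> 0 \<Longrightarrow> \<exists>W. arrow i V W"
  using phi_split[of i V 0] by (auto simp: arrow_def)

lemma arrow_Max_unpL:
  assumes "W = us @ Suc i # vs" "phi i us = 0" "eps i vs = 0"
  shows "Max (unpL i 0 W) = 2 * length us + 1"
proof -
  have "eps i W \<noteq> 0" using assms by (simp add: eps_append)
  then obtain us' vs' where *: "W = us' @ Suc i # vs'" "phi i us' = 0" "eps i vs' = 0"
    "Max (unpL i 0 W) = 2 * (0 + length us') + 1" using eps_split by blast
  have "us = us' \<and> vs = vs'" using * assms by (intro split_unique[where x = "Suc i" and i = i]) auto
  then show ?thesis using * by simp
qed

lemma arrow_Min_unpR:
  assumes "V = us @ i # vs" "phi i us = 0" "eps i vs = 0"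
  shows "Min (unpR i 0 V) = 2 * length us + 1"
proof -
  have "phi i V \<noteq> 0" using assms by (simp add: phi_append)
  then obtain us' vs' where *: "V = us' @ i # vs'" "phi i us' = 0" "eps i vs' = 0"
    "Min (unpR i 0 V) = 2 * (0 + length us') + 1" using phi_split by blast
  have "us = us' \<and> vs = vs'" using * assms by (intro split_unique[where x = i and i = i]) auto
  then show ?thesis using * by simp
qed

section \<open>Words as factorizations\<close>

definition enc :: "nat \<Rightarrow> nat list \<Rightarrow> factorization" where
  "enc n W = map (\<lambda>j. occ j 0 W) (rev [1..<Suc n])"

lemma length_enc [simp]: "length (enc n W) = n"
  by (simp add: enc_def)

lemma factor_enc: "i \<in> {1..n} \<Longrightarrow> factor (enc n W) i = occ i 0 W"
  by (auto simp: factor_def enc_def rev_nth simp del: upt_Suc)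

lemma factor_ext:
  assumes "length \<rho> = n" "length \<rho>' = n" "\<And>i. i \<in> {1..n} \<Longrightarrow> factor \<rho> i = factor \<rho>' i"
  shows "\<rho> = \<rho>'"
proof (rule nth_equalityI)
  fix j assume "j < length \<rho>"
  then have "n - j \<in> {1..n}" "n - (n - j) = j" using assms by auto
  then show "\<rho> ! j = \<rho>' ! j" using assms(1,2) assms(3)[of "n - j"] by (simp add: factor_def)
qed (use assms in simp)

lemma length_set_factor [simp]: "length (set_factor i A \<rho>) = length \<rho>"
  by (simp add: set_factor_def)

lemma factor_set_factor:
  assumes "i \<in> {1..length \<rho>}" "j \<in> {1..length \<rho>}"
  shows "factor (set_factor i A \<rho>) j = (if j = i then sorted_list_of_set A else factor \<rho> j)"
proof -
  have "length \<rho> - i = length \<rho> - j \<longleftrightarrow> i = j" using assms by auto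
  then show ?thesis using assms by (auto simp: factor_def set_factor_def nth_list_update)
qed

lemma RF_unpaired_enc:
  assumes "i \<in> {1..<n}"
  shows "RF_unpaired_L i (enc n W) = unpL i 0 W" "RF_unpaired_R i (enc n W) = unpR i 0 W"
  using assms by (simp_all add: RF_unpaired_L_def RF_unpaired_R_def factor_enc ms_pairing_occ)

lemma occ_change:
  fixes us vs :: "nat list"
  defines "a \<equiv> 2 * length us + 1"
  shows "set (occ i 0 (us @ i # vs)) = insert a (set (occ i 0 (us @ Suc i # vs)))"
    "set (occ (Suc i) 0 (us @ i # vs)) = set (occ (Suc i) 0 (us @ Suc i # vs)) - {a}"
    "set (occ i 0 (us @ Suc i # vs)) = set (occ i 0 (us @ i # vs)) - {a}"
    "set (occ (Suc i) 0 (us @ Suc i # vs)) = insert a (set (occ (Suc i) 0 (us @ i # vs)))"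
    "j \<noteq> i \<Longrightarrow> j \<noteq> Suc i \<Longrightarrow> occ j 0 (us @ Suc i # vs) = occ j 0 (us @ i # vs)"
proof -
  have "a \<notin> set (occ j 0 us)" "a \<notin> set (occ j (Suc (length us)) vs)" for j
    using occ_bound[of a j "Suc (length us)" vs] occ_upper_bound[of a j 0 us] by (auto simp: a_def)
  then show "set (occ i 0 (us @ i # vs)) = insert a (set (occ i 0 (us @ Suc i # vs)))"
    "set (occ (Suc i) 0 (us @ i # vs)) = set (occ (Suc i) 0 (us @ Suc i # vs)) - {a}"
    "set (occ i 0 (us @ Suc i # vs)) = set (occ i 0 (us @ i # vs)) - {a}"
    "set (occ (Suc i) 0 (us @ Suc i # vs)) = insert a (set (occ (Suc i) 0 (us @ i # vs)))"
    "j \<noteq> i \<Longrightarrow> j \<noteq> Suc i \<Longrightarrow> occ j 0 (us @ Suc i # vs) = occ j 0 (us @ i # vs)"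
    by (simp_all add: occ_append a_def)
qed

lemma even_notin_occ: "even x \<Longrightarrow> x \<notin> set (occ i k xs)"
  by (auto simp: in_occ_iff)

lemma RF_e_enc:
  assumes i: "i \<in> {1..<n}"
  shows "eps i W = 0 \<Longrightarrow> RF_e i (enc n W) = None"
    and "arrow i V W \<Longrightarrow> RF_e i (enc n W) = Some (enc n V)"
proof -
  show "eps i W = 0 \<Longrightarrow> RF_e i (enc n W) = None"
    using i by (simp add: RF_e_def RF_unpaired_enc unpL_empty_iff)
  assume arr: "arrow i V W"
  then obtain us vs where *: "V = us @ i # vs" "W = us @ Suc i # vs" "phi i us = 0" "eps i vs = 0"
    by (auto simp: arrow_def)
  let ?a = "2 * length us + 1"
  have f: "factor (enc n W) i = occ i 0 W" "factor (enc n W) (Suc i) = occ (Suc i) 0 W"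
    using i by (auto simp: factor_enc)
  have ne: "unpL i 0 W \<noteq> {}" using arrow_eps[OF arr] by (simp add: unpL_empty_iff)
  \<comment> \<open>The successor of an odd letter is even and lies in no factor, so there is no
    shift.\<close>
  have s: "(LEAST j. ?a + j + 1 \<notin> set (occ (Suc i) 0 W)) = 0"
    using even_notin_occ[of "?a + 0 + 1"] by (intro Least_eq_0) simp
  have "RF_e i (enc n W) = Some (set_factor (Suc i) (set (occ (Suc i) 0 W) - {?a})
      (set_factor i (insert ?a (set (occ i 0 W))) (enc n W)))"
    using ne arrow_Max_unpL[OF *(2-4)] s i by (simp add: RF_e_def RF_unpaired_enc f Let_def)
  also have "set_factor (Suc i) (set (occ (Suc i) 0 W) - {?a})
      (set_factor i (insert ?a (set (occ i 0 W))) (enc n W)) = enc n V"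
  proof (rule factor_ext[where n = n])
    fix j assume "j \<in> {1..n}"
    then show "factor (set_factor (Suc i) (set (occ (Suc i) 0 W) - {?a})
      (set_factor i (insert ?a (set (occ i 0 W))) (enc n W))) j = factor (enc n V) j"
      using i unfolding * occ_change(1,2)[symmetric]
      by (cases "j = i"; cases "j = Suc i")
        (simp_all add: factor_set_factor factor_enc sorted_list_of_set_occ occ_change(5))
  qed simp_all
  finally show "RF_e i (enc n W) = Some (enc n V)" .
qed

lemma RF_f_enc:
  assumes i: "i \<in> {1..<n}"
  shows "phi i V = 0 \<Longrightarrow> RF_f i (enc n V) = None"
    and "arrow i V W \<Longrightarrow> RF_f i (enc n V) = Some (enc n W)"
proof -
  show "phi i V = 0 \<Longrightarrow> RF_f i (enc n V) = None"
    using i by (simp add: RF_f_def RF_unpaired_enc unpR_empty_iff)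
  assume arr: "arrow i V W"
  then obtain us vs where *: "V = us @ i # vs" "W = us @ Suc i # vs" "phi i us = 0" "eps i vs = 0"
    by (auto simp: arrow_def)
  let ?a = "2 * length us + 1"
  have f: "factor (enc n V) i = occ i 0 V" "factor (enc n V) (Suc i) = occ (Suc i) 0 V"
    using i by (auto simp: factor_enc)
  have ne: "unpR i 0 V \<noteq> {}" using arrow_phi[OF arr] by (simp add: unpR_empty_iff)
  have s: "(LEAST j. ?a - j - 1 \<notin> set (occ i 0 V)) = 0"
    using even_notin_occ[of "?a - 0 - 1"] by (intro Least_eq_0) simp
  have "RF_f i (enc n V) = Some (set_factor i (set (occ i 0 V) - {?a})
      (set_factor (Suc i) (insert ?a (set (occ (Suc i) 0 V))) (enc n V)))"
    using ne arrow_Min_unpR[OF *(1,3,4)] s i by (simp add: RF_f_def RF_unpaired_enc f Let_def)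
  also have "set_factor i (set (occ i 0 V) - {?a})
      (set_factor (Suc i) (insert ?a (set (occ (Suc i) 0 V))) (enc n V)) = enc n W"
  proof (rule factor_ext[where n = n])
    fix j assume "j \<in> {1..n}"
    then show "factor (set_factor i (set (occ i 0 V) - {?a})
      (set_factor (Suc i) (insert ?a (set (occ (Suc i) 0 V))) (enc n V))) j = factor (enc n W) j"
      using i unfolding * occ_change(3,4)[symmetric]
      by (cases "j = i"; cases "j = Suc i")
        (simp_all add: factor_set_factor factor_enc sorted_list_of_set_occ occ_change(5))
  qed simp_all
  finally show "RF_f i (enc n V) = Some (enc n W)" .
qed

lemma RF_wt_enc: "RF_wt (enc n W) j = (if j \<in> {1..n} then int (count_list W j) else 0)"
  by (simp add: RF_wt_def factor_enc length_occ)


section \<open>Reduced words of the product of commuting transpositions\<close>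

lemma word_perm_Nil [simp]: "word_perm [] = id"
  by (simp add: word_perm_def)

lemma word_perm_Cons [simp]: "word_perm (j # js) = transpose j (Suc j) \<circ> word_perm js"
  by (simp add: word_perm_def)

lemma word_perm_append: "word_perm (xs @ ys) = word_perm xs \<circ> word_perm ys"
  by (induction xs) (auto simp: comp_assoc)

lemma word_perm_permutes:
  assumes "\<forall>j\<in>set js. j \<in> S \<and> Suc j \<in> S"
  shows "word_perm js permutes S"
  using assms
proof (induction js)
  case (Cons j js)
  then show ?case unfolding word_perm_Cons by (intro permutes_compose permutes_swap_id) auto
qed (simp add: permutes_id)

text \<open>Transpositions with distinct odd indices have disjoint supports, so the product depends
  only on the set of letters.\<close>

lemma word_perm_odd:
  assumes "distinct js" "\<forall>j\<in>set js. odd j"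
  shows "word_perm js x = (if x \<in> set js then Suc x else if 0 < x \<and> x - 1 \<in> set js then x - 1 else x)"
  using assms
proof (induction js)
  case (Cons j js)
  have odd: "odd j" "\<forall>k\<in>set js. odd k" using Cons.prems by simp_all
  have "even (Suc j)" "even (j - 1)" using odd by simp_all
  then have "Suc j \<notin> set js" "j - 1 \<notin> set js" using odd(2) by metis+
  moreover have "j \<notin> set js" "0 < j" using Cons.prems odd_pos[OF odd(1)] by simp_all
  ultimately have j: "j \<notin> set js" "Suc j \<notin> set js" "j - 1 \<notin> set js" "0 < j" by simp_all
  have IH: "word_perm js x = (if x \<in> set js then Suc x else if 0 < x \<and> x - 1 \<in> set js then x - 1 else x)"
    using Cons by simp
  consider "x = j" | "x = Suc j" | "x \<noteq> j" "x \<noteq> Suc j" by blast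
  then show ?case
  proof cases
    case 3
    have "word_perm js x \<noteq> j" "word_perm js x \<noteq> Suc j"
      using 3 j unfolding IH by (metis diff_Suc_1 gr0_conv_Suc nat.inject)+
    moreover have "x - 1 \<noteq> j \<or> x = 0" using 3 by auto
    ultimately show ?thesis using 3 IH by (auto simp: transpose_def)
  qed (use j IH in simp_all)
qed simp

text \<open>No letter other than \<open>j\<close> moves a point from \<open>{0..j}\<close> beyond
  \<open>j\<close>. As the product of the odd transpositions sends each of its indices
  \<open>j\<close> to \<open>Suc j\<close>, every word for it must contain all of them.\<close>

lemma word_perm_le:
  assumes "j \<notin> set js" "x \<le> j"
  shows "word_perm js x \<le> j"
  using assms
proof (induction js)
  case (Cons k js)
  then show ?case by (auto simp: transpose_def)
qed auto

definition odds :: "nat \<Rightarrow> nat list" where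
  "odds N = map (\<lambda>p. 2 * p + 1) [0..<N]"

lemma distinct_odds: "distinct (odds N)"
  by (auto simp: odds_def distinct_map intro: inj_onI)

lemma odd_odds: "j \<in> set (odds N) \<Longrightarrow> odd j"
  by (auto simp: odds_def)

lemma odds_iff: "j \<in> set (odds N) \<longleftrightarrow> (\<exists>p<N. j = 2 * p + 1)"
  by (auto simp: odds_def)

lemma card_odds: "card (set (odds N)) = N"
  using distinct_card[OF distinct_odds] by (simp add: odds_def)

lemma word_for_odds_subset:
  assumes "word_for (word_perm (odds N)) js"
  shows "set (odds N) \<subseteq> set js"
proof
  fix j assume j: "j \<in> set (odds N)"
  have "word_perm (odds N) j = Suc j" using word_perm_odd[OF distinct_odds] odd_odds j by auto
  then show "j \<in> set js" using assms word_perm_le[of j js j] by (auto simp: word_for_def)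
qed

lemma perm_length_odds: "perm_length (word_perm (odds N)) = N"
  unfolding perm_length_def
proof (rule Least_equality)
  have "word_for (word_perm (odds N)) (odds N)" by (auto simp: word_for_def odds_def)
  then show "\<exists>js. word_for (word_perm (odds N)) js \<and> length js = N" by (auto simp: odds_def)
next
  fix m assume "\<exists>js. word_for (word_perm (odds N)) js \<and> length js = m"
  then obtain js where "word_for (word_perm (odds N)) js" "length js = m" by blast
  then show "N \<le> m"
    using card_mono[OF _ word_for_odds_subset[of N js]] card_odds[of N] card_length[of js] by auto
qed

text \<open>All N letters are forced and N letters suffice, so a reduced word is an arbitrary
  ordering of the letter set.\<close>

lemma reduced_word_odds:
  "reduced_word (word_perm (odds N)) js \<longleftrightarrow> distinct js \<and> set js = set (odds N)"
proof
  assume r: "reduced_word (word_perm (odds N)) js"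
  then have sub: "set (odds N) \<subseteq> set js" and len: "length js = N"
    using word_for_odds_subset perm_length_odds by (auto simp: reduced_word_def)
  have "card (set js) \<le> N" using len card_length[of js] by simp
  then have eq: "set js = set (odds N)" using card_seteq[OF _ sub] card_odds[of N] by simp
  then have "card (set js) = length js" using card_odds len by simp
  then show "distinct js \<and> set js = set (odds N)" using eq card_distinct by blast
next
  assume d: "distinct js \<and> set js = set (odds N)"
  have "word_perm js = word_perm (odds N)"
    using word_perm_odd[of js] word_perm_odd[OF distinct_odds] d odd_odds by (intro ext) simp
  moreover have "length js = N" using d distinct_card card_odds by metis
  ultimately show "reduced_word (word_perm (odds N)) js"
    using d by (auto simp: reduced_word_def word_for_def perm_length_odds odds_iff)
qed

lemma odds_S_infinity: "word_perm (odds N) \<in> S_infinity"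
proof -
  have p: "word_perm (odds N) permutes {1..2 * N}"
    by (rule word_perm_permutes) (auto simp: odds_iff)
  then have "word_perm (odds N) permutes {1..}" by (rule permutes_subset) auto
  moreover have "{i. word_perm (odds N) i \<noteq> i} \<subseteq> {1..2 * N}" using p by (auto simp: permutes_def)
  then have "finite {i. word_perm (odds N) i \<noteq> i}" by (rule finite_subset) simp
  ultimately show ?thesis by (simp add: S_infinity_def)
qed

definition words :: "nat \<Rightarrow> nat \<Rightarrow> nat list set" where
  "words n N = {W. length W = N \<and> set W \<subseteq> {1..n}}"

lemma finite_words: "finite (words n N)"
proof -
  have "words n N = {W. set W \<subseteq> {1..n} \<and> length W = N}" by (auto simp: words_def)
  then show ?thesis by (simp add: finite_lists_length_eq)
qed

lemma set_concat_enc: "W \<in> words n N \<Longrightarrow> set (concat (enc n W)) = set (odds N)"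
proof (intro set_eqI iffI)
  fix x assume W: "W \<in> words n N" and "x \<in> set (odds N)"
  then obtain p where p: "p < N" "x = 2 * p + 1" by (auto simp: odds_iff)
  then have "W ! p \<in> {1..n}" using W by (auto simp: words_def subset_iff)
  moreover have "x \<in> set (occ (W ! p) 0 W)" using p W by (auto simp: in_occ_iff words_def)
  ultimately show "x \<in> set (concat (enc n W))" by (auto simp: enc_def simp del: upt_Suc)
qed (auto simp: enc_def in_occ_iff odds_iff words_def)

lemma distinct_concat_disjoint:
  "distinct (concat xss) \<Longrightarrow> a < b \<Longrightarrow> b < length xss \<Longrightarrow> set (xss ! a) \<inter> set (xss ! b) = {}"
proof (induction xss arbitrary: a b)
  case (Cons xs xss)
  then obtain b' where b: "b = Suc b'" by (cases b) auto
  show ?case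
  proof (cases a)
    case 0
    have "set (xss ! b') \<subseteq> set (concat xss)" using Cons.prems b by auto
    then show ?thesis using 0 b Cons.prems by auto
  next
    case (Suc a')
    then show ?thesis using b Cons by auto
  qed
qed auto

lemma factor_disjoint:
  assumes "distinct (concat \<rho>)" "i \<in> {1..length \<rho>}" "j \<in> {1..length \<rho>}" "x \<in> set (factor \<rho> i)" "x \<in> set (factor \<rho> j)"
  shows "i = j"
proof (rule ccontr)
  assume "i \<noteq> j"
  then have "length \<rho> - i < length \<rho> - j \<or> length \<rho> - j < length \<rho> - i" using assms by auto
  moreover have "length \<rho> - i < length \<rho>" "length \<rho> - j < length \<rho>" using assms by auto
  ultimately show False
    using assms distinct_concat_disjoint[of \<rho> "length \<rho> - i" "length \<rho> - j"]
      distinct_concat_disjoint[of \<rho> "length \<rho> - j" "length \<rho> - i"]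
    unfolding factor_def by blast
qed

lemma RF_odds: "RF n (word_perm (odds N)) = enc n ` words n N"
proof
  show "enc n ` words n N \<subseteq> RF n (word_perm (odds N))"
  proof
    fix \<rho> assume "\<rho> \<in> enc n ` words n N"
    then obtain W where W: "W \<in> words n N" "\<rho> = enc n W" by auto
    \<comment> \<open>Counting factor by factor gives N letters in total; since N different letters
      occur, none is repeated.\<close>
    have "length (concat (enc n W)) = sum_list (map (count_list W) (rev [1..<Suc n]))"
      by (simp add: enc_def length_concat comp_def length_occ)
    also have "\<dots> = sum (count_list W) (set [1..<Suc n])"
      by (simp add: rev_map[symmetric] sum_list_rev sum_list_distinct_conv_sum_set del: upt_Suc)
    also have "\<dots> = sum (count_list W) {1..n}" by (metis atLeastLessThanSuc_atLeastAtMost set_upt)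
    also have "\<dots> = N" using W sum_count_set[of W "{1..n}"] by (auto simp: words_def)
    finally have "distinct (concat (enc n W))"
      using set_concat_enc[OF W(1)] card_odds by (intro card_distinct) simp
    moreover have "\<forall>r\<in>set (enc n W). sorted_wrt (<) r" by (auto simp: enc_def occ_sorted)
    ultimately show "\<rho> \<in> RF n (word_perm (odds N))"
      using W set_concat_enc[OF W(1)] by (simp add: RF_def reduced_word_odds)
  qed
  show "RF n (word_perm (odds N)) \<subseteq> enc n ` words n N"
  proof
    fix \<rho> assume "\<rho> \<in> RF n (word_perm (odds N))"
    then have len: "length \<rho> = n" and sorted: "\<forall>r\<in>set \<rho>. sorted_wrt (<) r"
      and d: "distinct (concat \<rho>)" and s: "set (concat \<rho>) = set (odds N)"
      by (auto simp: RF_def reduced_word_odds)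
    have mem: "factor \<rho> j \<in> set \<rho>" if "j \<in> {1..n}" for j
      using that len by (auto simp: factor_def)
    have "\<exists>j\<in>{1..n}. 2 * p + 1 \<in> set (factor \<rho> j)" if "p < N" for p
    proof -
      have "2 * p + 1 \<in> set (concat \<rho>)" using s that by (auto simp: odds_iff)
      then obtain r where "r \<in> set \<rho>" "2 * p + 1 \<in> set r" by auto
      then obtain a where a: "a < n" "2 * p + 1 \<in> set (\<rho> ! a)" using len by (metis in_set_conv_nth)
      then show ?thesis using len by (intro bexI[of _ "n - a"]) (auto simp: factor_def)
    qed
    \<comment> \<open>\<open>g p\<close> is the index of the factor that contains the letter of
      position \<open>p\<close>; the list of these indices is the preimage word.\<close>
    then obtain g where g: "\<And>p. p < N \<Longrightarrow> g p \<in> {1..n} \<and> 2 * p + 1 \<in> set (factor \<rho> (g p))" by metis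
    define W where "W = map g [0..<N]"
    have W: "W \<in> words n N" using g by (auto simp: W_def words_def)
    have "\<rho> = enc n W"
    proof (rule factor_ext[where n = n])
      fix j assume j: "j \<in> {1..n}"
      have "set (factor \<rho> j) = set (occ j 0 W)"
      proof (intro set_eqI iffI)
        fix x assume x: "x \<in> set (factor \<rho> j)"
        then have "x \<in> set (odds N)" using mem[OF j] s by auto
        then obtain p where p: "p < N" "x = 2 * p + 1" by (auto simp: odds_iff)
        have "g p = j" using factor_disjoint[OF d, of "g p" j x] g[OF p(1)] j len x p by simp
        then show "x \<in> set (occ j 0 W)" using p by (auto simp: in_occ_iff W_def)
      next
        fix x assume "x \<in> set (occ j 0 W)"
        then show "x \<in> set (factor \<rho> j)" using g by (auto simp: in_occ_iff W_def)
      qed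
      moreover have "sorted_wrt (<) (factor \<rho> j)" using sorted mem[OF j] by auto
      ultimately have "factor \<rho> j = occ j 0 W" using occ_sorted strict_sorted_equal by blast
      then show "factor \<rho> j = factor (enc n W) j" using j by (simp add: factor_enc)
    qed (simp_all add: len)
    then show "\<rho> \<in> enc n ` words n N" using W by auto
  qed
qed

lemma inj_on_enc: "inj_on (enc n) (words n N)"
proof (rule inj_onI, rule nth_equalityI)
  fix W W' assume W: "W \<in> words n N" "W' \<in> words n N" "enc n W = enc n W'"
  then show "length W = length W'" by (auto simp: words_def)
  fix p assume p: "p < length W"
  then have j: "W ! p \<in> {1..n}" using W by (auto simp: words_def subset_iff)
  have "2 * p + 1 \<in> set (occ (W ! p) 0 W)" using p by (auto simp: in_occ_iff)
  also have "occ (W ! p) 0 W = occ (W ! p) 0 W'" using W(3) factor_enc[OF j] by metis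
  finally show "W ! p = W' ! p" by (auto simp: in_occ_iff)
qed

section \<open>Key tableaux\<close>

text \<open>Absent boxes have entry 0, so the row and key conditions can be stated without
  membership in the diagram: being larger than another entry already makes \<open>(a, Suc c)\<close>
  a box. Both conditions start at column 1, since column 0 consists of dummy zeros.\<close>

definition KT :: "(nat \<Rightarrow> nat) \<Rightarrow> tableau \<Rightarrow> bool" where
  "KT \<alpha> T \<longleftrightarrow> (\<forall>r c. T r c \<noteq> 0 \<longleftrightarrow> 1 \<le> c \<and> c \<le> \<alpha> r) \<and> (\<forall>r c. 1 \<le> c \<longrightarrow> T r (Suc c) \<le> T r c) \<and>
     (\<forall>a b c. a \<noteq> b \<longrightarrow> T a c \<noteq> 0 \<longrightarrow> T a c \<noteq> T b c) \<and>
     (\<forall>a b c. 1 \<le> c \<longrightarrow> a < b \<longrightarrow> T b c \<noteq> 0 \<longrightarrow> T b c < T a c \<longrightarrow> T b c < T a (Suc c))"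

lemma KT_D:
  assumes "KT \<alpha> T"
  shows KT_box: "T r c \<noteq> 0 \<longleftrightarrow> 1 \<le> c \<and> c \<le> \<alpha> r"
    and KT_row: "1 \<le> c \<Longrightarrow> T r (Suc c) \<le> T r c"
    and KT_col: "T a c \<noteq> 0 \<Longrightarrow> T a c = T b c \<Longrightarrow> a = b"
    and KT_cond: "1 \<le> c \<Longrightarrow> a < b \<Longrightarrow> T b c \<noteq> 0 \<Longrightarrow> T b c < T a c \<Longrightarrow> T b c < T a (Suc c)"
  using assms unfolding KT_def by blast+

lemma KT_row_mono:
  assumes "KT \<alpha> T" "1 \<le> c" "c \<le> c'"
  shows "T r c' \<le> T r c"
  using assms(3)
proof (induction rule: dec_induct)
  case (step c')
  then show ?case using KT_row[OF assms(1), of c' r] assms(2) by linarith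
qed simp

lemma initial_segment:
  fixes A :: "nat set"
  assumes "finite A" "\<And>c. c \<in> A \<Longrightarrow> 1 \<le> c \<and> {1..c} \<subseteq> A"
  shows "A = {1..card A}"
proof (cases "A = {}")
  case False
  then have "Max A \<in> A" using Max_in[OF assms(1)] by simp
  then have "{1..Max A} \<subseteq> A" using assms(2) by blast
  moreover have "A \<subseteq> {1..Max A}" using assms Max_ge[OF assms(1)] by auto
  ultimately have eq: "A = {1..Max A}" by (rule equalityI[rotated])
  then have "card A = card {1..Max A}" by (rule arg_cong)
  then have "card A = Max A" by simp
  then show ?thesis using eq by simp
qed auto

lemma finite_KT_boxes:
  assumes "weak_composition \<alpha>" "KT \<alpha> T"
  shows "finite (boxes T)"
proof -
  have "boxes T \<subseteq> Sigma {r. \<alpha> r \<noteq> 0} (\<lambda>r. {1..\<alpha> r})"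
    using KT_box[OF assms(2)] by (force simp: boxes_def)
  moreover have "finite (Sigma {r. \<alpha> r \<noteq> 0} (\<lambda>r. {1..\<alpha> r}))"
    using assms(1) by (auto simp: weak_composition_def)
  ultimately show ?thesis by (rule finite_subset)
qed

text \<open>Rows decrease weakly, so the flag is a condition on column 1 alone; empty rows satisfy
  it trivially.\<close>

lemma SSKT_iff:
  assumes wc: "weak_composition \<alpha>"
  shows "T \<in> SSKT \<alpha> \<phi> \<longleftrightarrow> KT \<alpha> T \<and> (\<forall>r. T r 1 \<le> \<phi> r)"
proof
  assume "T \<in> SSKT \<alpha> \<phi>"
  then have kt: "key_tableau T" and sh: "shape T = \<alpha>" and fl: "flagged \<phi> T" by (auto simp: SSKT_def)
  then have tab: "is_tableau T" by (simp add: key_tableau_def)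
  have box: "T r c \<noteq> 0 \<longleftrightarrow> 1 \<le> c \<and> c \<le> \<alpha> r" for r c
  proof -
    have "finite (snd ` boxes T)" using tab by (simp add: is_tableau_def)
    moreover have "{c. (r, c) \<in> boxes T} \<subseteq> snd ` boxes T" by force
    ultimately have "finite {c. (r, c) \<in> boxes T}" by (rule rev_finite_subset)
    then have e: "{c. (r, c) \<in> boxes T} = {1..card {c. (r, c) \<in> boxes T}}"
      using tab by (intro initial_segment) (auto simp: is_tableau_def)
    have "card {c. (r, c) \<in> boxes T} = \<alpha> r" by (simp add: shape_def flip: sh)
    then have "{1..card {c. (r, c) \<in> boxes T}} = {1..\<alpha> r}" by simp
    with e have "{c. (r, c) \<in> boxes T} = {1..\<alpha> r}" by (rule trans)
    then have "c \<in> {c. (r, c) \<in> boxes T} \<longleftrightarrow> c \<in> {1..\<alpha> r}" by (rule arg_cong)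
    then show ?thesis unfolding boxes_def by simp
  qed
  have row: "T r (Suc c) \<le> T r c" if "1 \<le> c" for r c
  proof (cases "T r (Suc c) = 0")
    case False
    then have "T r c \<noteq> 0" using box[of r c] box[of r "Suc c"] that by auto
    then show ?thesis using kt False unfolding key_tableau_def boxes_def by auto
  qed simp
  have "T r 1 \<le> \<phi> r" for r
    using fl unfolding flagged_def boxes_def by (cases "T r 1 = 0") auto
  moreover have "\<forall>a b c. a \<noteq> b \<longrightarrow> T a c \<noteq> 0 \<longrightarrow> T a c \<noteq> T b c"
    using kt unfolding key_tableau_def boxes_def mem_Collect_eq prod.case by (metis (no_types))
  moreover have "\<forall>a b c. 1 \<le> c \<longrightarrow> a < b \<longrightarrow> T b c \<noteq> 0 \<longrightarrow> T b c < T a c \<longrightarrow> T b c < T a (Suc c)"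
  proof (intro allI impI)
    fix a b c :: nat assume "1 \<le> c" "a < b" "T b c \<noteq> 0" "T b c < T a c"
    moreover have "T a c \<noteq> 0" using calculation by simp
    ultimately show "T b c < T a (Suc c)"
      using kt unfolding key_tableau_def boxes_def mem_Collect_eq prod.case by blast
  qed
  ultimately show "KT \<alpha> T \<and> (\<forall>r. T r 1 \<le> \<phi> r)" using box row unfolding KT_def by auto
next
  assume *: "KT \<alpha> T \<and> (\<forall>r. T r 1 \<le> \<phi> r)"
  then have kt: "KT \<alpha> T" by simp
  note box = KT_box[OF kt]
  have "is_tableau T"
    using finite_KT_boxes[OF wc kt] wc box
    unfolding is_tableau_def boxes_def weak_composition_def
    by (auto simp: Suc_le_eq) (metis gr0I le_zero_eq not_gr0)
  moreover have "T r c' \<le> T r c" if "(r, c) \<in> boxes T" "c \<le> c'" for r c c'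
    using KT_row_mono[OF kt, of c c' r] that box by (auto simp: boxes_def)
  moreover have "T i c \<noteq> T k c" if "(i, c) \<in> boxes T" "i \<noteq> k" for i k c
    using KT_col[OF kt] that by (auto simp: boxes_def)
  moreover have "(i, Suc j) \<in> boxes T \<and> T i (Suc j) > T k j"
    if "(k, j) \<in> boxes T" "i < k" "T i j > T k j" for i j k
    using KT_cond[OF kt, of j i k] that box[of k j] by (auto simp: boxes_def)
  ultimately have "key_tableau T" unfolding key_tableau_def by blast
  moreover have "shape T = \<alpha>"
  proof
    fix r
    have "{c. (r, c) \<in> boxes T} = {1..\<alpha> r}" using box by (auto simp: boxes_def)
    then show "shape T r = \<alpha> r" by (simp add: shape_def)
  qed
  moreover have "T i j \<le> \<phi> i" if "T i j \<noteq> 0" for i j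
  proof -
    have "T i j \<le> T i 1" using KT_row_mono[OF kt, of 1 j i] box[of i j] that by simp
    then show ?thesis using * le_trans by blast
  qed
  then have "flagged \<phi> T" by (auto simp: flagged_def boxes_def)
  ultimately show "T \<in> SSKT \<alpha> \<phi>" by (simp add: SSKT_def)
qed

section \<open>Columns and their excess\<close>

definition colset :: "tableau \<Rightarrow> nat \<Rightarrow> nat set" where
  "colset T c = {T r c | r. T r c \<noteq> 0}"

lemma in_colset: "x \<in> colset T c \<longleftrightarrow> x \<noteq> 0 \<and> (\<exists>r. T r c = x)"
  by (auto simp: colset_def)

definition col_excess :: "nat \<Rightarrow> tableau \<Rightarrow> nat \<Rightarrow> int" where
  "col_excess i T c = of_bool (Suc i \<in> colset T c) - of_bool (i \<in> colset T c)"

definition prefix_excess :: "nat \<Rightarrow> tableau \<Rightarrow> nat \<Rightarrow> int" where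
  "prefix_excess i T c = (\<Sum>j = 1..c. col_excess i T j)"

lemma prefix_excess_0 [simp]: "prefix_excess i T 0 = 0" by (simp add: prefix_excess_def)

lemma prefix_excess_Suc: "prefix_excess i T (Suc c) = prefix_excess i T c + col_excess i T (Suc c)" by (simp add: prefix_excess_def)

text \<open>This is the excess of the suffix of the column reading word starting at box
  \<open>(r, c)\<close>: the suffix covers the columns left of \<open>c\<close> and the rows up to
  \<open>r\<close> in column \<open>c\<close>. Indicators suffice because an entry occurs at most
  once in a column.\<close>

definition box_excess :: "nat \<Rightarrow> tableau \<Rightarrow> nat \<Rightarrow> nat \<Rightarrow> int" where
  "box_excess i T r c = prefix_excess i T (c - 1) + of_bool (\<exists>r'\<le>r. T r' c = Suc i) - of_bool (\<exists>r'\<le>r. T r' c = i)"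

lemma finite_rows:
  assumes "weak_composition \<alpha>" "KT \<alpha> T"
  shows "finite {r. T r c \<noteq> 0}"
proof (rule finite_subset)
  show "{r. T r c \<noteq> 0} \<subseteq> {r. \<alpha> r \<noteq> 0}" using KT_box[OF assms(2)] by force
qed (use assms in \<open>simp add: weak_composition_def\<close>)

lemma finite_colset:
  assumes "weak_composition \<alpha>" "KT \<alpha> T"
  shows "finite (colset T c)"
proof -
  have "colset T c = (\<lambda>r. T r c) ` {r. T r c \<noteq> 0}" by (auto simp: colset_def)
  then show ?thesis using finite_rows[OF assms] by simp
qed

subsection \<open>The column reading word\<close>

text \<open>The order is from left to right and upwards, opposite to the reading order:
  \<open>after x y\<close> means that \<open>x\<close> is read before \<open>y\<close>. Hence the
  suffix from a box on consists of the boxes that are not \<open>after\<close> it.\<close>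

definition after :: "nat \<times> nat \<Rightarrow> nat \<times> nat \<Rightarrow> bool" where
  "after x y \<longleftrightarrow> snd y < snd x \<or> snd y = snd x \<and> fst y < fst x"

lemma sorted_wrt_concat_map:
  assumes "sorted_wrt Q xs" "\<And>x. x \<in> set xs \<Longrightarrow> sorted_wrt R (f x)"
    "\<And>x y a b. Q x y \<Longrightarrow> a \<in> set (f x) \<Longrightarrow> b \<in> set (f y) \<Longrightarrow> R a b"
  shows "sorted_wrt R (concat (map f xs))"
  using assms(1,2)
proof (induction xs)
  case (Cons x xs)
  have "R a b" if "a \<in> set (f x)" "b \<in> set (concat (map f xs))" for a b
  proof -
    obtain y where "y \<in> set xs" "b \<in> set (f y)" using \<open>b \<in> _\<close> by auto
    then show ?thesis using assms(3)[of x y a b] Cons.prems(1) that by simp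
  qed
  then show ?case using Cons by (simp add: sorted_wrt_append)
qed simp

lemma sorted_rev_upt: "sorted_wrt (>) (rev [1..<n::nat])"
  using sorted_wrt_upt[of 1 n] by (simp add: sorted_wrt_rev)

lemma col_boxes_sorted: "sorted_wrt after (col_boxes T)"
  unfolding col_boxes_def
  by (intro sorted_wrt_concat_map[where Q = "(>)"] sorted_rev_upt)
    (auto simp: after_def split: if_splits)

lemma set_col_boxes:
  assumes "weak_composition \<alpha>" "KT \<alpha> T"
  shows "set (col_boxes T) = boxes T"
proof -
  have fin: "finite (boxes T)" by (rule finite_KT_boxes[OF assms])
  have "1 \<le> r \<and> r < Suc (height T) \<and> 1 \<le> c \<and> c < Suc (width T)" if "(r, c) \<in> boxes T" for r c
  proof -
    have "r \<le> height T" "c \<le> width T"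
      using that fin unfolding height_def width_def by (auto intro!: Max_ge rev_image_eqI)
    moreover have "1 \<le> c" "c \<le> \<alpha> r" using KT_box[OF assms(2), of r c] that by (auto simp: boxes_def)
    moreover have "r \<noteq> 0" using assms(1) calculation(3,4) by (cases r) (auto simp: weak_composition_def)
    ultimately show ?thesis by simp
  qed
  then show ?thesis by (auto simp: col_boxes_def simp del: upt_Suc)
qed

lemma set_drop_sorted:
  assumes "sorted_wrt R L" "\<And>x y. R x y \<Longrightarrow> \<not> R y x" "q < length L"
  shows "set (drop q L) = {x \<in> set L. \<not> R x (L ! q)}"
proof -
  have "\<not> R x (L ! q)" if x: "x \<in> set (drop q L)" for x
  proof -
    have "\<exists>j. q \<le> j \<and> j < length L \<and> x = L ! j"
    proof -
      obtain k where "k < length (drop q L)" "x = drop q L ! k" using x by (metis in_set_conv_nth)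
      then show ?thesis by (intro exI[of _ "q + k"]) auto
    qed
    then obtain j where j: "q \<le> j" "j < length L" "x = L ! j" by blast
    then show ?thesis using sorted_wrt_nth_less[OF assms(1), of q j] assms(2) by (cases "q = j") auto
  qed
  moreover have "x \<in> set (drop q L)" if "x \<in> set L" "\<not> R x (L ! q)" for x
  proof -
    obtain j where j: "j < length L" "x = L ! j" using \<open>x \<in> set L\<close> by (auto simp: in_set_conv_nth)
    then have "\<not> j < q" using sorted_wrt_nth_less[OF assms(1), of j q] assms(3) that(2) by auto
    then have "j - q < length (drop q L)" "x = drop q L ! (j - q)" using j by auto
    then show ?thesis by (metis nth_mem)
  qed
  ultimately show ?thesis using set_drop_subset by fast
qed

lemma count_list_map_card: "distinct xs \<Longrightarrow> count_list (map f xs) y = card {x \<in> set xs. f x = y}"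
proof (induction xs)
  case (Cons a xs)
  have "{x \<in> set (a # xs). f x = y} = (if f a = y then insert a else id) {x \<in> set xs. f x = y}" by auto
  then show ?case using Cons by auto
qed simp

text \<open>Send each such box to its column: this is injective since a column contains
  \<open>i\<close> at most once.\<close>

lemma count_before:
  assumes wc: "weak_composition \<alpha>" and kt: "KT \<alpha> T" and i: "1 \<le> i"
    and box: "(r, c) \<in> boxes T"
  shows "int (card {x \<in> boxes T. \<not> after x (r, c) \<and> (case x of (r', c') \<Rightarrow> T r' c' = i)}) =
    (\<Sum>j = 1..c - 1. of_bool (i \<in> colset T j)) + of_bool (\<exists>r'\<le>r. T r' c = i)"
proof -
  let ?S = "{x \<in> boxes T. \<not> after x (r, c) \<and> (case x of (r', c') \<Rightarrow> T r' c' = i)}"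
  let ?A = "{j \<in> {1..c - 1}. i \<in> colset T j}"
  let ?B = "if \<exists>r'\<le>r. T r' c = i then {c} else {}"
  have c: "1 \<le> c" using KT_box[OF kt, of r c] box by (auto simp: boxes_def)
  have inj: "inj_on snd ?S"
  proof (rule inj_onI)
    fix x y assume "x \<in> ?S" "y \<in> ?S" "snd x = snd y"
    moreover obtain a b a' b' where "x = (a, b)" "y = (a', b')" by fastforce
    ultimately show "x = y" using KT_col[OF kt, of a b a'] i by simp
  qed
  have "snd ` ?S = ?A \<union> ?B"
  proof (intro set_eqI iffI)
    fix j assume "j \<in> snd ` ?S"
    then obtain r' where "(r', j) \<in> boxes T" "\<not> after (r', j) (r, c)" "T r' j = i"
      by auto
    then have r': "(r', j) \<in> boxes T" "j < c \<or> j = c \<and> r' \<le> r" "T r' j = i"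
      by (auto simp: after_def)
    moreover have "1 \<le> j" using KT_box[OF kt, of r' j] r'(1) by (auto simp: boxes_def)
    ultimately show "j \<in> ?A \<union> ?B" using i by (auto simp: in_colset)
  next
    fix j assume "j \<in> ?A \<union> ?B"
    then have "\<exists>r'. T r' j = i \<and> (j < c \<or> j = c \<and> r' \<le> r)"
      using c by (auto simp: in_colset split: if_splits)
    then obtain r' where "T r' j = i" "j < c \<or> j = c \<and> r' \<le> r" by blast
    then show "j \<in> snd ` ?S" using i by (intro image_eqI[of _ _ "(r', j)"]) (auto simp: boxes_def after_def)
  qed
  then have "card ?S = card (?A \<union> ?B)" using card_image[OF inj] by simp
  also have "\<dots> = card ?A + card ?B" using c by (intro card_Un_disjoint) auto
  finally have "int (card ?S) = int (card ?A) + int (card ?B)" by simp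
  moreover have "int (card ?A) = (\<Sum>j = 1..c - 1. of_bool (i \<in> colset T j))"
    by (simp add: sum_of_bool_eq Int_def)
  moreover have "int (card ?B) = of_bool (\<exists>r'\<le>r. T r' c = i)" by simp
  ultimately show ?thesis by (simp only:)
qed

lemma suffix_excess_box_excess:
  assumes wc: "weak_composition \<alpha>" and kt: "KT \<alpha> T" and i: "1 \<le> i"
    and q: "q < length (col_boxes T)" "col_boxes T ! q = (r, c)"
  shows "suffix_excess i (col_reading T) q = box_excess i T r c"
proof -
  have asym: "\<And>x y. after x y \<Longrightarrow> \<not> after y x" by (auto simp: after_def)
  have dist: "distinct (col_boxes T)"
    using col_boxes_sorted[of T] asym unfolding distinct_conv_nth sorted_wrt_iff_nth_less
    by (metis nat_neq_iff)
  have box: "(r, c) \<in> boxes T" using q set_col_boxes[OF wc kt] nth_mem by metis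
  have "int (count_list (drop q (col_reading T)) l) =
    (\<Sum>j = 1..c - 1. of_bool (l \<in> colset T j)) + of_bool (\<exists>r'\<le>r. T r' c = l)" if "1 \<le> l" for l
  proof -
    have "count_list (drop q (col_reading T)) l =
        card {x \<in> set (drop q (col_boxes T)). (case x of (r', c') \<Rightarrow> T r' c') = l}"
      using dist by (simp add: col_reading_def drop_map count_list_map_card)
    also have "{x \<in> set (drop q (col_boxes T)). (case x of (r', c') \<Rightarrow> T r' c') = l} =
       {x \<in> boxes T. \<not> after x (r, c) \<and> (case x of (r', c') \<Rightarrow> T r' c' = l)}"
      using set_drop_sorted[OF col_boxes_sorted asym q(1)] q(2) set_col_boxes[OF wc kt] by auto
    finally show ?thesis using count_before[OF wc kt that box] by simp
  qed
  from this[of i] this[of "Suc i"] show ?thesis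
    using i unfolding suffix_excess_def box_excess_def prefix_excess_def col_excess_def by (simp add: sum_subtractf)
qed

text \<open>The suffix starting at the topmost box of a column covers exactly this column and all
  columns to its left, and empty columns contribute nothing. So \<open>max_excess\<close>, a maximum
  over boxes, bounds the excess of whole columns too.\<close>

lemma prefix_excess_attained:
  assumes wc: "weak_composition \<alpha>" and kt: "KT \<alpha> T" and i: "1 \<le> i"
  shows "prefix_excess i T c = 0 \<or> (\<exists>r c'. c' \<le> c \<and> (r, c') \<in> boxes T \<and> box_excess i T r c' = prefix_excess i T c)"
proof (induction c)
  case (Suc c)
  show ?case
  proof (cases "{r. T r (Suc c) \<noteq> 0} = {}")
    case True
    then have "col_excess i T (Suc c) = 0" by (simp add: col_excess_def colset_def)
    then show ?thesis using Suc by (auto simp: prefix_excess_Suc intro: le_SucI)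
  next
    case False
    let ?r = "Max {r. T r (Suc c) \<noteq> 0}"
    have r: "T ?r (Suc c) \<noteq> 0" "\<And>r. T r (Suc c) \<noteq> 0 \<Longrightarrow> r \<le> ?r"
      using Max_in[OF finite_rows[OF wc kt] False] Max_ge[OF finite_rows[OF wc kt]] by auto
    have "l \<in> colset T (Suc c) \<longleftrightarrow> (\<exists>r'\<le>?r. T r' (Suc c) = l)" if "l \<noteq> 0" for l
      using r that by (auto simp: in_colset)
    from this[of i] this[of "Suc i"] have "box_excess i T ?r (Suc c) = prefix_excess i T (Suc c)"
      using i unfolding box_excess_def prefix_excess_Suc col_excess_def by simp
    then show ?thesis using r by (auto simp: boxes_def)
  qed
qed simp

subsection \<open>The raising operator\<close>

lemma max_excess_ge: "q \<le> length \<rho> \<Longrightarrow> suffix_excess i \<rho> q \<le> max_excess i \<rho>"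
  unfolding max_excess_def by (intro Max_ge) auto

lemma length_col_reading: "length (col_reading T) = length (col_boxes T)"
  by (simp add: col_reading_def)

lemma box_excess_le_max_excess:
  assumes "weak_composition \<alpha>" "KT \<alpha> T" "1 \<le> i" "(r, c) \<in> boxes T"
  shows "box_excess i T r c \<le> max_excess i (col_reading T)"
proof -
  obtain q where "q < length (col_boxes T)" "col_boxes T ! q = (r, c)"
    using assms(4) set_col_boxes[OF assms(1,2)] by (metis in_set_conv_nth)
  then show ?thesis
    using suffix_excess_box_excess[OF assms(1-3)] max_excess_ge[of q "col_reading T" i] length_col_reading[of T]
    by simp
qed

lemma tableau_e_None:
  assumes "weak_composition \<alpha>" "KT \<alpha> T" "1 \<le> i" "tableau_e i T = None"
  shows "prefix_excess i T c \<le> 0"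
proof -
  have "max_excess i (col_reading T) \<le> 0"
    using assms(4) by (auto simp: tableau_e_def Let_def split: if_splits prod.splits)
  then show ?thesis
    using prefix_excess_attained[OF assms(1-3), of c] box_excess_le_max_excess[OF assms(1-3)] by force
qed

text \<open>The distinguished position is the largest maximiser, so every box read later has
  strictly smaller excess; this strictness drives the analysis of the raising step.\<close>

lemma excess_pos_box:
  assumes wc: "weak_composition \<alpha>" and kt: "KT \<alpha> T" and i: "1 \<le> i"
    and M: "max_excess i (col_reading T) > 0"
    and rc: "col_boxes T ! excess_pos i (col_reading T) = (r, c)"
  shows "(r, c) \<in> boxes T" "box_excess i T r c = max_excess i (col_reading T)"
    "(r', c') \<in> boxes T \<Longrightarrow> after (r, c) (r', c') \<Longrightarrow> box_excess i T r' c' < max_excess i (col_reading T)"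
proof -
  let ?\<rho> = "col_reading T" and ?M = "max_excess i (col_reading T)"
  let ?Q = "{q. q < length ?\<rho> \<and> suffix_excess i ?\<rho> q = ?M}"
  have "?M \<in> suffix_excess i ?\<rho> ` {0..length ?\<rho>}" unfolding max_excess_def by (intro Max_in) auto
  then obtain q where q: "q \<le> length ?\<rho>" "suffix_excess i ?\<rho> q = ?M" by auto
  \<comment> \<open>The empty suffix has excess 0, below the positive maximum.\<close>
  have "q \<noteq> length ?\<rho>" using q(2) M by (auto simp: suffix_excess_def)
  then have "q \<in> ?Q" using q by simp
  then have ne: "?Q \<noteq> {}" by blast
  have fin: "finite ?Q" by simp
  have in_Q: "excess_pos i ?\<rho> \<in> ?Q" using Max_in[OF fin ne] unfolding excess_pos_def .
  then have len: "excess_pos i ?\<rho> < length (col_boxes T)" by (simp add: length_col_reading)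
  show "(r, c) \<in> boxes T" using len rc set_col_boxes[OF wc kt] nth_mem by metis
  show "box_excess i T r c = ?M" using suffix_excess_box_excess[OF wc kt i len rc] in_Q by simp
  assume box: "(r', c') \<in> boxes T" and a: "after (r, c) (r', c')"
  obtain p where p: "p < length (col_boxes T)" "col_boxes T ! p = (r', c')"
    using box set_col_boxes[OF wc kt] by (metis in_set_conv_nth)
  have "\<not> p \<le> excess_pos i ?\<rho>"
  proof
    assume "p \<le> excess_pos i ?\<rho>"
    then have "(r', c') = (r, c) \<or> after (r', c') (r, c)"
      using sorted_wrt_nth_less[OF col_boxes_sorted[of T], of p "excess_pos i ?\<rho>"] len p rc
      by (cases "p = excess_pos i ?\<rho>") auto
    then show False using a by (auto simp: after_def)
  qed
  then have "p \<notin> ?Q" using Max_ge[OF fin] unfolding excess_pos_def by blast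
  then show "box_excess i T r' c' < ?M"
    using p suffix_excess_box_excess[OF wc kt i p] max_excess_ge[of p ?\<rho> i] by (auto simp: length_col_reading)
qed

text \<open>Here \<open>(r0, c0)\<close> is the distinguished box and \<open>c1\<close> the last
  column in which row \<open>r0\<close> contains \<open>Suc i\<close>. The validity of the raised
  tableau, its word and its first column are all read off from this list of properties.\<close>

lemma tableau_e_Some:
  assumes wc: "weak_composition \<alpha>" and kt: "KT \<alpha> T" and i: "1 \<le> i" and e: "tableau_e i T = Some U"
  obtains r0 c0 c1 where "1 \<le> c0" "c0 \<le> c1" "\<And>c. c0 \<le> c \<Longrightarrow> c \<le> c1 \<Longrightarrow> T r0 c = Suc i" "T r0 (Suc c1) \<le> i"
    "\<And>c. c0 \<le> c \<Longrightarrow> c < c1 \<Longrightarrow> \<exists>k>r0. T k c = i" "\<And>r. T r c1 \<noteq> i"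
    "\<And>r c. r < r0 \<Longrightarrow> c0 \<le> c \<Longrightarrow> c \<le> c1 \<Longrightarrow> T r c \<noteq> i"
    "\<And>c. c < c1 \<Longrightarrow> prefix_excess i T c < prefix_excess i T c1" "\<And>c. prefix_excess i T c \<le> prefix_excess i T c1" "prefix_excess i T (c0 - 1) = prefix_excess i T c1 - 1"
    "\<And>k. r0 < k \<Longrightarrow> 2 \<le> c0 \<Longrightarrow> T k (c0 - 1) \<noteq> i" "prefix_excess i T (c1 - 1) = prefix_excess i T c1 - 1"
    "U = (\<lambda>r c. if c0 \<le> c \<and> c \<le> c1 then transpose i (Suc i) (T r c) else T r c)"
proof -
  define M where "M = max_excess i (col_reading T)"
  have M: "M > 0" using e unfolding M_def tableau_e_def by (auto split: if_splits)
  obtain r0 c0 where rc: "col_boxes T ! excess_pos i (col_reading T) = (r0, c0)" by fastforce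
  note pos = excess_pos_box[OF wc kt i M[unfolded M_def] rc, folded M_def]
  have U: "U = (\<lambda>r c. if r = r0 \<and> c0 \<le> c \<and> T r c = Suc i then i
       else if T r c = i \<and> c0 \<le> c \<and> T r0 c = Suc i then Suc i else T r c)"
    using e M rc unfolding M_def tableau_e_def by (auto simp: Let_def)
  have le: "box_excess i T r c \<le> M" if "(r, c) \<in> boxes T" for r c
    using box_excess_le_max_excess[OF wc kt i that] by (simp add: M_def)
  have c0: "1 \<le> c0" using KT_box[OF kt, of r0 c0] pos(1) by (auto simp: boxes_def)
  have cE_le: "prefix_excess i T c \<le> M" for c
    using prefix_excess_attained[OF wc kt i, of c] le M by force
  have cE_less: "prefix_excess i T c < M" if "c < c0" for c
  proof -
    have "box_excess i T r c' < M" if "c' \<le> c" "(r, c') \<in> boxes T" for r c'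
      using pos(3)[OF that(2)] that \<open>c < c0\<close> by (auto simp: after_def)
    then show ?thesis using prefix_excess_attained[OF wc kt i, of c] M by force
  qed
  have pE0: "box_excess i T r0 c0 = M" by (rule pos(2))
  have "prefix_excess i T (c0 - 1) < M" using cE_less c0 by simp
  \<comment> \<open>Column \<open>c0\<close> up to row \<open>r0\<close> adds at most 1 to an excess
    below M and yields M. Hence it adds exactly 1: \<open>Suc i\<close> has been met there and
    \<open>i\<close> has not.\<close>
  then have cEp: "prefix_excess i T (c0 - 1) = M - 1" and ex1: "\<exists>r'\<le>r0. T r' c0 = Suc i" and ni: "\<forall>r'\<le>r0. T r' c0 \<noteq> i"
    using pE0 unfolding box_excess_def by (auto simp: of_bool_def split: if_splits)
  obtain r' where r': "r' \<le> r0" "T r' c0 = Suc i" using ex1 by blast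
  \<comment> \<open>A lower box containing \<open>Suc i\<close> would attain M as well, although it
    is read later.\<close>
  have "r' = r0"
  proof (rule ccontr)
    assume "r' \<noteq> r0"
    then have "after (r0, c0) (r', c0)" using r' by (simp add: after_def)
    moreover have "(r', c0) \<in> boxes T" using r' by (simp add: boxes_def)
    ultimately have "box_excess i T r' c0 < M" by (rule pos(3)[rotated])
    moreover have "box_excess i T r' c0 = M"
    proof -
      have "\<exists>x\<le>r'. T x c0 = Suc i" "\<not> (\<exists>x\<le>r'. T x c0 = i)" using r' ni by auto
      then show ?thesis using cEp unfolding box_excess_def by simp
    qed
    ultimately show False by simp
  qed
  then have T0: "T r0 c0 = Suc i" using r' by simp
  define c1 where "c1 = Max {c. T r0 c = Suc i}"
  have "{c. T r0 c = Suc i} \<subseteq> {..\<alpha> r0}" using KT_box[OF kt] by force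
  then have fin: "finite {c. T r0 c = Suc i}" by (rule finite_subset) simp
  have c1: "T r0 c1 = Suc i" using Max_in[OF fin] T0 unfolding c1_def by blast
  have c1_ge: "c \<le> c1" if "T r0 c = Suc i" for c using Max_ge[OF fin] that unfolding c1_def by blast
  have c01: "c0 \<le> c1" using c1_ge T0 by blast
  have T1: "T r0 c = Suc i" if "c0 \<le> c" "c \<le> c1" for c
    using KT_row_mono[OF kt c0 that(1), of r0] KT_row_mono[OF kt _ that(2), of r0] T0 c1 c0 that by simp
  have T2: "T r0 (Suc c1) \<le> i"
    using KT_row[OF kt, of c1 r0] c1 c0 c01 c1_ge[of "Suc c1"] by (cases "T r0 (Suc c1) = Suc i") auto
  \<comment> \<open>A row below \<open>r0\<close> containing \<open>i\<close> at column
    \<open>c\<close> has an entry above \<open>Suc i\<close> at \<open>c0\<close>. The key condition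
    against the \<open>Suc i\<close> of row \<open>r0\<close> then keeps its entries above
    \<open>Suc i\<close> up to column \<open>c\<close>.\<close>
  have below: "T r c \<noteq> i" if r: "r < r0" and c: "c0 \<le> c" "c \<le> c1" for r c
  proof
    assume ri: "T r c = i"
    have "T r x > Suc i" if "c0 \<le> x" "x \<le> c" for x
      using that
    proof (induction rule: dec_induct)
      case base
      have "T r c0 \<ge> i" using KT_row_mono[OF kt c0 c(1), of r] ri by simp
      moreover have "T r c0 \<noteq> i" using ni r by auto
      moreover have "T r c0 \<noteq> Suc i" using KT_col[OF kt, of r0 c0 r] T0 r by auto
      ultimately show ?case by simp
    next
      case (step x)
      then have "T r x > Suc i" "T r0 x = Suc i" using T1[of x] c by simp_all
      then show ?case using KT_cond[OF kt, of x r r0] r c0 step by simp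
    qed
    from this[of c] show False using ri c by simp
  qed
  \<comment> \<open>By \<open>below\<close>, this \<open>i\<close> would lie above row
    \<open>r0\<close>; the key condition would then require an entry greater than \<open>i\<close>
    just right of the run of \<open>Suc i\<close> in row \<open>r0\<close>.\<close>
  have above: "T r c1 \<noteq> i" for r
  proof
    assume ri: "T r c1 = i"
    then have "r0 < r" using below[of r c1] c01 c1 by (cases r r0 rule: linorder_cases) auto
    then show False using KT_cond[OF kt, of c1 r0 r] ri c1 T2 c0 c01 i by simp
  qed
  have cex1: "col_excess i T c1 = 1" using c1 above by (auto simp: col_excess_def in_colset)
  have cex_ge: "col_excess i T c \<ge> 0" if "c0 \<le> c" "c \<le> c1" for c
    using T1[OF that] by (auto simp: col_excess_def in_colset)
  have mono: "prefix_excess i T a \<le> prefix_excess i T b" if "c0 - 1 \<le> a" "a \<le> b" "b \<le> c1" for a b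
    using that(2,3)
  proof (induction rule: dec_induct)
    case (step b)
    have "col_excess i T (Suc b) \<ge> 0" using cex_ge[of "Suc b"] c0 that(1) step by linarith
    then show ?case using step by (simp add: prefix_excess_Suc)
  qed simp
  have c1S: "prefix_excess i T c1 = prefix_excess i T (c1 - 1) + 1"
    using prefix_excess_Suc[of i T "c1 - 1"] cex1 c0 c01 by simp
  have "prefix_excess i T (c0 - 1) \<le> prefix_excess i T (c1 - 1)" by (rule mono) (use c01 in auto)
  then have cE1: "prefix_excess i T c1 = M" using cE_le[of c1] cEp c1S by simp
  \<comment> \<open>A squeeze: the excess is M - 1 before \<open>c0\<close>, does not decrease up to
    \<open>c1\<close>, and its last increment there is 1. So each column strictly before
    \<open>c1\<close> in the interval has excess 0 and contains \<open>i\<close> besides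
    \<open>Suc i\<close>.\<close>
  have mid: "prefix_excess i T c = M - 1" if "c0 - 1 \<le> c" "c < c1" for c
  proof -
    have "prefix_excess i T (c0 - 1) \<le> prefix_excess i T c" "prefix_excess i T c \<le> prefix_excess i T (c1 - 1)"
      by (rule mono; use that in linarith)+
    then show ?thesis using c1S cE1 cEp by simp
  qed
  show thesis
  proof (rule that[of c0 c1 r0])
    show "\<exists>k>r0. T k c = i" if "c0 \<le> c" "c < c1" for c
    proof -
      have "col_excess i T c = 0" using mid[of c] mid[of "c - 1"] prefix_excess_Suc[of i T "c - 1"] c0 that by simp
      then have "i \<in> colset T c" using T1[of c] that by (auto simp: col_excess_def in_colset of_bool_def split: if_splits)
      then obtain k where k: "T k c = i" by (auto simp: in_colset)
      then have "r0 < k" using below[of k c] T1[of c] that by (cases k r0 rule: linorder_cases) auto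
      then show ?thesis using k by blast
    qed
    show "prefix_excess i T c < prefix_excess i T c1" if "c < c1" for c
      using cE1 cE_less[of c] mid[of c] that by (cases "c < c0") auto
    \<comment> \<open>This protects the left border, where an \<open>i\<close> above
      \<open>r0\<close> in column \<open>c0\<close> becomes \<open>Suc i\<close>. Otherwise, if row
      \<open>r0\<close> has \<open>Suc i\<close> in column \<open>c0 - 1\<close>, the box there
      attains M although it is read later. If \<open>Suc i\<close> is in another row of that column,
      the key condition produces a wrong entry in column \<open>c0\<close>. If it is absent, the
      columns before attain M too early.\<close>
    show "T k (c0 - 1) \<noteq> i" if k: "r0 < k" and c: "2 \<le> c0" for k
    proof
      assume ki: "T k (c0 - 1) = i"
      let ?c = "c0 - 1"
      have sc: "Suc ?c = c0" "Suc (?c - 1) = ?c" "1 \<le> ?c" using c by simp_all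
      have ic: "i \<in> colset T ?c" using ki i by (auto simp: in_colset)
      have step: "prefix_excess i T ?c = prefix_excess i T (?c - 1) + col_excess i T ?c" using prefix_excess_Suc[of i T "?c - 1"] sc by simp
      have ge: "T r0 ?c \<ge> Suc i" using KT_row[OF kt sc(3), of r0] sc T0 by simp
      show False
      proof (cases "T r0 ?c = Suc i")
        case True
        then have "col_excess i T ?c = 0" using ic by (auto simp: col_excess_def in_colset)
        then have "prefix_excess i T (?c - 1) = M - 1" using step cEp by simp
        moreover have "\<not> (\<exists>r'\<le>r0. T r' ?c = i)"
        proof
          assume "\<exists>r'\<le>r0. T r' ?c = i"
          then obtain r' where "r' \<le> r0" "T r' ?c = i" by blast
          then show False using KT_col[OF kt, of k ?c r'] ki k i by simp
        qed
        moreover have "\<exists>r'\<le>r0. T r' ?c = Suc i" using True by blast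
        ultimately have "box_excess i T r0 ?c = M" unfolding box_excess_def by simp
        moreover have "box_excess i T r0 ?c < M"
          using pos(3)[of r0 ?c] True c by (simp add: boxes_def after_def)
        ultimately show False by simp
      next
        case False
        show False
        proof (cases "Suc i \<in> colset T ?c")
          case True
          then obtain l where l: "T l ?c = Suc i" by (auto simp: in_colset)
          then have "l \<noteq> r0" using False by blast
          show False
          proof (cases "r0 < l")
            case True
            then show False using KT_cond[OF kt sc(3) True] l ge False sc T0 by simp
          next
            case False
            then have "l < k" using k by simp
            then have "T l c0 > i" using KT_cond[OF kt sc(3), of l k] l ki i sc by simp
            moreover have "T l c0 \<le> Suc i" using KT_row[OF kt sc(3), of l] l sc by simp
            ultimately have "T l c0 = Suc i" by simp
            then show False using KT_col[OF kt, of l c0 r0] T0 \<open>l \<noteq> r0\<close> by simp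
          qed
        next
          case False
          then have "col_excess i T ?c = -1" using ic by (simp add: col_excess_def)
          then show False using step cEp cE_less[of "?c - 1"] c by simp
        qed
      qed
    qed
    show "U = (\<lambda>r c. if c0 \<le> c \<and> c \<le> c1 then transpose i (Suc i) (T r c) else T r c)"
    proof (intro ext)
      fix r c
      show "U r c = (if c0 \<le> c \<and> c \<le> c1 then transpose i (Suc i) (T r c) else T r c)"
      proof (cases "c0 \<le> c \<and> c \<le> c1")
        case True
        then have "T r0 c = Suc i" using T1 by blast
        moreover have "r = r0" if "T r c = Suc i" using KT_col[OF kt, of r c r0] that calculation by simp
        ultimately show ?thesis using True unfolding U by (auto simp: transpose_def)
      next
        case False
        then show ?thesis using c1_ge unfolding U by auto
      qed
    qed
  qed (use c0 c01 T1 T2 above below cE1 cE_le cEp c1S in auto)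
qed


text \<open>The conditions compare columns \<open>c\<close> and \<open>Suc c\<close>. Inside the
  interval both are transposed, so only comparisons of \<open>i\<close> with \<open>Suc i\<close>
  matter. At the right border column \<open>c1\<close> contains no \<open>i\<close>; at the left
  border column \<open>c0 - 1\<close> has no \<open>i\<close> above row \<open>r0\<close>.\<close>

lemma tableau_e_KT:
  assumes wc: "weak_composition \<alpha>" and kt: "KT \<alpha> T" and i: "1 \<le> i" and e: "tableau_e i T = Some U"
  shows "KT \<alpha> U"
proof -
  obtain r0 c0 c1 where s: "1 \<le> c0" "c0 \<le> c1" "\<And>c. c0 \<le> c \<Longrightarrow> c \<le> c1 \<Longrightarrow> T r0 c = Suc i" "T r0 (Suc c1) \<le> i"
    "\<And>r. T r c1 \<noteq> i" "\<And>r c. r < r0 \<Longrightarrow> c0 \<le> c \<Longrightarrow> c \<le> c1 \<Longrightarrow> T r c \<noteq> i"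
    "\<And>k. r0 < k \<Longrightarrow> 2 \<le> c0 \<Longrightarrow> T k (c0 - 1) \<noteq> i"
    "U = (\<lambda>r c. if c0 \<le> c \<and> c \<le> c1 then transpose i (Suc i) (T r c) else T r c)"
    by (rule tableau_e_Some[OF assms]) (rule that)
  let ?t = "transpose i (Suc i)"
  have r0: "r = r0" if "T r c = Suc i" "c0 \<le> c" "c \<le> c1" for r c
    using KT_col[OF kt, of r c r0] s(3)[of c] that by simp
  have Uin: "U r c = ?t (T r c)" if "c0 \<le> c" "c \<le> c1" for r c using s(8) that by simp
  have Uout: "U r c = T r c" if "c < c0 \<or> c1 < c" for r c using s(8) that by auto
  have box: "U r c \<noteq> 0 \<longleftrightarrow> T r c \<noteq> 0" for r c using s(8) i by (auto simp: transpose_def)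
  have row: "U r (Suc c) \<le> U r c" if c: "1 \<le> c" for r c
  proof -
    note T = KT_row[OF kt c, of r]
    consider "c0 \<le> c" "Suc c \<le> c1" | "c = c1" | "Suc c = c0" | "Suc c < c0 \<or> c1 < c" using s(2) by linarith
    then show ?thesis
    proof cases
      case 1
      then have "\<not> (T r (Suc c) = i \<and> T r c = Suc i)" using r0[of r c] s(3)[of "Suc c"] by auto
      then show ?thesis using T 1 by (auto simp: Uin transpose_def)
    next
      case 2
      have "\<not> (T r (Suc c) = Suc i \<and> T r c = Suc i)" using r0[of r c1] s(2,4) 2 by auto
      then show ?thesis using T 2 s(2) s(5)[of r] by (auto simp: Uin Uout transpose_def)
    next
      case 3
      have "T r c \<noteq> i" if "T r c0 = i"
      proof -
        have "r \<noteq> r0" using that s(2) s(3)[of c0] by auto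
        moreover have "\<not> r < r0" using s(6)[of r c0] that s(2) by blast
        ultimately show ?thesis using s(7)[of r] 3 c by force
      qed
      then show ?thesis using T 3 s(2) by (auto simp: Uin Uout transpose_def)
    next
      case 4
      then show ?thesis using T s(2) by (auto simp: Uout)
    qed
  qed
  have col: "U a c \<noteq> U b c" if "a \<noteq> b" "U a c \<noteq> 0" for a b c
    using KT_col[OF kt, of a c b] that box[of a c] s(8) by (auto simp: transpose_def split: if_splits)
  have cond: "U b c < U a (Suc c)" if c: "1 \<le> c" and ab: "a < b" and nz: "U b c \<noteq> 0" and less: "U b c < U a c"
    for a b c
  proof -
    have nz': "T b c \<noteq> 0" using nz box by simp
    have ne: "T a c \<noteq> T b c" using KT_col[OF kt, of b c a] nz' ab by auto
    note T = KT_cond[OF kt c ab nz']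
    consider "c0 \<le> c" "Suc c \<le> c1" | "c = c1" | "Suc c = c0" | "Suc c < c0 \<or> c1 < c" using s(2) by linarith
    then show ?thesis
    proof cases
      case 1
      have in_c: "U r c = ?t (T r c)" "U r (Suc c) = ?t (T r (Suc c))" for r using 1 by (simp_all add: Uin)
      have "\<not> (T a c = i \<and> T b c = Suc i)" using r0[of b c] s(6)[of a c] ab 1 by auto
      then have lt: "T b c < T a c" using less ne unfolding in_c by (auto simp: transpose_def split: if_splits)
      have "\<not> (T b c = i \<and> T a (Suc c) = Suc i)"
      proof
        assume *: "T b c = i \<and> T a (Suc c) = Suc i"
        then have "a = r0" using r0[of a "Suc c"] 1 by simp
        then have "T a c = Suc i" using s(3)[of c] 1 by simp
        then show False using less * unfolding in_c by simp
      qed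
      then show ?thesis using T[OF lt] unfolding in_c by (auto simp: transpose_def)
    next
      case 2
      have in_c: "U r c = ?t (T r c)" "U r (Suc c) = T r (Suc c)" for r using 2 s(2) by (simp_all add: Uin Uout)
      have "\<not> (T a c = Suc i \<and> T b c = Suc i)" using ne by simp
      then have "T b c < T a c" using less ne s(5) 2 unfolding in_c by (auto simp: transpose_def split: if_splits)
      then show ?thesis using T s(5)[of b] 2 unfolding in_c by (auto simp: transpose_def)
    next
      case 3
      have in_c: "U r c = T r c" "U r (Suc c) = ?t (T r (Suc c))" for r using 3 s(2) by (simp_all add: Uin Uout)
      have "\<not> (T b c = i \<and> T a (Suc c) = Suc i)"
        using r0[of a c0] s(2) s(7)[of b] ab 3 c by force
      then show ?thesis using T less unfolding in_c by (auto simp: transpose_def)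
    next
      case 4
      then show ?thesis using T less s(2) by (auto simp: Uout)
    qed
  qed
  show ?thesis unfolding KT_def using box KT_box[OF kt] row col cond by blast
qed

text \<open>In increasing order an \<open>i\<close> stands directly before an \<open>Suc i\<close>
  of the same column and is paired with it, so a column containing both is neutral for the
  bracketing.\<close>

definition colword :: "nat \<Rightarrow> (nat \<Rightarrow> nat set) \<Rightarrow> nat list" where
  "colword m C = concat (map (\<lambda>c. sorted_list_of_set (C c)) [1..<Suc m])"

lemma colword_0 [simp]: "colword 0 C = []" by (simp add: colword_def)

lemma colword_Suc: "colword (Suc m) C = colword m C @ sorted_list_of_set (C (Suc m))"
  by (simp add: colword_def)

lemma eps_sorted: "sorted_wrt (<) L \<Longrightarrow> eps i L = of_bool (Suc i \<in> set L \<and> i \<notin> set L)"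
  by (induction L) auto

lemma count_list_distinct: "distinct L \<Longrightarrow> count_list L x = of_bool (x \<in> set L)"
  by (induction L) auto

lemma wexcess_column: "finite A \<Longrightarrow> wexcess i (sorted_list_of_set A) = of_bool (Suc i \<in> A) - of_bool (i \<in> A)"
  by (simp add: wexcess_def count_list_distinct)

lemma eps_column: "finite A \<Longrightarrow> eps i (sorted_list_of_set A) = of_bool (Suc i \<in> A \<and> i \<notin> A)"
  by (simp add: eps_sorted)

lemma phi_column:
  assumes "finite A"
  shows "phi i (sorted_list_of_set A) = of_bool (i \<in> A \<and> Suc i \<notin> A)"
  using eps_phi[of i "sorted_list_of_set A"] wexcess_column[OF assms, of i] eps_column[OF assms, of i]
  by (auto simp: of_bool_def split: if_splits)

lemma wexcess_append: "wexcess i (xs @ ys) = wexcess i xs + wexcess i ys"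
  by (simp add: wexcess_def)

lemma eps_append_int: "int (eps i (xs @ ys)) = max (int (eps i xs)) (wexcess i xs + int (eps i ys))"
  using eps_append[of i xs ys] eps_phi[of i xs] by linarith

lemma wexcess_colword:
  assumes "\<And>c. finite (colset T c)"
  shows "wexcess i (colword m (colset T)) = prefix_excess i T m"
proof (induction m)
  case 0
  then show ?case by (simp add: wexcess_def)
next
  case (Suc m)
  then show ?case by (simp add: colword_Suc wexcess_append wexcess_column[OF assms] prefix_excess_Suc col_excess_def)
qed

text \<open>\<open>eps\<close> is the maximal excess of a prefix of the word. In a sorted column
  \<open>i\<close> precedes \<open>Suc i\<close>, so the maximum is attained at a column
  boundary.\<close>

lemma eps_colword_le:
  assumes fin: "\<And>c. finite (colset T c)" and B: "0 \<le> B" "\<And>c. c \<le> m \<Longrightarrow> prefix_excess i T c \<le> B"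
  shows "int (eps i (colword m (colset T))) \<le> B"
  using B(2)
proof (induction m)
  case (Suc m)
  have "prefix_excess i T m + int (eps i (sorted_list_of_set (colset T (Suc m)))) \<le> B"
    using Suc.prems[of m] Suc.prems[of "Suc m"]
    by (auto simp: eps_column[OF fin] prefix_excess_Suc col_excess_def of_bool_def split: if_splits)
  moreover have "int (eps i (colword m (colset T))) \<le> B" using Suc by simp
  ultimately show ?case by (simp add: colword_Suc eps_append_int wexcess_colword[OF fin])
qed (use B(1) in simp)

lemma sorted_list_of_set_split:
  assumes "finite A" "x \<in> A"
  shows "sorted_list_of_set A = sorted_list_of_set {y \<in> A. y < x} @ x # sorted_list_of_set {y \<in> A. x < y}"
proof -
  let ?L = "sorted_list_of_set {y \<in> A. y < x} @ x # sorted_list_of_set {y \<in> A. x < y}"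
  have fin: "finite {y \<in> A. y < x}" "finite {y \<in> A. x < y}" using assms(1) by simp_all
  then have "sorted_wrt (<) ?L" by (auto simp: sorted_wrt_append)
  moreover have "set ?L = A" using assms fin by auto
  ultimately show ?thesis using assms(1) by (intro strict_sorted_equal) auto
qed

lemma colword_split:
  assumes "1 \<le> c" "c \<le> m"
  shows "colword m C = colword (c - 1) C @ sorted_list_of_set (C c) @
    concat (map (\<lambda>c. sorted_list_of_set (C c)) [Suc c..<Suc m])"
proof -
  have "[1..<Suc m] = [1..<c] @ c # [Suc c..<Suc m]"
    using assms upt_add_eq_append[of 1 c "Suc m - c"] upt_conv_Cons[of c "Suc m"] by simp
  moreover have "[1..<c] = [1..<Suc (c - 1)]" using assms by simp
  ultimately show ?thesis unfolding colword_def by simp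
qed

lemma colword_cong: "(\<And>c. 1 \<le> c \<Longrightarrow> c \<le> m \<Longrightarrow> C c = C' c) \<Longrightarrow> colword m C = colword m C'"
  unfolding colword_def by (intro arg_cong[of _ _ concat] map_cong) auto

text \<open>As \<open>i\<close> is absent from the column, it takes the very place of
  \<open>Suc i\<close> in the sorted order, and the word changes in a single letter.\<close>

lemma colword_change:
  assumes fin: "finite (C c)" and c: "1 \<le> c" "c \<le> m" and i: "Suc i \<in> C c" "i \<notin> C c"
  defines "low \<equiv> sorted_list_of_set {y \<in> C c. y < Suc i}"
    and "high \<equiv> sorted_list_of_set {y \<in> C c. Suc i < y} @ concat (map (\<lambda>c. sorted_list_of_set (C c)) [Suc c..<Suc m])"
  shows "colword m C = (colword (c - 1) C @ low) @ Suc i # high"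
    and "colword m (C(c := insert i (C c - {Suc i}))) = (colword (c - 1) C @ low) @ i # high"
proof -
  let ?C = "C(c := insert i (C c - {Suc i}))"
  show "colword m C = (colword (c - 1) C @ low) @ Suc i # high"
    unfolding colword_split[OF c] low_def high_def sorted_list_of_set_split[OF fin i(1)] by simp
  have "{y \<in> ?C c. y < i} = {y \<in> C c. y < Suc i}" "{y \<in> ?C c. i < y} = {y \<in> C c. Suc i < y}"
    using i by (auto simp: less_Suc_eq)
  then have "sorted_list_of_set (?C c) = low @ i # sorted_list_of_set {y \<in> C c. Suc i < y}"
    using sorted_list_of_set_split[of "?C c" i] fin unfolding low_def by simp
  moreover have "colword (c - 1) ?C = colword (c - 1) C" by (rule colword_cong) auto
  moreover have "map (\<lambda>c. sorted_list_of_set (?C c)) [Suc c..<Suc m] = map (\<lambda>c. sorted_list_of_set (C c)) [Suc c..<Suc m]"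
    by (rule map_cong) auto
  ultimately show "colword m ?C = (colword (c - 1) C @ low) @ i # high"
    unfolding colword_split[OF c, of ?C] high_def by (simp only: append_assoc append_Cons)
qed

definition tword :: "nat \<Rightarrow> tableau \<Rightarrow> nat list" where
  "tword m T = colword m (colset T)"

lemma weak_composition_bound:
  assumes "weak_composition \<alpha>"
  obtains m where "\<And>r. \<alpha> r \<le> m"
proof -
  have "finite (\<alpha> ` {r. \<alpha> r \<noteq> 0})" using assms by (simp add: weak_composition_def)
  then have "\<alpha> r \<le> Max (insert 0 (\<alpha> ` {r. \<alpha> r \<noteq> 0}))" for r
    by (cases "\<alpha> r = 0") (auto intro!: Max_ge)
  then show ?thesis by (rule that)
qed

text \<open>As sets, the columns of the interval before \<open>c1\<close> are fixed by the
  transposition, so only column \<open>c1\<close> changes. It is the first column at which the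
  prefix excess is maximal, which makes its \<open>Suc i\<close> the rightmost unpaired one.\<close>

lemma tableau_e_arrow:
  assumes wc: "weak_composition \<alpha>" and kt: "KT \<alpha> T" and i: "1 \<le> i" and e: "tableau_e i T = Some U"
    and m: "\<And>r. \<alpha> r \<le> m"
  shows "arrow i (tword m U) (tword m T)"
proof -
  obtain r0 c0 c1 where s: "1 \<le> c0" "c0 \<le> c1" "\<And>c. c0 \<le> c \<Longrightarrow> c \<le> c1 \<Longrightarrow> T r0 c = Suc i"
    "\<And>c. c0 \<le> c \<Longrightarrow> c < c1 \<Longrightarrow> \<exists>k>r0. T k c = i" "\<And>r. T r c1 \<noteq> i"
    "\<And>c. c < c1 \<Longrightarrow> prefix_excess i T c < prefix_excess i T c1" "\<And>c. prefix_excess i T c \<le> prefix_excess i T c1" "prefix_excess i T (c1 - 1) = prefix_excess i T c1 - 1"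
    "U = (\<lambda>r c. if c0 \<le> c \<and> c \<le> c1 then transpose i (Suc i) (T r c) else T r c)"
    by (rule tableau_e_Some[OF assms(1-4)]) (rule that)
  note fin = finite_colset[OF wc kt]
  have nz: "0 < transpose i (Suc i) x \<longleftrightarrow> 0 < x" for x using i by (auto simp: transpose_def)
  have col: "colset U c = (if c0 \<le> c \<and> c \<le> c1 then transpose i (Suc i) ` colset T c else colset T c)" for c
    unfolding s(9) colset_def by (auto simp: nz)
  have colU: "colset U = (colset T)(c1 := insert i (colset T c1 - {Suc i}))"
  proof
    fix c
    consider "c0 \<le> c" "c < c1" | "c = c1" | "c < c0 \<or> c1 < c" using s(2) by linarith
    then show "colset U c = ((colset T)(c1 := insert i (colset T c1 - {Suc i}))) c"
    proof cases
      case 1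
      then have "Suc i \<in> colset T c" "i \<in> colset T c"
        using s(3)[of c] s(4)[of c] i by (auto simp: in_colset)
      then have "transpose i (Suc i) ` colset T c = colset T c" by (auto simp: transpose_def image_iff)
      then show ?thesis using col 1 by simp
    next
      case 2
      then have "Suc i \<in> colset T c" "i \<notin> colset T c"
        using s(3)[of c] s(2,5) by (auto simp: in_colset)
      then have "transpose i (Suc i) ` colset T c = insert i (colset T c - {Suc i})"
        by (auto simp: transpose_def image_iff)
      then show ?thesis using col 2 s(2) by simp
    next
      case 3
      then show ?thesis using col s(2) by auto
    qed
  qed
  have c1: "1 \<le> c1" "c1 \<le> m" using s(1-3) KT_box[OF kt, of r0 c1] m[of r0] by auto
  have mem: "Suc i \<in> colset T c1" "i \<notin> colset T c1"
    using s(3)[of c1] s(2,5) by (auto simp: in_colset)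
  define low where "low = sorted_list_of_set {y \<in> colset T c1. y < Suc i}"
  define high where "high = sorted_list_of_set {y \<in> colset T c1. Suc i < y} @
    concat (map (\<lambda>c. sorted_list_of_set (colset T c)) [Suc c1..<Suc m])"
  define xs where "xs = colword (c1 - 1) (colset T) @ low"
  note words = colword_change[where C = "colset T" and c = c1, OF fin c1 mem, folded low_def high_def xs_def]
  have low: "eps i low = 0" "phi i low = 0" "wexcess i low = 0"
    unfolding low_def using fin mem by (simp_all add: eps_column phi_column wexcess_column)
  \<comment> \<open>The prefix ends at its own maximal excess, so \<open>eps\<close> is at most the
    excess and their difference \<open>phi\<close> vanishes.\<close>
  have "int (eps i (colword (c1 - 1) (colset T))) \<le> prefix_excess i T c1 - 1"
  proof (rule eps_colword_le[OF fin])
    show "prefix_excess i T c \<le> prefix_excess i T c1 - 1" if "c \<le> c1 - 1" for c using s(6)[of c] that c1 by simp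
    from this[of 0] show "0 \<le> prefix_excess i T c1 - 1" by simp
  qed
  moreover have "wexcess i (colword (c1 - 1) (colset T)) = prefix_excess i T c1 - 1" using wexcess_colword[OF fin] s(8) by simp
  ultimately have phi0: "phi i (colword (c1 - 1) (colset T)) = 0"
    using eps_phi[of i "colword (c1 - 1) (colset T)"] by linarith
  then have xs: "phi i xs = 0" "wexcess i xs = prefix_excess i T c1 - 1"
    unfolding xs_def using low wexcess_colword[OF fin, of i "c1 - 1"] s(8) by (simp_all add: phi_append wexcess_append)
  have "0 \<le> prefix_excess i T c1" using s(7)[of 0] by simp
  then have "int (eps i (colword m (colset T))) \<le> prefix_excess i T c1"
    using eps_colword_le[OF fin] s(7) by blast
  then have "eps i high = 0"
    using xs unfolding words(1) eps_append_int by simp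
  then show ?thesis
    unfolding arrow_def tword_def words(1) colU words(2) using xs(1) by blast
qed

lemma tableau_e_None_iff:
  assumes wc: "weak_composition \<alpha>" and kt: "KT \<alpha> T" and i: "1 \<le> i" and m: "\<And>r. \<alpha> r \<le> m"
  shows "tableau_e i T = None \<longleftrightarrow> eps i (tword m T) = 0"
proof
  assume "tableau_e i T = None"
  then have "prefix_excess i T c \<le> 0" for c by (rule tableau_e_None[OF wc kt i])
  then have "int (eps i (tword m T)) \<le> 0"
    unfolding tword_def by (intro eps_colword_le finite_colset[OF wc kt]) auto
  then show "eps i (tword m T) = 0" by simp
next
  assume *: "eps i (tword m T) = 0"
  show "tableau_e i T = None"
  proof (cases "tableau_e i T")
    case (Some U)
    then show ?thesis using arrow_eps[OF tableau_e_arrow[OF wc kt i Some m]] * by simp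
  qed
qed

text \<open>If column 1 changes, the interval starts at \<open>c0 = 1\<close>. The empty prefix has
  excess 0, so the maximal prefix excess is 1 and a single raising step uses it up.\<close>

lemma tableau_e_first_column:
  assumes wc: "weak_composition \<alpha>" and kt: "KT \<alpha> T" and i: "1 \<le> i" and e: "tableau_e i T = Some U"
  shows "(\<forall>r. U r 1 = T r 1) \<or> tableau_e i U = None \<and> (\<exists>r0. T r0 1 = Suc i \<and> U r0 1 = i \<and>
    (\<forall>r. r \<noteq> r0 \<longrightarrow> U r 1 = T r 1 \<or> r0 < r \<and> T r 1 = i \<and> U r 1 = Suc i))"
proof -
  obtain r0 c0 c1 where s: "1 \<le> c0" "c0 \<le> c1" "\<And>c. c0 \<le> c \<Longrightarrow> c \<le> c1 \<Longrightarrow> T r0 c = Suc i"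
    "\<And>r c. r < r0 \<Longrightarrow> c0 \<le> c \<Longrightarrow> c \<le> c1 \<Longrightarrow> T r c \<noteq> i"
    "\<And>c. prefix_excess i T c \<le> prefix_excess i T c1" "prefix_excess i T (c0 - 1) = prefix_excess i T c1 - 1"
    "U = (\<lambda>r c. if c0 \<le> c \<and> c \<le> c1 then transpose i (Suc i) (T r c) else T r c)"
    by (rule tableau_e_Some[OF assms(1-4)]) (rule that)
  obtain m where m: "\<And>r. \<alpha> r \<le> m" by (rule weak_composition_bound[OF wc]) blast
  show ?thesis
  proof (cases "c0 = 1")
    case True
    have "prefix_excess i T c \<le> 1" for c using s(5)[of c] s(6) True by simp
    then have "int (eps i (tword m T)) \<le> 1"
      unfolding tword_def by (intro eps_colword_le finite_colset[OF wc kt]) auto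
    then have "eps i (tword m U) = 0" using arrow_eps[OF tableau_e_arrow[OF assms m]] by simp
    then have None: "tableau_e i U = None"
      using tableau_e_None_iff[OF wc tableau_e_KT[OF assms] i m] by simp
    have T1: "T r0 1 = Suc i" using s(2,3) True by simp
    have U1: "U r 1 = transpose i (Suc i) (T r 1)" for r using s(2,7) True by simp
    have "U r 1 = T r 1 \<or> r0 < r \<and> T r 1 = i \<and> U r 1 = Suc i" if "r \<noteq> r0" for r
    proof -
      have "T r 1 \<noteq> Suc i" using KT_col[OF kt, of r 1 r0] T1 that by auto
      moreover have "T r 1 = i \<Longrightarrow> r0 < r" using s(4)[of r 1] s(2) True that by (cases "r < r0") auto
      ultimately show ?thesis unfolding U1 by (auto simp: transpose_def)
    qed
    then show ?thesis using None T1 U1[of r0] by auto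
  next
    case False
    then show ?thesis using s(1,7) by auto
  qed
qed

text \<open>A column 1 entry \<^term>\<open>Suc i\<close> of an \<^term>\<open>i\<close>-highest tableau must be cancelled by an \<^term>\<open>i\<close> in the
  same column; if that \<^term>\<open>i\<close> lies above it, the key condition forces another \<^term>\<open>Suc i\<close> in column 2,
  and so on.\<close>

lemma first_column_highest:
  assumes wc: "weak_composition \<alpha>" and kt: "KT \<alpha> T" and i: "1 \<le> i" and e: "tableau_e i T = None"
    and j: "T j 1 = Suc i"
  shows "\<exists>r<j. i \<le> T r 1"
proof (rule ccontr)
  assume "\<not> ?thesis"
  then have low: "T r 1 < i" if "r < j" for r using that by force
  have "\<forall>c'. 1 \<le> c' \<and> c' \<le> Suc c \<longrightarrow> T j c' = Suc i" for c
  proof (induction c)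
    case 0
    then show ?case using j by (auto simp: le_Suc_eq)
  next
    case (Suc c)
    let ?c = "Suc c"
    have ge: "col_excess i T c' \<ge> 0" if "c' \<in> {1..?c}" for c' using Suc that by (auto simp: col_excess_def in_colset)
    have "prefix_excess i T ?c \<le> 0" by (rule tableau_e_None[OF wc kt i e])
    moreover have "prefix_excess i T ?c \<ge> 0" unfolding prefix_excess_def using ge by (rule sum_nonneg)
    ultimately have "(\<Sum>j = 1..?c. col_excess i T j) = 0" unfolding prefix_excess_def by simp
    then have col_excess: "col_excess i T ?c = 0" using sum_nonneg_0[where s = "{1..?c}" and f = "col_excess i T" and i = ?c] ge by simp
    have Tj: "T j ?c = Suc i" using Suc by simp
    have "Suc i \<in> colset T ?c" using Tj by (auto simp: in_colset)
    then have "i \<in> colset T ?c" using col_excess by (auto simp: col_excess_def of_bool_def split: if_splits)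
    then obtain r where r: "T r ?c = i" by (auto simp: in_colset)
    have "T r ?c \<le> T r 1" using KT_row_mono[OF kt, of 1 ?c r] by simp
    then have "\<not> r < j" using low[of r] r by auto
    moreover have "r \<noteq> j" using Tj r by auto
    ultimately have "j < r" by simp
    then have "T j (Suc ?c) > i" using KT_cond[OF kt, of ?c j r] r Tj i by simp
    moreover have "T j (Suc ?c) \<le> Suc i" using KT_row[OF kt, of ?c j] Tj by simp
    ultimately have "T j (Suc ?c) = Suc i" by simp
    then show ?case using Suc le_Suc_eq[of _ ?c] by metis
  qed
  from this[of "\<alpha> j"] have "T j (Suc (\<alpha> j)) = Suc i" by simp
  then show False using KT_box[OF kt, of j "Suc (\<alpha> j)"] by simp
qed

subsection \<open>Key tableaux are determined by their columns\<close>

lemma colword_inj: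
  assumes "\<And>c. finite (C c)" "\<And>c. finite (C' c)" "\<And>c. 1 \<le> c \<Longrightarrow> c \<le> m \<Longrightarrow> card (C c) = card (C' c)"
    "colword m C = colword m C'" "1 \<le> c" "c \<le> m"
  shows "C c = C' c"
  using assms(3-)
proof (induction m)
  case (Suc m)
  have "length (sorted_list_of_set (C (Suc m))) = length (sorted_list_of_set (C' (Suc m)))"
    using Suc.prems(1)[of "Suc m"] by simp
  then have eq: "colword m C = colword m C'" "sorted_list_of_set (C (Suc m)) = sorted_list_of_set (C' (Suc m))"
    using Suc.prems(2) unfolding colword_Suc by (simp_all add: append_eq_append_conv)
  show ?case
  proof (cases "c = Suc m")
    case True
    then show ?thesis using eq(2) assms(1,2) sorted_list_of_set.set_sorted_key_list_of_set by metis
  next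
    case False
    then show ?thesis using Suc eq by simp
  qed
qed simp

lemma card_colset:
  assumes "KT \<alpha> T" "1 \<le> c"
  shows "card (colset T c) = card {r. c \<le> \<alpha> r}"
proof -
  have "colset T c = (\<lambda>r. T r c) ` {r. c \<le> \<alpha> r}"
    using KT_box[OF assms(1)] assms(2) by (auto simp: colset_def)
  moreover have "inj_on (\<lambda>r. T r c) {r. c \<le> \<alpha> r}"
    using KT_col[OF assms(1)] KT_box[OF assms(1)] assms(2) by (auto simp: inj_on_def)
  ultimately show ?thesis by (simp add: card_image)
qed

text \<open>Filling the columns from right to left and each column from bottom to top, every row takes the
  smallest available entry that is not less than its right neighbour.\<close>

lemma greedy_min:
  assumes kt: "KT \<alpha> T" and "T r c \<noteq> 0" "x \<in> colset T c" "T r (Suc c) \<le> x" "\<forall>r'<r. T r' c \<noteq> x"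
  shows "T r c \<le> x"
proof (rule ccontr)
  assume *: "\<not> T r c \<le> x"
  obtain k where k: "T k c = x" "x \<noteq> 0" using assms(3) by (auto simp: in_colset)
  have "1 \<le> c" using KT_box[OF kt, of r c] assms(2) by simp
  moreover have "r < k" using k * assms(5) by (cases r k rule: linorder_cases) auto
  ultimately show False using KT_cond[OF kt, of c r k] k * assms(4) by simp
qed

lemma greedy_same:
  assumes kt: "KT \<alpha> T" "KT \<alpha>' T'" and col: "colset T c = colset T' c"
    and box: "T r c \<noteq> 0" "T' r' c \<noteq> 0" and nxt: "T r (Suc c) = T' r' (Suc c)"
    and used: "\<forall>x. x \<noteq> 0 \<longrightarrow> (\<exists>a<r. T a c = x) \<longleftrightarrow> (\<exists>a<r'. T' a c = x)"
  shows "T r c = T' r' c"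
proof (rule antisym)
  have c: "1 \<le> c" using KT_box[OF kt(1), of r c] box(1) by simp
  show "T r c \<le> T' r' c"
  proof (rule greedy_min[OF kt(1) box(1)])
    show "T' r' c \<in> colset T c" using box(2) by (auto simp: col in_colset)
    show "T r (Suc c) \<le> T' r' c" unfolding nxt by (rule KT_row[OF kt(2) c])
    show "\<forall>a<r. T a c \<noteq> T' r' c" using used box(2) KT_col[OF kt(2), of r' c] by (metis less_irrefl)
  qed
  show "T' r' c \<le> T r c"
  proof (rule greedy_min[OF kt(2) box(2)])
    show "T r c \<in> colset T' c" using box(1) by (auto simp: col[symmetric] in_colset)
    show "T' r' (Suc c) \<le> T r c" unfolding nxt[symmetric] by (rule KT_row[OF kt(1) c])
    show "\<forall>a<r'. T' a c \<noteq> T r c" using used box(1) KT_col[OF kt(1), of r c] by (metis less_irrefl)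
  qed
qed

lemma KT_unique:
  assumes wc: "weak_composition \<alpha>" and kt: "KT \<alpha> T" "KT \<alpha> T'" and col: "\<And>c. 1 \<le> c \<Longrightarrow> colset T c = colset T' c"
  shows "T = T'"
proof -
  obtain m where m: "\<And>r. \<alpha> r \<le> m" by (rule weak_composition_bound[OF wc]) blast
  have zero: "T r c = 0 \<and> T' r c = 0" if "c = 0 \<or> m < c" for r c
    using KT_box[OF kt(1), of r c] KT_box[OF kt(2), of r c] m[of r] that by auto
  have "\<forall>r. T r c = T' r c" if c: "1 \<le> c" "c \<le> Suc m" for c
    using c(2)
  proof (induction rule: inc_induct)
    case base
    then show ?case using zero by auto
  next
    case (step n)
    show ?case
    proof
      fix r
      show "T r n = T' r n"
      proof (induction r rule: less_induct)
        case (less r)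
        show ?case
        proof (cases "T r n = 0")
          case True
          then show ?thesis using KT_box[OF kt(1), of r n] KT_box[OF kt(2), of r n] by (cases "T' r n = 0") auto
        next
          case False
          then have "T' r n \<noteq> 0" using KT_box[OF kt(1), of r n] KT_box[OF kt(2), of r n] by simp
          moreover have "colset T n = colset T' n" using col step c by simp
          moreover have "\<forall>x. x \<noteq> 0 \<longrightarrow> (\<exists>a<r. T a n = x) \<longleftrightarrow> (\<exists>a<r. T' a n = x)" using less by auto
          ultimately show ?thesis using greedy_same[OF kt, of n r r] False step by simp
        qed
      qed
    qed
  qed
  then have "T r c = T' r c" for r c using zero[of c r] by (cases "1 \<le> c \<and> c \<le> Suc m") auto
  then show ?thesis by blast
qed

lemma tword_inj:
  assumes wc: "weak_composition \<alpha>" "weak_composition \<alpha>'" and kt: "KT \<alpha> T" "KT \<alpha>' T'"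
    and m: "\<And>r. \<alpha> r \<le> m" "\<And>r. \<alpha>' r \<le> m" and card: "\<And>c. 1 \<le> c \<Longrightarrow> card {r. c \<le> \<alpha> r} = card {r. c \<le> \<alpha>' r}"
    and eq: "tword m T = tword m T'" and c: "1 \<le> c"
  shows "colset T c = colset T' c"
proof (cases "c \<le> m")
  case True
  show ?thesis
    using True c eq unfolding tword_def
    by (intro colword_inj[where m = m and C = "colset T" and C' = "colset T'"])
      (simp_all add: finite_colset[OF wc(1) kt(1)] finite_colset[OF wc(2) kt(2)] card_colset[OF kt(1)]
        card_colset[OF kt(2)] card)
next
  case False
  have "T r c = 0" "T' r c = 0" for r
    using KT_box[OF kt(1), of r c] KT_box[OF kt(2), of r c] m(1)[of r] m(2)[of r] False by auto
  then show ?thesis by (simp add: colset_def)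
qed

lemma tword_KT_unique:
  assumes "weak_composition \<alpha>" "KT \<alpha> T" "KT \<alpha> T'" "\<And>r. \<alpha> r \<le> m" "tword m T = tword m T'"
  shows "T = T'"
  using KT_unique[OF assms(1-3)] tword_inj[OF assms(1,1-3) assms(4,4) refl assms(5)] by blast

subsection \<open>Existence of key tableaux with given columns\<close>

text \<open>\<open>b r\<close> is the right neighbour of row \<open>r\<close> and \<open>g r\<close>
  its new entry; the last conjunct is the contrapositive of the key condition. The lowest row takes
  the least admissible entry, and the threshold condition survives its removal.\<close>

lemma greedy_match:
  fixes R C :: "nat set"
  assumes "finite R" "finite C" "card R = card C" "\<And>v. card {r \<in> R. v \<le> b r} \<le> card {x \<in> C. v \<le> x}"
  shows "\<exists>g. bij_betw g R C \<and> (\<forall>r\<in>R. b r \<le> g r) \<and> (\<forall>a\<in>R. \<forall>k\<in>R. a < k \<longrightarrow> b a \<le> g k \<longrightarrow> g a < g k)"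
  using assms
proof (induction "card R" arbitrary: R C)
  case 0
  then show ?case by (auto simp: bij_betw_def)
next
  case (Suc n)
  then have ne: "R \<noteq> {}" by auto
  define r where "r = Min R"
  have r: "r \<in> R" "\<And>a. a \<in> R \<Longrightarrow> r \<le> a" using Min_in Min_le Suc.prems(1) ne unfolding r_def by auto
  have "card {a \<in> R. b r \<le> b a} > 0" using r(1) Suc.prems(1) by (auto simp: card_gt_0_iff)
  then have "card {x \<in> C. b r \<le> x} > 0" using Suc.prems(4)[of "b r"] by linarith
  then have neC: "{x \<in> C. b r \<le> x} \<noteq> {}" by (metis card.empty less_irrefl)
  define x where "x = Min {x \<in> C. b r \<le> x}"
  have finC: "finite {x \<in> C. b r \<le> x}" using Suc.prems(2) by simp
  have x: "x \<in> C" "b r \<le> x" using Min_in[OF finC neC] unfolding x_def by auto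
  have xmin: "x \<le> y" if "y \<in> C" "b r \<le> y" for y using Min_le[OF finC] that unfolding x_def by simp
  have dom: "card {a \<in> R - {r}. v \<le> b a} \<le> card {y \<in> C - {x}. v \<le> y}" for v
  proof -
    have Rm: "card {a \<in> R - {r}. v \<le> b a} = card {a \<in> R. v \<le> b a} - of_bool (v \<le> b r)"
    proof -
      have "{a \<in> R - {r}. v \<le> b a} = {a \<in> R. v \<le> b a} - {r}" by auto
      then show ?thesis using r(1) Suc.prems(1) by (auto simp: card_Diff_singleton_if)
    qed
    have Cm: "card {y \<in> C - {x}. v \<le> y} = card {y \<in> C. v \<le> y} - of_bool (v \<le> x)"
    proof -
      have "{y \<in> C - {x}. v \<le> y} = {y \<in> C. v \<le> y} - {x}" by auto
      then show ?thesis using x(1) Suc.prems(2) by (auto simp: card_Diff_singleton_if)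
    qed
    consider "v \<le> b r" | "b r < v" "v \<le> x" | "x < v" using x by linarith
    then show ?thesis
    proof cases
      case 1
      then show ?thesis using Suc.prems(4)[of v] Rm Cm x(2) by simp
    next
      \<comment> \<open>No element of \<open>C\<close> lies between \<open>b r\<close> and
        \<open>x\<close>, so the thresholds \<open>v\<close> and \<open>b r\<close> count the same
        elements of \<open>C\<close>, while row \<open>r\<close> is counted for \<open>b r\<close>
        only.\<close>
      case 2
      have "{y \<in> C. v \<le> y} = {y \<in> C. b r \<le> y}" using 2 xmin by force
      moreover have "card {a \<in> R. v \<le> b a} < card {a \<in> R. b r \<le> b a}"
      proof (rule psubset_card_mono)
        have "r \<in> {a \<in> R. b r \<le> b a}" "r \<notin> {a \<in> R. v \<le> b a}" using 2 r(1) by auto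
        moreover have "{a \<in> R. v \<le> b a} \<subseteq> {a \<in> R. b r \<le> b a}" using 2 by auto
        ultimately show "{a \<in> R. v \<le> b a} \<subset> {a \<in> R. b r \<le> b a}" by blast
      qed (use Suc.prems(1) in simp)
      ultimately show ?thesis using Suc.prems(4)[of "b r"] Rm Cm 2 by simp
    next
      case 3
      then show ?thesis using Suc.prems(4)[of v] Rm Cm x(2) by simp
    qed
  qed
  have "n = card (R - {r})" "card (R - {r}) = card (C - {x})"
    using Suc.hyps(2) Suc.prems(1-3) r(1) x(1) by (simp_all add: card_Diff_singleton)
  then obtain g where g: "bij_betw g (R - {r}) (C - {x})" "\<forall>a\<in>R - {r}. b a \<le> g a"
    "\<forall>a\<in>R - {r}. \<forall>k\<in>R - {r}. a < k \<longrightarrow> b a \<le> g k \<longrightarrow> g a < g k"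
    using Suc.hyps(1)[of "R - {r}" "C - {x}"] Suc.prems(1,2) dom by auto
  let ?g = "g(r := x)"
  have "bij_betw ?g (R - {r}) (C - {x})" using g(1) by (subst bij_betw_cong[of _ ?g g]) auto
  then have "bij_betw ?g (R - {r} \<union> {r}) (C - {x} \<union> {?g r})" by (intro notIn_Un_bij_betw) auto
  then have "bij_betw ?g R C" using r(1) x(1) by (simp add: insert_absorb)
  moreover have "\<forall>a\<in>R. b a \<le> ?g a" using g(2) x(2) by auto
  moreover have "?g a < ?g k" if "a \<in> R" "k \<in> R" "a < k" "b a \<le> ?g k" for a k
  proof -
    have k: "k \<in> R - {r}" "?g k = g k" using that r(2)[of a] by auto
    have gk: "g k \<in> C - {x}" using bij_betwE[OF g(1)] k(1) by blast
    show ?thesis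
    proof (cases "a = r")
      case True
      then show ?thesis using xmin[of "g k"] gk that k by auto
    next
      case False
      then show ?thesis using g(3) that k by auto
    qed
  qed
  ultimately show ?case by blast
qed

text \<open>Every entry at least \<open>v\<close> has a left neighbour at least \<open>v\<close> in
  its row.\<close>

lemma KT_dominance:
  assumes wc: "weak_composition \<alpha>" and kt: "KT \<alpha> T" and c: "1 \<le> c"
  shows "card {x \<in> colset T (Suc c). v \<le> x} \<le> card {x \<in> colset T c. v \<le> x}"
proof -
  have *: "{x \<in> colset T c. v \<le> x} = (\<lambda>r. T r c) ` {r. T r c \<noteq> 0 \<and> v \<le> T r c}" for c
    by (auto simp: colset_def)
  have fin: "finite {r. T r c \<noteq> 0 \<and> v \<le> T r c}" by (rule rev_finite_subset[OF finite_rows[OF wc kt]]) auto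
  have "card {x \<in> colset T (Suc c). v \<le> x} \<le> card {r. T r (Suc c) \<noteq> 0 \<and> v \<le> T r (Suc c)}"
    unfolding * by (rule card_image_le, rule rev_finite_subset[OF finite_rows[OF wc kt]]) auto
  also have "\<dots> \<le> card {r. T r c \<noteq> 0 \<and> v \<le> T r c}"
  proof (rule card_mono[OF fin])
    show "{r. T r (Suc c) \<noteq> 0 \<and> v \<le> T r (Suc c)} \<subseteq> {r. T r c \<noteq> 0 \<and> v \<le> T r c}"
      using KT_row[OF kt c] le_trans by fastforce
  qed
  also have "\<dots> = card {x \<in> colset T c. v \<le> x}"
    unfolding * using KT_col[OF kt] by (intro card_image[symmetric]) (auto simp: inj_on_def)
  finally show ?thesis .
qed

lemma KT_exists:
  assumes wc: "weak_composition \<alpha>" and fin: "\<And>c. finite (C c)" and zero: "\<And>c. 0 \<notin> C c"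
    and card: "\<And>c. 1 \<le> c \<Longrightarrow> card (C c) = card {r. c \<le> \<alpha> r}"
    and dom: "\<And>c v. 1 \<le> c \<Longrightarrow> card {x \<in> C (Suc c). v \<le> x} \<le> card {x \<in> C c. v \<le> x}"
  shows "\<exists>T. KT \<alpha> T \<and> (\<forall>c\<ge>1. colset T c = C c)"
proof -
  obtain m where m: "\<And>r. \<alpha> r \<le> m" by (rule weak_composition_bound[OF wc]) blast
  \<comment> \<open>This is \<open>KT\<close> with the prescribed columns, restricted to the columns
    beyond \<open>n\<close>; the filling proceeds from right to left.\<close>
  define P where "P n T \<longleftrightarrow> (\<forall>r c. T r c \<noteq> 0 \<longleftrightarrow> n < c \<and> c \<le> \<alpha> r) \<and> (\<forall>r c. n < c \<longrightarrow> T r (Suc c) \<le> T r c) \<and>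
     (\<forall>a b c. a \<noteq> b \<longrightarrow> T a c \<noteq> 0 \<longrightarrow> T a c \<noteq> T b c) \<and>
     (\<forall>a b c. n < c \<longrightarrow> a < b \<longrightarrow> T b c \<noteq> 0 \<longrightarrow> T b c < T a c \<longrightarrow> T b c < T a (Suc c)) \<and>
     (\<forall>c>n. colset T c = C c)" for n and T :: tableau
  have "\<exists>T. P 0 T" using le0[of m]
  proof (induction rule: inc_induct)
    case base
    have "C c = {}" if "m < c" for c
    proof -
      have "{r. c \<le> \<alpha> r} = {}" using le_less_trans[OF m that] by (auto simp: not_le)
      then show ?thesis using card[of c] fin[of c] that by (simp add: card_eq_0_iff)
    qed
    then have "P m (\<lambda>_ _. 0)" using m unfolding P_def colset_def by (auto simp: not_le intro: le_less_trans)
    then show ?case by blast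
  next
    case (step n)
    then obtain T where T: "P (Suc n) T" by blast
    have box: "T r c \<noteq> 0 \<longleftrightarrow> Suc n < c \<and> c \<le> \<alpha> r" for r c
      using T[unfolded P_def, THEN conjunct1] by blast
    have row: "Suc n < c \<Longrightarrow> T r (Suc c) \<le> T r c" for r c
      using T[unfolded P_def, THEN conjunct2, THEN conjunct1] by blast
    have col: "a \<noteq> b \<Longrightarrow> T a c \<noteq> 0 \<Longrightarrow> T a c \<noteq> T b c" for a b c
      using T[unfolded P_def, THEN conjunct2, THEN conjunct2, THEN conjunct1] by blast
    have cond: "Suc n < c \<Longrightarrow> a < b \<Longrightarrow> T b c \<noteq> 0 \<Longrightarrow> T b c < T a c \<Longrightarrow> T b c < T a (Suc c)" for a b c
      using T[unfolded P_def, THEN conjunct2, THEN conjunct2, THEN conjunct2, THEN conjunct1] by blast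
    have cs: "Suc n < c \<Longrightarrow> colset T c = C c" for c
      using T[unfolded P_def, THEN conjunct2, THEN conjunct2, THEN conjunct2, THEN conjunct2] by blast
    let ?c = "Suc n"
    let ?R = "{r. ?c \<le> \<alpha> r}" and ?b = "\<lambda>r. T r (Suc ?c)"
    have finR: "finite ?R"
      by (rule finite_subset[of _ "{r. \<alpha> r \<noteq> 0}"]) (use wc in \<open>auto simp: weak_composition_def\<close>)
    \<comment> \<open>Threshold 0 is the size condition. For positive thresholds only rows with an
      actual right neighbour count, and these neighbours are distinct entries of the next
      column.\<close>
    have "card {r \<in> ?R. v \<le> ?b r} \<le> card {x \<in> C ?c. v \<le> x}" for v
    proof (cases "v = 0")
      case True
      then show ?thesis using card[of ?c] by simp
    next
      case False
      have "card {r \<in> ?R. v \<le> ?b r} \<le> card {x \<in> C (Suc ?c). v \<le> x}"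
      proof (rule card_inj_on_le[where f = ?b])
        show "inj_on ?b {r \<in> ?R. v \<le> ?b r}"
        proof (rule inj_onI)
          fix a b assume "a \<in> {r \<in> ?R. v \<le> ?b r}" "?b a = ?b b"
          then show "a = b" using col[of a b "Suc ?c"] False by auto
        qed
        show "?b ` {r \<in> ?R. v \<le> ?b r} \<subseteq> {x \<in> C (Suc ?c). v \<le> x}"
          using cs[of "Suc ?c", symmetric] False by (auto simp: in_colset)
      qed (simp add: fin)
      also have "\<dots> \<le> card {x \<in> C ?c. v \<le> x}" by (rule dom) simp
      finally show ?thesis .
    qed
    then obtain g where g: "bij_betw g ?R (C ?c)" "\<forall>r\<in>?R. ?b r \<le> g r"
      "\<forall>a\<in>?R. \<forall>k\<in>?R. a < k \<longrightarrow> ?b a \<le> g k \<longrightarrow> g a < g k"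
      using greedy_match[of ?R "C ?c" ?b] finR fin[of ?c] card[of ?c] by auto
    have gR: "g r \<in> C ?c" "g r \<noteq> 0" if "r \<in> ?R" for r
      using bij_betwE[OF g(1)] that zero[of ?c] by metis+
    define T' where "T' = (\<lambda>r c. if c = ?c then (if r \<in> ?R then g r else 0) else T r c)"
    have T'c: "T' r ?c = (if r \<in> ?R then g r else 0)" for r by (simp add: T'_def)
    have T'o: "T' r c = T r c" if "c \<noteq> ?c" for r c using that by (simp add: T'_def)
    have "P n T'" unfolding P_def
    proof (intro conjI allI impI)
      show "T' r c \<noteq> 0 \<longleftrightarrow> n < c \<and> c \<le> \<alpha> r" for r c
        using gR(2)[of r] box[of r c] by (cases "c = ?c") (auto simp: T'c T'o)
      show "T' r (Suc c) \<le> T' r c" if "n < c" for r c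
      proof (cases "c = ?c")
        case True
        then show ?thesis using g(2) box[of r "Suc ?c"] by (auto simp: T'c T'o)
      next
        case False
        then show ?thesis using row[of c r] that by (simp add: T'o)
      qed
      show "T' a c \<noteq> T' b c" if "a \<noteq> b" "T' a c \<noteq> 0" for a b c
      proof (cases "c = ?c")
        case True
        then have "a \<in> ?R" using that by (auto simp: T'c split: if_splits)
        then show ?thesis
          using True that gR(2)[of a] inj_onD[OF bij_betw_imp_inj_on[OF g(1)], of a b] by (auto simp: T'c)
      next
        case False
        then show ?thesis using col[of a b c] that by (simp add: T'o)
      qed
      show "T' b c < T' a (Suc c)" if "n < c" "a < b" "T' b c \<noteq> 0" "T' b c < T' a c" for a b c
      proof (cases "c = ?c")
        case True
        then have ab: "a \<in> ?R" "b \<in> ?R" using that by (auto simp: T'c split: if_splits)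
        then have "g b < g a" using that True by (simp add: T'c)
        then have "\<not> ?b a \<le> g b" using g(3)[rule_format, OF ab that(2)] by fastforce
        then show ?thesis using True ab by (simp add: T'c T'o)
      next
        case False
        then show ?thesis using cond[of c a b] that by (simp add: T'o)
      qed
      show "colset T' c = C c" if "n < c" for c
      proof (cases "c = ?c")
        case True
        have "colset T' ?c = g ` ?R" using gR(2) by (auto simp: colset_def T'c)
        then show ?thesis using True bij_betw_imp_surj_on[OF g(1)] by simp
      next
        case False
        then show ?thesis using cs[of c] that by (simp add: colset_def T'o)
      qed
    qed
    then show ?case by blast
  qed
  then obtain T where "P 0 T" by blast
  then have "KT \<alpha> T \<and> (\<forall>c\<ge>1. colset T c = C c)" unfolding P_def KT_def by (simp add: Suc_le_eq)
  then show ?thesis by blast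
qed

lemma colword_locate:
  assumes "\<And>c. finite (C c)" "colword m C = xs @ x # ys"
  shows "\<exists>c. 1 \<le> c \<and> c \<le> m \<and> x \<in> C c \<and> xs = colword (c - 1) C @ sorted_list_of_set {y \<in> C c. y < x} \<and>
    ys = sorted_list_of_set {y \<in> C c. x < y} @ concat (map (\<lambda>c. sorted_list_of_set (C c)) [Suc c..<Suc m])"
  using assms(2)
proof (induction m arbitrary: ys)
  case (Suc m)
  let ?L = "sorted_list_of_set (C (Suc m))"
  have col: ?case if "xs = colword m C @ us" "?L = us @ x # ys" for us
  proof -
    have x: "x \<in> C (Suc m)" using arg_cong[OF that(2), of set] assms(1) by auto
    have "us @ x # ys = sorted_list_of_set {y \<in> C (Suc m). y < x} @ x # sorted_list_of_set {y \<in> C (Suc m). x < y}"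
      using that(2) sorted_list_of_set_split[OF assms(1) x] by simp
    moreover have "x \<notin> set us" "x \<notin> set ys"
      using that(2) distinct_sorted_list_of_set[of "C (Suc m)"] by auto
    ultimately have "us = sorted_list_of_set {y \<in> C (Suc m). y < x}" "ys = sorted_list_of_set {y \<in> C (Suc m). x < y}"
      by (simp_all add: append_Cons_eq_iff)
    then show ?thesis using x that(1) by (intro exI[of _ "Suc m"]) simp
  qed
  obtain us where "colword m C = xs @ us \<and> us @ ?L = x # ys \<or> colword m C @ us = xs \<and> ?L = us @ x # ys"
    using Suc.prems unfolding colword_Suc append_eq_append_conv2 by blast
  then show ?case
  proof (elim disjE conjE)
    assume *: "colword m C @ us = xs" "?L = us @ x # ys"
    show ?thesis by (rule col[OF *(1)[symmetric] *(2)])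
  next
    assume *: "colword m C = xs @ us" "us @ ?L = x # ys"
    show ?thesis
    proof (cases us)
      case Nil
      show ?thesis by (rule col[of "[]"]) (use * Nil in simp_all)
    next
      case (Cons z zs)
      then obtain c where c: "1 \<le> c" "c \<le> m" "x \<in> C c" "xs = colword (c - 1) C @ sorted_list_of_set {y \<in> C c. y < x}"
        "zs = sorted_list_of_set {y \<in> C c. x < y} @ concat (map (\<lambda>c. sorted_list_of_set (C c)) [Suc c..<Suc m])"
        using Suc.IH[of zs] * by auto
      then show ?thesis using * Cons by (intro exI[of _ c]) auto
    qed
  qed
qed simp

lemma card_ge_step:
  assumes "finite (A :: nat set)"
  shows "card {x \<in> A. v \<le> x} = card {x \<in> A. Suc v \<le> x} + of_bool (v \<in> A)"
proof -
  have "{x \<in> A. v \<le> x} = (if v \<in> A then insert v {x \<in> A. Suc v \<le> x} else {x \<in> A. Suc v \<le> x})"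
    by (auto simp: le_eq_less_or_eq Suc_le_eq)
  then show ?thesis using assms by simp
qed

lemma card_ge_change:
  assumes "finite (A :: nat set)" "i \<in> A" "Suc i \<notin> A"
  shows "card {x \<in> insert (Suc i) (A - {i}). v \<le> x} = card {x \<in> A. v \<le> x} + of_bool (v = Suc i)"
proof -
  let ?B = "insert (Suc i) (A - {i})"
  consider "v \<le> i" | "v = Suc i" | "Suc i < v" by linarith
  then show ?thesis
  proof cases
    case 1
    have "{x \<in> ?B. v \<le> x} = insert (Suc i) ({x \<in> A. v \<le> x} - {i})" using 1 by auto
    moreover have "card (insert (Suc i) ({x \<in> A. v \<le> x} - {i})) = Suc (card ({x \<in> A. v \<le> x} - {i}))"
      using assms by simp
    moreover have "Suc (card ({x \<in> A. v \<le> x} - {i})) = card {x \<in> A. v \<le> x}"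
      using assms 1 by (intro card.remove[symmetric]) auto
    ultimately show ?thesis using 1 by simp
  next
    case 2
    have "{x \<in> ?B. v \<le> x} = insert (Suc i) {x \<in> A. v \<le> x}" using 2 by auto
    then show ?thesis using assms 2 by simp
  next
    case 3
    have "{x \<in> ?B. v \<le> x} = {x \<in> A. v \<le> x}" using 3 by auto
    then show ?thesis using 3 by simp
  qed
qed

text \<open>The columns read off from \<open>W\<close> still meet the existence criterion. Raising
  the resulting tableau gives one with the word of \<open>T\<close>, hence \<open>T\<close>
  itself.\<close>

lemma arrow_lift:
  assumes wc: "weak_composition \<alpha>" and kt: "KT \<alpha> T" and i: "1 \<le> i" and m: "\<And>r. \<alpha> r \<le> m"
    and arr: "arrow i (tword m T) W"
  shows "\<exists>T'. KT \<alpha> T' \<and> tword m T' = W \<and> tableau_e i T' = Some T"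
proof -
  define C where "C = colset T"
  have fin: "finite (C c)" for c unfolding C_def by (rule finite_colset[OF wc kt])
  obtain xs ys where a: "colword m C = xs @ i # ys" "W = xs @ Suc i # ys" "phi i xs = 0" "eps i ys = 0"
    using arr unfolding arrow_def tword_def C_def by blast
  obtain c1 where c1: "1 \<le> c1" "c1 \<le> m" "i \<in> C c1"
    and xs: "xs = colword (c1 - 1) C @ sorted_list_of_set {y \<in> C c1. y < i}"
    and ys: "ys = sorted_list_of_set {y \<in> C c1. i < y} @ concat (map (\<lambda>c. sorted_list_of_set (C c)) [Suc c1..<Suc m])"
    using colword_locate[OF fin a(1)] by blast
  have no: "Suc i \<notin> C c1"
  proof
    assume "Suc i \<in> C c1"
    then have "eps i (sorted_list_of_set {y \<in> C c1. i < y}) = 1" using fin by (simp add: eps_column)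
    then show False using a(4) unfolding ys eps_append by simp
  qed
  have left: "\<not> (i \<in> C (c1 - 1) \<and> Suc i \<notin> C (c1 - 1))" if "2 \<le> c1"
  proof -
    have "phi i (colword (c1 - 1) C) = 0"
      using a(3) fin unfolding xs phi_append by (simp add: eps_column)
    moreover have "colword (c1 - 1) C = colword (c1 - 2) C @ sorted_list_of_set (C (c1 - 1))"
      using colword_Suc[of "c1 - 2" C] that by (simp add: Suc_diff_Suc numeral_2_eq_2)
    ultimately have "phi i (sorted_list_of_set (C (c1 - 1))) = 0" by (simp add: phi_append)
    then show ?thesis using fin by (simp add: phi_column split: if_splits)
  qed
  define C' where "C' = C(c1 := insert (Suc i) (C c1 - {i}))"
  have C'1: "C' c1 = insert (Suc i) (C c1 - {i})" and C'o: "c \<noteq> c1 \<Longrightarrow> C' c = C c" for c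
    by (simp_all add: C'_def)
  have W: "colword m C' = W"
  proof -

    have fin': "finite (C' c1)" using fin C'1 by simp
    have mem': "Suc i \<in> C' c1" "i \<notin> C' c1" using C'1 by auto
    have "(y \<in> C' c1 \<and> y < Suc i) = (y \<in> C c1 \<and> y < i)" for y
      by (cases y i rule: linorder_cases) (auto simp: C'1)
    moreover have "(y \<in> C' c1 \<and> Suc i < y) = (y \<in> C c1 \<and> i < y)" for y
      using no by (cases "y = Suc i") (auto simp: C'1)
    ultimately have "{y \<in> C' c1. y < Suc i} = {y \<in> C c1. y < i}" "{y \<in> C' c1. Suc i < y} = {y \<in> C c1. i < y}"
      by simp_all
    moreover have "colword (c1 - 1) C' = colword (c1 - 1) C" by (rule colword_cong) (auto simp: C'_def)
    moreover have "map (\<lambda>c. sorted_list_of_set (C' c)) [Suc c1..<Suc m] = map (\<lambda>c. sorted_list_of_set (C c)) [Suc c1..<Suc m]"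
      by (rule map_cong) (auto simp: C'_def)
    ultimately show ?thesis
      using colword_change(1)[of C' c1 m i, OF fin' c1(1,2) mem'] unfolding a(2) xs ys by (simp only: append_assoc)
  qed
  have dom: "card {x \<in> C (Suc c). v \<le> x} \<le> card {x \<in> C c. v \<le> x}" if "1 \<le> c" for c v
    unfolding C_def by (rule KT_dominance[OF wc kt that])
  have ch: "card {x \<in> C' c1. v \<le> x} = card {x \<in> C c1. v \<le> x} + of_bool (v = Suc i)" for v
    unfolding C'1 by (rule card_ge_change[OF fin c1(3) no])
  have "\<exists>T'. KT \<alpha> T' \<and> (\<forall>c\<ge>1. colset T' c = C' c)"
  proof (rule KT_exists[OF wc])
    show "finite (C' c)" for c using fin by (simp add: C'_def)
    show "0 \<notin> C' c" for c using i by (auto simp: C'_def C_def colset_def)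
    show "card (C' c) = card {r. c \<le> \<alpha> r}" if "1 \<le> c" for c
    proof -
      have "card (C' c) = card (C c)"
        using fin c1(3) no card.remove[of "C c1" i] by (simp add: C'_def)
      then show ?thesis using card_colset[OF kt that] by (simp add: C_def)
    qed
    show "card {x \<in> C' (Suc c). v \<le> x} \<le> card {x \<in> C' c. v \<le> x}" if c: "1 \<le> c" for c v
    proof (cases "Suc c = c1 \<and> v = Suc i")
      case True
      then have cc: "Suc c = c1" "v = Suc i" by simp_all
      \<comment> \<open>Only the threshold \<open>Suc i\<close> can be violated, and only if there
        was no slack. In that case the thresholds \<open>i\<close> and \<open>Suc (Suc i)\<close>
        show that column \<open>c\<close> contains \<open>i\<close> but not \<open>Suc i\<close>,
        contrary to \<open>left\<close>.\<close>
      have "\<not> card {x \<in> C c. v \<le> x} \<le> card {x \<in> C c1. v \<le> x}"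
      proof
        assume le: "card {x \<in> C c. v \<le> x} \<le> card {x \<in> C c1. v \<le> x}"
        have 1: "card {x \<in> C c1. i \<le> x} \<le> card {x \<in> C c. i \<le> x}"
          "card {x \<in> C c1. Suc (Suc i) \<le> x} \<le> card {x \<in> C c. Suc (Suc i) \<le> x}"
          using dom[OF c] cc by auto
        have "i \<in> C c"
          using 1(1) le cc card_ge_step[OF fin[of c1], of i] card_ge_step[OF fin[of c], of i] c1(3)
          by (cases "i \<in> C c") auto
        moreover have "Suc i \<notin> C c"
          using 1(2) le cc card_ge_step[OF fin[of c1], of "Suc i"] card_ge_step[OF fin[of c], of "Suc i"] no
          by (cases "Suc i \<in> C c") auto
        ultimately show False using left cc c by auto
      qed
      then have "card {x \<in> C c1. v \<le> x} + 1 \<le> card {x \<in> C c. v \<le> x}" by simp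
      then show ?thesis using ch[of v] C'o[of c] cc by auto
    next
      case False
      then show ?thesis using dom[OF c, of v] ch[of v] C'o[of c] C'o[of "Suc c"]
        by (cases "c = c1"; cases "Suc c = c1") auto
    qed
  qed
  then obtain T' where T': "KT \<alpha> T'" "\<And>c. 1 \<le> c \<Longrightarrow> colset T' c = C' c" by blast
  have tw: "tword m T' = W" unfolding tword_def W[symmetric] by (rule colword_cong) (simp add: T'(2))
  have "tableau_e i T' \<noteq> None"
    using tableau_e_None_iff[OF wc T'(1) i m] arrow_eps[OF arr] tw by simp
  then obtain U where U: "tableau_e i T' = Some U" by blast
  have "tword m U = tword m T"
    using tableau_e_arrow[OF wc T'(1) i U m] arr tw by (simp add: arrow_unique_source)
  then have "U = T" using tword_KT_unique[OF wc tableau_e_KT[OF wc T'(1) i U] kt m] by blast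
  then show ?thesis using T'(1) tw U by blast
qed

subsection \<open>Exchanging two adjacent rows of the shape\<close>

text \<open>\<open>x\<close>, \<open>y\<close> are the greedy choices for the right neighbours
  \<open>p\<close>, \<open>q\<close> in this order, and \<open>x'\<close>, \<open>y'\<close> those
  for \<open>q\<close>, \<open>p\<close>. If \<open>x\<close> is also admissible for
  \<open>q\<close>, both start with the same choice; otherwise \<open>x\<close> is admissible only
  for \<open>p\<close> and the two choices are exchanged.\<close>

lemma greedy_pair_aux:
  fixes x y x' y' p q :: nat
  assumes pq: "p \<le> q" and b: "p \<le> x" "q \<le> y" "x \<noteq> y" "q \<le> x'" "p \<le> y'" "x' \<noteq> y'"
    and 1: "\<And>z. z \<in> {x, y, x', y'} \<Longrightarrow> p \<le> z \<Longrightarrow> x \<le> z" and 2: "\<And>z. z \<in> {x, y, x', y'} \<Longrightarrow> z \<noteq> x \<Longrightarrow> q \<le> z \<Longrightarrow> y \<le> z"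
    and 3: "\<And>z. z \<in> {x, y, x', y'} \<Longrightarrow> q \<le> z \<Longrightarrow> x' \<le> z" and 4: "\<And>z. z \<in> {x, y, x', y'} \<Longrightarrow> z \<noteq> x' \<Longrightarrow> p \<le> z \<Longrightarrow> y' \<le> z"
  shows "x' = x \<and> y' = y \<or> x' = y \<and> y' = x"
proof (cases "q \<le> x")
  case True
  have "x' = x" using 3[of x] 1[of x'] True b(4) pq by simp
  moreover have "y \<le> y'" using 2[of y'] 1[of y'] True b(5,6) calculation by auto
  moreover have "y' \<le> y" using 4[of y] b pq calculation(1) by auto
  ultimately show ?thesis by simp
next
  case False
  then have "x' \<noteq> x" using b(4) by auto
  then have "x' = y" using 2[of x'] 3[of y] b by simp
  moreover have "y' = x" using 4[of x] 1[of y'] b \<open>x' \<noteq> x\<close> by simp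
  ultimately show ?thesis by simp
qed

lemma greedy_pair:
  fixes x y x' y' p q :: nat
  assumes b: "p \<le> x" "q \<le> y" "x \<noteq> y" "q \<le> x'" "p \<le> y'" "x' \<noteq> y'"
    and 1: "\<And>z. z \<in> {x, y, x', y'} \<Longrightarrow> p \<le> z \<Longrightarrow> x \<le> z" and 2: "\<And>z. z \<in> {x, y, x', y'} \<Longrightarrow> z \<noteq> x \<Longrightarrow> q \<le> z \<Longrightarrow> y \<le> z"
    and 3: "\<And>z. z \<in> {x, y, x', y'} \<Longrightarrow> q \<le> z \<Longrightarrow> x' \<le> z" and 4: "\<And>z. z \<in> {x, y, x', y'} \<Longrightarrow> z \<noteq> x' \<Longrightarrow> p \<le> z \<Longrightarrow> y' \<le> z"
  shows "{x', y'} = {x, y}"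
proof -
  have Z: "{x, y, x', y'} = {x', y', x, y}" by auto
  have "x' = x \<and> y' = y \<or> x' = y \<and> y' = x"
  proof (cases "p \<le> q")
    case True
    then show ?thesis using b 1 2 3 4 by (rule greedy_pair_aux)
  next
    case False
    then have "q \<le> p" by simp
    then have "x = x' \<and> y = y' \<or> x = y' \<and> y = x'"
      using b(4-6,1-3) 3[unfolded Z] 4[unfolded Z] 1[unfolded Z] 2[unfolded Z] by (rule greedy_pair_aux)
    then show ?thesis by auto
  qed
  then show ?thesis by auto
qed

text \<open>Both fillings are greedy with the same columns. They agree below row \<open>t\<close>,
  rows \<open>t\<close> and \<open>Suc t\<close> together consume the same entries, and so the rows
  above again face the same choices.\<close>

lemma KT_swap_rows:
  fixes t :: nat
  assumes wc: "weak_composition \<alpha>" and kt: "KT \<alpha> T" "KT (\<alpha> \<circ> transpose t (Suc t)) T'"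
    and col: "\<And>c. 1 \<le> c \<Longrightarrow> colset T c = colset T' c" and c: "1 \<le> c"
  shows "(\<forall>r. r \<noteq> t \<longrightarrow> r \<noteq> Suc t \<longrightarrow> T' r c = T r c) \<and> {T' t c, T' (Suc t) c} = {T t c, T (Suc t) c}"
proof -
  obtain m where m: "\<And>r. \<alpha> r \<le> m" by (rule weak_composition_bound[OF wc]) blast
  have m': "(\<alpha> \<circ> transpose t (Suc t)) r \<le> m" for r using m by simp
  have zero: "T r c = 0 \<and> T' r c = 0" if "m < c" for r c
    using KT_box[OF kt(1), of r c] KT_box[OF kt(2), of r c] m[of r] m'[of r] that by auto
  show ?thesis
  proof (cases "c \<le> Suc m")
    case False
    then show ?thesis using zero[of c] by simp
  next
    case True
    then show ?thesis using c
    proof (induction rule: inc_induct)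
      case base
      then show ?case using zero by simp
    next
      case (step n)
      have n: "1 \<le> n" using step by simp
      have IH: "\<And>r. r \<noteq> t \<Longrightarrow> r \<noteq> Suc t \<Longrightarrow> T' r (Suc n) = T r (Suc n)"
        "{T' t (Suc n), T' (Suc t) (Suc n)} = {T t (Suc n), T (Suc t) (Suc n)}" using step n by auto
      have b: "T r n \<noteq> 0 \<longleftrightarrow> n \<le> \<alpha> r" "r \<noteq> t \<Longrightarrow> r \<noteq> Suc t \<Longrightarrow> T' r n \<noteq> 0 \<longleftrightarrow> n \<le> \<alpha> r"
        "T' t n \<noteq> 0 \<longleftrightarrow> n \<le> \<alpha> (Suc t)" "T' (Suc t) n \<noteq> 0 \<longleftrightarrow> n \<le> \<alpha> t" for r
        using KT_box[OF kt(1), of r n] KT_box[OF kt(2), of r n] KT_box[OF kt(2), of t n]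
          KT_box[OF kt(2), of "Suc t" n] n by (simp_all add: transpose_def)
      have bS: "\<not> n \<le> \<alpha> r \<Longrightarrow> T r (Suc n) = 0" "\<not> n \<le> \<alpha> (Suc t) \<Longrightarrow> T' t (Suc n) = 0"
        "\<not> n \<le> \<alpha> t \<Longrightarrow> T' (Suc t) (Suc n) = 0" for r
        using KT_row[OF kt(1) n, of r] KT_row[OF kt(2) n, of t] KT_row[OF kt(2) n, of "Suc t"] b by force+
      note cn = col[OF n]
      have same: "T' r n = T r n" if "r \<noteq> t" "r \<noteq> Suc t"
        "\<forall>x. x \<noteq> 0 \<longrightarrow> (\<exists>a<r. T a n = x) \<longleftrightarrow> (\<exists>a<r. T' a n = x)" for r
      proof (cases "n \<le> \<alpha> r")
        case True
        then show ?thesis using greedy_same[OF kt cn, of r r] b(1)[of r] b(2)[OF that(1,2)] IH(1)[OF that(1,2)] that(3)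
          by simp
      next
        case False
        then show ?thesis using b(1)[of r] b(2)[OF that(1,2)] by simp
      qed
      have low: "T' r n = T r n" if "r < t" for r
        using that
      proof (induction r rule: less_induct)
        case (less r)
        then have "\<forall>a<r. T' a n = T a n" by simp
        then show ?case using less.prems by (intro same) auto
      qed
      have pair: "{T' t n, T' (Suc t) n} = {T t n, T (Suc t) n}"
      proof -
        consider "\<not> n \<le> \<alpha> t" "\<not> n \<le> \<alpha> (Suc t)" | "n \<le> \<alpha> t" "\<not> n \<le> \<alpha> (Suc t)" | "\<not> n \<le> \<alpha> t" "n \<le> \<alpha> (Suc t)"
          | "n \<le> \<alpha> t" "n \<le> \<alpha> (Suc t)" by blast
        then show ?thesis
        proof cases
          case 1
          then show ?thesis using b(1)[of t] b(1)[of "Suc t"] b(3,4) by simp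
        next
          case 2
          then have z: "T (Suc t) n = 0" "T' t n = 0" "T (Suc t) (Suc n) = 0" "T' t (Suc n) = 0"
            using b(1)[of "Suc t"] b(3) bS(1)[of "Suc t"] bS(2) by auto
          then have "T t (Suc n) = T' (Suc t) (Suc n)" using IH(2) by (auto simp: doubleton_eq_iff)
          moreover have "\<forall>x. x \<noteq> 0 \<longrightarrow> (\<exists>a<t. T a n = x) \<longleftrightarrow> (\<exists>a<Suc t. T' a n = x)"
            using low z by (auto simp: less_Suc_eq)
          ultimately have "T t n = T' (Suc t) n"
            using greedy_same[OF kt cn, of t "Suc t"] b(1)[of t] b(4) 2 by simp
          then show ?thesis using z by auto
        next
          case 3
          then have z: "T t n = 0" "T' (Suc t) n = 0" "T t (Suc n) = 0" "T' (Suc t) (Suc n) = 0"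
            using b(1)[of t] b(4) bS(1)[of t] bS(3) by auto
          then have "T (Suc t) (Suc n) = T' t (Suc n)" using IH(2) by (auto simp: doubleton_eq_iff)
          moreover have "\<forall>x. x \<noteq> 0 \<longrightarrow> (\<exists>a<Suc t. T a n = x) \<longleftrightarrow> (\<exists>a<t. T' a n = x)"
            using low z by (auto simp: less_Suc_eq)
          ultimately have "T (Suc t) n = T' t n"
            using greedy_same[OF kt cn, of "Suc t" t] b(1)[of "Suc t"] b(3) 3 by simp
          then show ?thesis using z by auto
        next
          case 4
          let ?Z = "{T t n, T (Suc t) n, T' t n, T' (Suc t) n}"
          have nz: "T t n \<noteq> 0" "T (Suc t) n \<noteq> 0" "T' t n \<noteq> 0" "T' (Suc t) n \<noteq> 0" using b 4 by simp_all
          have ne: "T t n \<noteq> T (Suc t) n" "T' t n \<noteq> T' (Suc t) n"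
            using KT_col[OF kt(1) nz(1), of "Suc t"] KT_col[OF kt(2) nz(3), of "Suc t"] by auto
          have Z: "z \<in> colset T n" "z \<in> colset T' n" "\<forall>a<t. T a n \<noteq> z" "\<forall>a<t. T' a n \<noteq> z" if z: "z \<in> ?Z" for z
          proof -
            have "z \<in> colset T n \<or> z \<in> colset T' n" using z nz by (auto simp: in_colset)
            then show "z \<in> colset T n" "z \<in> colset T' n" using cn by simp_all
            have 1: "T a n \<noteq> T t n" "T a n \<noteq> T (Suc t) n" "T' a n \<noteq> T' t n" "T' a n \<noteq> T' (Suc t) n" if "a < t" for a
              using KT_col[OF kt(1) nz(1), of a] KT_col[OF kt(1) nz(2), of a]
                KT_col[OF kt(2) nz(3), of a] KT_col[OF kt(2) nz(4), of a] that by auto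
            show "\<forall>a<t. T a n \<noteq> z" "\<forall>a<t. T' a n \<noteq> z" using z 1 low by auto
          qed
          have g1: "T t n \<le> z" if "z \<in> ?Z" "T t (Suc n) \<le> z" for z
            using greedy_min[OF kt(1) nz(1) Z(1)[OF that(1)] that(2) Z(3)[OF that(1)]] .
          have g2: "T (Suc t) n \<le> z" if "z \<in> ?Z" "z \<noteq> T t n" "T (Suc t) (Suc n) \<le> z" for z
            using greedy_min[OF kt(1) nz(2) Z(1)[OF that(1)] that(3)] Z(3)[OF that(1)] that(2) less_Suc_eq by metis
          have g1': "T' t n \<le> z" if "z \<in> ?Z" "T' t (Suc n) \<le> z" for z
            using greedy_min[OF kt(2) nz(3) Z(2)[OF that(1)] that(2) Z(4)[OF that(1)]] .
          have g2': "T' (Suc t) n \<le> z" if "z \<in> ?Z" "z \<noteq> T' t n" "T' (Suc t) (Suc n) \<le> z" for z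
            using greedy_min[OF kt(2) nz(4) Z(2)[OF that(1)] that(3)] Z(4)[OF that(1)] that(2) less_Suc_eq by metis
          note rows = KT_row[OF kt(1) n, of t] KT_row[OF kt(1) n, of "Suc t"]
            KT_row[OF kt(2) n, of t] KT_row[OF kt(2) n, of "Suc t"]
          \<comment> \<open>The two right neighbours agree as a set. In the same order they lead to
            the same choices; in exchanged order \<open>greedy_pair\<close> applies.\<close>
          show ?thesis
          proof (cases "T' t (Suc n) = T t (Suc n)")
            case True
            then have q: "T' (Suc t) (Suc n) = T (Suc t) (Suc n)" using IH(2) by (auto simp: doubleton_eq_iff)
            have "T' t n = T t n" using g1[of "T' t n"] g1'[of "T t n"] rows True by simp
            moreover have "T' (Suc t) n = T (Suc t) n"
              using g2[of "T' (Suc t) n"] g2'[of "T (Suc t) n"] rows q ne calculation by simp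
            ultimately show ?thesis by simp
          next
            case False
            then have pq: "T' t (Suc n) = T (Suc t) (Suc n)" "T' (Suc t) (Suc n) = T t (Suc n)"
              using IH(2) by (auto simp: doubleton_eq_iff)
            show ?thesis
              using rows ne g1 g2 g1' g2' unfolding pq
              by (intro greedy_pair[where p = "T t (Suc n)" and q = "T (Suc t) (Suc n)"]) blast+
          qed
        qed
      qed
      have "T' r n = T r n" if "r \<noteq> t" "r \<noteq> Suc t" for r
        using that
      proof (induction r rule: less_induct)
        case (less r)
        show ?case
        proof (cases "r < t")
          case True
          then show ?thesis by (rule low)
        next
          case False
          then have r: "Suc t < r" using less.prems by simp
          have "(\<exists>a<r. T a n = x) \<longleftrightarrow> (\<exists>a<r. T' a n = x)" for x
          proof -
            have split: "(\<exists>a<r. S a n = x) \<longleftrightarrow> (\<exists>a<r. a \<noteq> t \<and> a \<noteq> Suc t \<and> S a n = x) \<or> x \<in> {S t n, S (Suc t) n}" for S :: tableau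
            proof -
              have "t < r" using r by simp
              then show ?thesis using r by blast
            qed
            have "(\<exists>a<r. a \<noteq> t \<and> a \<noteq> Suc t \<and> T a n = x) \<longleftrightarrow> (\<exists>a<r. a \<noteq> t \<and> a \<noteq> Suc t \<and> T' a n = x)"
              using less.IH by auto
            then show ?thesis unfolding split[of T] split[of T'] pair by simp
          qed
          then show ?thesis using less.prems by (intro same) auto
        qed
      qed
      then show ?case using pair by blast
    qed
  qed
qed

text \<open>If row \<open>a\<close> exceeded row \<open>b\<close> in column 1, the key condition
  would carry this along row \<open>a\<close> and finally demand a positive entry beyond its
  end.\<close>

lemma KT_first_column_less:
  assumes kt: "KT \<alpha> T" and ab: "a < b" "\<alpha> a \<le> \<alpha> b" "\<alpha> a \<noteq> 0"
  shows "T a 1 < T b 1"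
proof (rule ccontr)
  assume *: "\<not> T a 1 < T b 1"
  have nz: "T b c \<noteq> 0" if "1 \<le> c" "c \<le> \<alpha> a" for c using KT_box[OF kt, of b c] that ab by simp
  have "1 \<le> \<alpha> a" using ab by simp
  then have "T a (\<alpha> a) > T b (\<alpha> a)"
  proof (induction rule: dec_induct)
    case base
    have "T b 1 \<noteq> T a 1" using KT_col[OF kt nz[of 1], of a] ab by auto
    then show ?case using * by simp
  next
    case (step c)
    then have "T b c < T a (Suc c)" using KT_cond[OF kt, of c a b] nz[of c] ab by simp
    then show ?case using KT_row[OF kt, of c b] step by simp
  qed
  then have "T b (\<alpha> a) < T a (Suc (\<alpha> a))" using KT_cond[OF kt, of "\<alpha> a" a b] nz[of "\<alpha> a"] ab by simp
  then show False using KT_box[OF kt, of a "Suc (\<alpha> a)"] by simp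
qed

section \<open>Flagged key tableaux as sets of words\<close>

lemma row_pos: "weak_composition \<alpha> \<Longrightarrow> KT \<alpha> T \<Longrightarrow> T r c \<noteq> 0 \<Longrightarrow> 1 \<le> r"
  using KT_box[of \<alpha> T r c] by (cases r) (auto simp: weak_composition_def)

text \<open>The only first-column entries that grow are some \<open>i\<close> above a row that
  already contained \<open>Suc i\<close>. So monotonicity of the bounds is required at the value
  \<open>Suc i\<close> alone, which also covers bounds modified in a single row.\<close>

lemma SSKT_e_closed:
  assumes wc: "weak_composition \<alpha>" and T: "T \<in> SSKT \<alpha> \<phi>" and i: "1 \<le> i" and e: "tableau_e i T = Some U"
    and fl: "\<And>a b. 1 \<le> a \<Longrightarrow> a < b \<Longrightarrow> Suc i \<le> \<phi> a \<Longrightarrow> Suc i \<le> \<phi> b"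
  shows "U \<in> SSKT \<alpha> \<phi>"
proof -
  have kt: "KT \<alpha> T" and f: "\<And>r. T r 1 \<le> \<phi> r" using T SSKT_iff[OF wc] by auto
  have "U r 1 \<le> \<phi> r" for r
    using tableau_e_first_column[OF wc kt i e]
  proof (elim disjE conjE exE)
    assume "\<forall>r. U r 1 = T r 1" then show ?thesis using f by simp
  next
    fix r0 assume r0: "T r0 1 = Suc i" "U r0 1 = i"
      "\<forall>r. r \<noteq> r0 \<longrightarrow> U r 1 = T r 1 \<or> r0 < r \<and> T r 1 = i \<and> U r 1 = Suc i"
    have "1 \<le> r0" using row_pos[OF wc kt, of r0 1] r0(1) by simp
    then have "Suc i \<le> \<phi> r" if "r0 < r" using fl[of r0 r] f[of r0] r0(1) that by simp
    then show ?thesis using r0 f[of r] f[of r0] by (cases "r = r0") (auto dest: spec[of _ r])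
  qed
  then show ?thesis using tableau_e_KT[OF wc kt i e] SSKT_iff[OF wc] by simp
qed

text \<open>\<open>Y\<close> consists of whole \<open>t\<close>-strings, and \<open>X\<close> meets
  each of them in its top or in all of it. Arrows point down the string; the clause with
  \<open>eps t V \<noteq> 0\<close> says that membership below the top is inherited
  downwards.\<close>

definition dem_step :: "nat \<Rightarrow> nat list set \<Rightarrow> nat list set \<Rightarrow> bool" where
  "dem_step t X Y \<longleftrightarrow> finite Y \<and> X \<subseteq> Y \<and> (\<forall>V W. arrow t V W \<longrightarrow> (V \<in> Y \<longleftrightarrow> W \<in> Y)) \<and>
     (\<forall>W\<in>Y. eps t W = 0 \<longrightarrow> W \<in> X) \<and> (\<forall>V W. arrow t V W \<longrightarrow> V \<in> X \<longrightarrow> eps t V \<noteq> 0 \<longrightarrow> W \<in> X) \<and>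
     (\<forall>V W. arrow t V W \<longrightarrow> W \<in> X \<longrightarrow> V \<in> X)"

text \<open>This is the number of boxes when \<open>m\<close> bounds the row lengths. Counting by
  columns makes the invariance under permuting rows visible.\<close>

definition csize :: "nat \<Rightarrow> (nat \<Rightarrow> nat) \<Rightarrow> nat" where
  "csize m \<alpha> = (\<Sum>c = 1..m. card {r. c \<le> \<alpha> r})"

lemma length_tword:
  assumes "weak_composition \<alpha>" "KT \<alpha> T"
  shows "length (tword m T) = csize m \<alpha>"
proof -
  have "length (colword m (colset T)) = (\<Sum>c = 1..m. card (colset T c))"
    by (induction m) (simp_all add: colword_Suc)
  then show ?thesis using card_colset[OF assms(2)] by (simp add: tword_def csize_def)
qed

lemma set_colword: "(\<And>c. finite (C c)) \<Longrightarrow> set (colword m C) = (\<Union>c\<in>{1..m}. C c)"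
  by (auto simp: colword_def atLeastLessThanSuc_atLeastAtMost simp del: upt_Suc)

lemma tword_in_words:
  assumes wc: "weak_composition \<alpha>" and T: "T \<in> SSKT \<alpha> \<phi>" and n: "\<And>r. \<alpha> r \<noteq> 0 \<Longrightarrow> \<phi> r \<le> n"
  shows "tword m T \<in> words n (csize m \<alpha>)"
proof -
  have kt: "KT \<alpha> T" and f: "\<And>r. T r 1 \<le> \<phi> r" using T SSKT_iff[OF wc] by auto
  have "x \<in> {1..n}" if x: "x \<in> set (tword m T)" for x
  proof -
    obtain r c where rc: "1 \<le> c" "T r c = x" "x \<noteq> 0"
      using x unfolding tword_def set_colword[of "colset T", OF finite_colset[OF wc kt]] by (auto simp: in_colset)
    have "x \<le> T r 1" using KT_row_mono[OF kt, of 1 c r] rc by simp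
    moreover have "\<alpha> r \<noteq> 0" using KT_box[OF kt, of r c] rc by auto
    ultimately show ?thesis using f[of r] n[of r] rc by simp
  qed
  then show ?thesis using length_tword[OF wc kt] by (auto simp: words_def)
qed

lemma inj_on_tword:
  assumes "weak_composition \<alpha>" "\<And>r. \<alpha> r \<le> m"
  shows "inj_on (tword m) (SSKT \<alpha> \<phi>)"
  using tword_KT_unique[OF assms(1) _ _ assms(2)] SSKT_iff[OF assms(1)] by (auto intro!: inj_onI)

lemma flag_bound:
  fixes \<phi> :: "nat \<Rightarrow> nat"
  assumes "weak_composition \<alpha>"
  obtains n where "\<And>r. \<alpha> r \<noteq> 0 \<Longrightarrow> \<phi> r \<le> n"
proof -
  have "finite (\<phi> ` {r. \<alpha> r \<noteq> 0})" using assms by (simp add: weak_composition_def)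
  then have "\<phi> r \<le> Max (\<phi> ` {r. \<alpha> r \<noteq> 0})" if "\<alpha> r \<noteq> 0" for r using that by (intro Max_ge) auto
  then show ?thesis by (rule that)
qed

lemma finite_SSKT:
  assumes wc: "weak_composition \<alpha>"
  shows "finite (SSKT \<alpha> \<phi>)"
proof -
  obtain m where m: "\<And>r. \<alpha> r \<le> m" by (rule weak_composition_bound[OF wc]) blast
  obtain n where n: "\<And>r. \<alpha> r \<noteq> 0 \<Longrightarrow> \<phi> r \<le> n" by (rule flag_bound[OF wc, of \<phi>]) blast
  have "tword m ` SSKT \<alpha> \<phi> \<subseteq> words n (csize m \<alpha>)"
  proof (rule image_subsetI)
    fix T assume "T \<in> SSKT \<alpha> \<phi>"
    then show "tword m T \<in> words n (csize m \<alpha>)" by (rule tword_in_words[OF wc]) (rule n)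
  qed
  then have "finite (tword m ` SSKT \<alpha> \<phi>)" by (rule finite_subset) (rule finite_words)
  then show ?thesis using finite_image_iff[OF inj_on_tword[OF wc m]] by simp
qed

lemma tableau_e_arrow_iff:
  assumes wc: "weak_composition \<alpha>" and kt: "KT \<alpha> T" and i: "1 \<le> i" and m: "\<And>r. \<alpha> r \<le> m" and arr: "arrow i V (tword m T)"
  shows "\<exists>U. tableau_e i T = Some U \<and> tword m U = V"
proof -
  have "tableau_e i T \<noteq> None" using tableau_e_None_iff[OF wc kt i m] arrow_eps[OF arr] by simp
  then obtain U where U: "tableau_e i T = Some U" by blast
  then show ?thesis using arrow_unique_source[OF tableau_e_arrow[OF wc kt i U m] arr] by blast
qed

text \<open>The hypotheses on the bounds say that \<open>t\<close> is the bound of row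
  \<open>j\<close> alone, with smaller bounds below and larger ones above, so that moving between
  \<open>t\<close> and \<open>Suc t\<close> in column 1 concerns no other bound.\<close>

lemma SSKT_dem_step:
  assumes wc: "weak_composition \<alpha>" and m: "\<And>r. \<alpha> r \<le> m" and t: "1 \<le> t"
    and \<phi>: "\<phi> j = t" "\<And>r. 1 \<le> r \<Longrightarrow> r < j \<Longrightarrow> \<phi> r < t" "\<And>r. j < r \<Longrightarrow> t < \<phi> r"
  shows "dem_step t (tword m ` SSKT \<alpha> \<phi>) (tword m ` SSKT \<alpha> (\<phi>(j := Suc t)))"
proof -
  let ?\<phi> = "\<phi>(j := Suc t)"
  let ?X = "SSKT \<alpha> \<phi>" and ?Y = "SSKT \<alpha> ?\<phi>"
  have D: "KT \<alpha> T" "T r 1 \<le> \<psi> r" if "T \<in> SSKT \<alpha> \<psi>" for T \<psi> r using that SSKT_iff[OF wc] by auto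
  have XY: "?X \<subseteq> ?Y"
  proof
    fix T assume T: "T \<in> ?X"
    have "T r 1 \<le> ?\<phi> r" for r using D(2)[OF T, of r] \<phi>(1) by (cases "r = j") auto
    then show "T \<in> ?Y" using D(1)[OF T] SSKT_iff[OF wc] by simp
  qed
  have eX: "U \<in> ?X" if "T \<in> ?X" "tableau_e t T = Some U" for T U
  proof (rule SSKT_e_closed[OF wc that(1) t that(2)])
    show "Suc t \<le> \<phi> b" if "1 \<le> a" "a < b" "Suc t \<le> \<phi> a" for a b
      using \<phi>(1) \<phi>(2)[of a] \<phi>(3)[of b] that by (cases a j rule: linorder_cases) auto
  qed
  have eY: "U \<in> ?Y" if "T \<in> ?Y" "tableau_e t T = Some U" for T U
  proof (rule SSKT_e_closed[OF wc that(1) t that(2)])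
    show "Suc t \<le> ?\<phi> b" if "1 \<le> a" "a < b" "Suc t \<le> ?\<phi> a" for a b
      using \<phi>(2)[of a] \<phi>(3)[of b] that by (cases a j rule: linorder_cases) auto
  qed
  have fY: "T \<in> ?Y" if kt: "KT \<alpha> T" and e: "tableau_e t T = Some U" and U: "U \<in> ?Y" for T U
  proof -
    have "T r 1 \<le> ?\<phi> r" for r
      using tableau_e_first_column[OF wc kt t e]
    proof (elim disjE conjE exE)
      assume "\<forall>r. U r 1 = T r 1" then show ?thesis using D(2)[OF U] by metis
    next
      fix r0 assume r0: "T r0 1 = Suc t" "U r0 1 = t"
        "\<forall>r. r \<noteq> r0 \<longrightarrow> U r 1 = T r 1 \<or> r0 < r \<and> T r 1 = t \<and> U r 1 = Suc t"
      have r1: "1 \<le> r0" using row_pos[OF wc kt, of r0 1] r0(1) by simp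
      show ?thesis
      proof (cases "r = r0")
        case True
        \<comment> \<open>The raised tableau has \<open>t\<close> in row \<open>r0\<close>, so
          \<open>r0\<close> is not below \<open>j\<close>, and from row \<open>j\<close> on the new
          bounds are at least \<open>Suc t\<close>.\<close>
        have "t \<le> ?\<phi> r0" using D(2)[OF U, of r0] r0(2) by simp
        then show ?thesis using True r0(1) r1 \<phi>(2)[of r0] \<phi>(3)[of r0] by (cases r0 j rule: linorder_cases) auto
      next
        case False
        then show ?thesis using r0(3) D(2)[OF U, of r] by force
      qed
    qed
    then show ?thesis using kt SSKT_iff[OF wc] by simp
  qed
  have top: "T \<in> ?X" if T: "T \<in> ?Y" and e: "tableau_e t T = None" for T
  proof -
    \<comment> \<open>In a top element an \<open>Suc t\<close> here would require a first-column
      entry of at least \<open>t\<close> in a lower row, whose bound is less than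
      \<open>t\<close>.\<close>
    have "T j 1 \<noteq> Suc t"
    proof
      assume "T j 1 = Suc t"
      then obtain r where r: "r < j" "t \<le> T r 1" using first_column_highest[OF wc D(1)[OF T] t e] by blast
      have "1 \<le> r" using row_pos[OF wc D(1)[OF T], of r 1] r(2) t by simp
      then show False using \<phi>(2)[of r] D(2)[OF T, of r] r by simp
    qed
    then have "T r 1 \<le> \<phi> r" for r using D(2)[OF T, of r] \<phi>(1) by (cases "r = j") auto
    then show ?thesis using D(1)[OF T] SSKT_iff[OF wc] by simp
  qed
  have string: "T \<in> ?X" if kt: "KT \<alpha> T" and e: "tableau_e t T = Some U" and U: "U \<in> ?X" "tableau_e t U \<noteq> None" for T U
  proof -
    \<comment> \<open>\<open>U\<close> is not a top, whereas column 1 changes only in the step that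
      reaches the top.\<close>
    have "\<forall>r. U r 1 = T r 1" using tableau_e_first_column[OF wc kt t e] U(2) by blast
    then have "T r 1 \<le> \<phi> r" for r using D(2)[OF U(1)] by metis
    then show ?thesis using kt SSKT_iff[OF wc] by simp
  qed
  show ?thesis unfolding dem_step_def
  proof (intro conjI allI ballI impI)
    show "finite (tword m ` ?Y)" using finite_SSKT[OF wc] by simp
    show "tword m ` ?X \<subseteq> tword m ` ?Y" using XY by blast
  next
    fix V W assume arr: "arrow t V W"
    show "V \<in> tword m ` ?Y \<longleftrightarrow> W \<in> tword m ` ?Y"
    proof
      assume "V \<in> tword m ` ?Y"
      then obtain U where U: "U \<in> ?Y" "V = tword m U" by blast
      then show "W \<in> tword m ` ?Y" using arrow_lift[OF wc D(1)[OF U(1)] t m] arr fY by blast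
    next
      assume "W \<in> tword m ` ?Y"
      then obtain T where T: "T \<in> ?Y" "W = tword m T" by blast
      then show "V \<in> tword m ` ?Y" using tableau_e_arrow_iff[OF wc D(1)[OF T(1)] t m] arr eY by blast
    qed
    show "V \<in> tword m ` ?X" if W: "W \<in> tword m ` ?X"
    proof -
      obtain T where T: "T \<in> ?X" "W = tword m T" using W by blast
      then show ?thesis using tableau_e_arrow_iff[OF wc D(1)[OF T(1)] t m] arr eX by blast
    qed
    show "W \<in> tword m ` ?X" if V: "V \<in> tword m ` ?X" "eps t V \<noteq> 0"
    proof -
      obtain U where U: "U \<in> ?X" "V = tword m U" using V by blast
      moreover have "tableau_e t U \<noteq> None" using tableau_e_None_iff[OF wc D(1)[OF U(1)] t m] V U(2) by simp
      ultimately show ?thesis using arrow_lift[OF wc D(1)[OF U(1)] t m] arr string by blast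
    qed
  next
    fix W assume "W \<in> tword m ` ?Y" "eps t W = 0"
    then show "W \<in> tword m ` ?X" using top tableau_e_None_iff[OF wc D(1) t m] by blast
  qed
qed

section \<open>Weights of tableaux and of words\<close>

lemma count_list_colword:
  assumes "\<And>c. finite (C c)"
  shows "count_list (colword m C) x = card {c \<in> {1..m}. x \<in> C c}"
proof (induction m)
  case (Suc m)
  have "{c \<in> {1..Suc m}. x \<in> C c} = (if x \<in> C (Suc m) then insert (Suc m) else id) {c \<in> {1..m}. x \<in> C c}"
    by (auto simp: le_Suc_eq)
  then show ?case using Suc assms by (auto simp: colword_Suc count_list_distinct)
qed simp

lemma tableau_wt_tword:
  assumes wc: "weak_composition \<alpha>" and kt: "KT \<alpha> T" and m: "\<And>r. \<alpha> r \<le> m"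
  shows "tableau_wt T = count_list (tword m T)"
proof
  fix x
  define L where "L = concat (map (\<lambda>r. map (Pair r) [1..<Suc (shape T r)]) (rev [1..<Suc (height T)]))"
  have RL: "row_reading T = map (\<lambda>(r, c). T r c) L"
    unfolding row_reading_def L_def map_concat by (simp add: comp_def del: upt_Suc)
  have shape: "shape T r = \<alpha> r" for r
  proof -
    have "{c. (r, c) \<in> boxes T} = {1..\<alpha> r}" using KT_box[OF kt] by (auto simp: boxes_def)
    then show ?thesis by (simp add: shape_def)
  qed
  have "sorted_wrt (\<lambda>x y. fst y < fst x \<or> fst y = fst x \<and> snd x < snd y) L"
    unfolding L_def
    by (intro sorted_wrt_concat_map[where Q = "(>)"] sorted_rev_upt)
      (auto simp: sorted_wrt_map sorted_wrt_upt simp del: upt_Suc)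
  then have dist: "distinct L"
    unfolding sorted_wrt_iff_nth_less distinct_conv_nth by (metis (no_types, lifting) less_irrefl nat_neq_iff)
  have "set L = boxes T"
  proof (intro set_eqI iffI)
    fix y assume "y \<in> set L"
    then show "y \<in> boxes T" using KT_box[OF kt] by (auto simp: L_def boxes_def shape simp del: upt_Suc)
  next
    fix y assume y: "y \<in> boxes T"
    obtain r c where rc: "y = (r, c)" by fastforce
    have "r \<le> height T" using y rc finite_KT_boxes[OF wc kt] unfolding height_def
      by (auto intro!: Max_ge rev_image_eqI)
    moreover have "1 \<le> r" using row_pos[OF wc kt] y rc by (auto simp: boxes_def)
    moreover have "1 \<le> c" "c \<le> \<alpha> r" using KT_box[OF kt, of r c] y rc by (auto simp: boxes_def)
    ultimately have "r \<in> {1..<Suc (height T)}" "c \<in> {1..<Suc (\<alpha> r)}" by auto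
    then show "y \<in> set L" unfolding L_def rc by (auto simp: shape simp del: upt_Suc intro!: bexI[of _ r])
  qed
  then have "tableau_wt T x = card {y \<in> boxes T. (case y of (r, c) \<Rightarrow> T r c) = x}"
    unfolding tableau_wt_def RL using count_list_map_card[OF dist] by simp
  also have "\<dots> = card (snd ` {y \<in> boxes T. (case y of (r, c) \<Rightarrow> T r c) = x})"
  proof (rule card_image[symmetric], rule inj_onI)
    fix y z assume "y \<in> {y \<in> boxes T. (case y of (r, c) \<Rightarrow> T r c) = x}" "z \<in> {y \<in> boxes T. (case y of (r, c) \<Rightarrow> T r c) = x}"
      "snd y = snd z"
    moreover obtain a b a' b' where "y = (a, b)" "z = (a', b')" by fastforce
    ultimately show "y = z" using KT_col[OF kt, of a b a'] by (auto simp: boxes_def)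
  qed
  also have "snd ` {y \<in> boxes T. (case y of (r, c) \<Rightarrow> T r c) = x} = {c \<in> {1..m}. x \<in> colset T c}"
  proof (intro set_eqI iffI)
    fix c assume "c \<in> snd ` {y \<in> boxes T. (case y of (r, c) \<Rightarrow> T r c) = x}"
    then obtain r where "T r c \<noteq> 0" "T r c = x" by (auto simp: boxes_def)
    then show "c \<in> {c \<in> {1..m}. x \<in> colset T c}" using KT_box[OF kt, of r c] m[of r] by (auto simp: in_colset)
  next
    fix c assume "c \<in> {c \<in> {1..m}. x \<in> colset T c}"
    then obtain r where "T r c \<noteq> 0" "T r c = x" by (auto simp: in_colset)
    then show "c \<in> snd ` {y \<in> boxes T. (case y of (r, c) \<Rightarrow> T r c) = x}"
      by (intro image_eqI[of _ _ "(r, c)"]) (auto simp: boxes_def)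
  qed
  also have "card {c \<in> {1..m}. x \<in> colset T c} = count_list (tword m T) x"
    unfolding tword_def using count_list_colword[of "colset T", OF finite_colset[OF wc kt]] by simp
  finally show "tableau_wt T x = count_list (tword m T) x" .
qed

section \<open>Permuting the rows of the shape\<close>

lemma weak_composition_transpose:
  assumes "weak_composition \<alpha>" "1 \<le> t"
  shows "weak_composition (\<alpha> \<circ> transpose t (Suc t))"
proof -
  have "finite (transpose t (Suc t) -` {i. \<alpha> i \<noteq> 0})"
    using assms by (intro finite_vimageI) (auto simp: weak_composition_def)
  moreover have "{i. (\<alpha> \<circ> transpose t (Suc t)) i \<noteq> 0} = transpose t (Suc t) -` {i. \<alpha> i \<noteq> 0}" by auto
  ultimately show ?thesis using assms by (simp add: weak_composition_def transpose_def)
qed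

lemma card_transpose: "card {r. c \<le> (\<alpha> \<circ> transpose t (Suc t)) r} = card {r. c \<le> \<alpha> r}"
proof -
  have "{r. c \<le> (\<alpha> \<circ> transpose t (Suc t)) r} = transpose t (Suc t) -` {r. c \<le> \<alpha> r}" by auto
  moreover have "card (transpose t (Suc t) -` {r. c \<le> \<alpha> r}) = card {r. c \<le> \<alpha> r}"
    by (rule card_vimage_inj) (simp_all add: surj_def)
  ultimately show ?thesis by simp
qed

lemma csize_transpose: "csize m (\<alpha> \<circ> transpose t (Suc t)) = csize m \<alpha>"
  unfolding csize_def card_transpose ..

text \<open>The existence criterion involves the shape only through the column sizes.\<close>

lemma KT_change_shape:
  assumes wc: "weak_composition \<alpha>" "weak_composition \<beta>" and kt: "KT \<alpha> T"
    and card: "\<And>c. 1 \<le> c \<Longrightarrow> card {r. c \<le> \<beta> r} = card {r. c \<le> \<alpha> r}"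
  shows "\<exists>T'. KT \<beta> T' \<and> (\<forall>c\<ge>1. colset T' c = colset T c)"
proof (rule KT_exists[OF wc(2)])
  show "finite (colset T c)" for c by (rule finite_colset[OF wc(1) kt])
  show "0 \<notin> colset T c" for c by (simp add: in_colset)
  show "card (colset T c) = card {r. c \<le> \<beta> r}" if "1 \<le> c" for c using card_colset[OF kt that] card[OF that] by simp
  show "card {x \<in> colset T (Suc c). v \<le> x} \<le> card {x \<in> colset T c. v \<le> x}" if "1 \<le> c" for c v
    by (rule KT_dominance[OF wc(1) kt that])
qed

lemma tword_cong: "(\<And>c. 1 \<le> c \<Longrightarrow> colset T c = colset T' c) \<Longrightarrow> tword m T = tword m T'"
  unfolding tword_def by (rule colword_cong) simp

text \<open>Refill the same columns: the first entries of rows \<open>t\<close> and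
  \<open>Suc t\<close> form the same pair, bounded by \<open>Suc t\<close> on either side. In the
  exchanged shape row \<open>t\<close> is the shorter one, so its first entry is the smaller one and
  is at most \<open>t\<close>.\<close>

lemma SSKT_swap_words:
  assumes wc: "weak_composition \<alpha>" and t: "1 \<le> t" and less: "\<alpha> (Suc t) < \<alpha> t"
  shows "tword m ` SSKT \<alpha> ((\<lambda>r. r)(t := Suc t)) = tword m ` SSKT (\<alpha> \<circ> transpose t (Suc t)) (\<lambda>r. r)"
proof (intro equalityI image_subsetI)
  let ?\<beta> = "\<alpha> \<circ> transpose t (Suc t)" and ?\<phi> = "(\<lambda>r. r)(t := Suc t)"
  have wc': "weak_composition ?\<beta>" by (rule weak_composition_transpose[OF wc t])
  {
    fix T assume "T \<in> SSKT \<alpha> ?\<phi>"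
    then have kt: "KT \<alpha> T" and f: "\<And>r. T r 1 \<le> ?\<phi> r" using SSKT_iff[OF wc] by auto
    obtain T' where kt': "KT ?\<beta> T'" and col: "\<And>c. 1 \<le> c \<Longrightarrow> colset T' c = colset T c"
      using KT_change_shape[OF wc wc' kt card_transpose] by blast
    have sw: "\<And>r. r \<noteq> t \<Longrightarrow> r \<noteq> Suc t \<Longrightarrow> T' r 1 = T r 1" "{T' t 1, T' (Suc t) 1} = {T t 1, T (Suc t) 1}"
      using KT_swap_rows[OF wc kt kt' col[symmetric], of 1] by auto
    have le: "T' t 1 \<le> Suc t" "T' (Suc t) 1 \<le> Suc t" using sw(2) f[of t] f[of "Suc t"] by (auto simp: doubleton_eq_iff)
    have "T' t 1 \<le> t"
    proof (cases "?\<beta> t = 0")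
      case True
      then show ?thesis using KT_box[OF kt', of t 1] by simp
    next
      case False
      then have "T' t 1 < T' (Suc t) 1"
        using less by (intro KT_first_column_less[OF kt']) (auto simp: transpose_def)
      then show ?thesis using le by simp
    qed
    then have "T' r 1 \<le> r" for r using le sw(1)[of r] f[of r] by (cases "r = t"; cases "r = Suc t") auto
    then have "T' \<in> SSKT ?\<beta> (\<lambda>r. r)" using kt' SSKT_iff[OF wc'] by simp
    moreover have "tword m T = tword m T'" by (rule tword_cong) (simp add: col)
    ultimately show "tword m T \<in> tword m ` SSKT ?\<beta> (\<lambda>r. r)" by blast
  next
    fix T' assume "T' \<in> SSKT ?\<beta> (\<lambda>r. r)"
    then have kt': "KT ?\<beta> T'" and f: "\<And>r. T' r 1 \<le> r" using SSKT_iff[OF wc'] by auto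
    obtain T where kt: "KT \<alpha> T" and col: "\<And>c. 1 \<le> c \<Longrightarrow> colset T c = colset T' c"
      using KT_change_shape[OF wc' wc kt' card_transpose[symmetric]] by blast
    have sw: "\<And>r. r \<noteq> t \<Longrightarrow> r \<noteq> Suc t \<Longrightarrow> T' r 1 = T r 1" "{T' t 1, T' (Suc t) 1} = {T t 1, T (Suc t) 1}"
      using KT_swap_rows[OF wc kt kt' col, of 1] by auto
    have le: "T t 1 \<le> Suc t" "T (Suc t) 1 \<le> Suc t" using sw(2) f[of t] f[of "Suc t"] by (auto simp: doubleton_eq_iff)
    have "T r 1 \<le> ?\<phi> r" for r using le sw(1)[of r] f[of r] by (cases "r = t"; cases "r = Suc t") auto
    then have "T \<in> SSKT \<alpha> ?\<phi>" using kt SSKT_iff[OF wc] by simp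
    moreover have "tword m T' = tword m T" by (rule tword_cong) (simp add: col)
    ultimately show "tword m T' \<in> tword m ` SSKT \<alpha> ?\<phi>" by blast
  }
qed

text \<open>Row \<open>t\<close> starts with an entry smaller than that of row \<open>Suc t\<close>,
  which is at most \<open>Suc t\<close>; the larger bound is never reached.\<close>

lemma SSKT_raise_flag_trivial:
  assumes wc: "weak_composition \<alpha>" and le: "\<alpha> t \<le> \<alpha> (Suc t)"
  shows "SSKT \<alpha> ((\<lambda>r. r)(t := Suc t)) = SSKT \<alpha> (\<lambda>r. r)"
proof (intro set_eqI)
  fix T
  have *: "T t 1 \<le> t" if kt: "KT \<alpha> T" and f: "\<forall>r. T r 1 \<le> ((\<lambda>r. r)(t := Suc t)) r"
  proof (cases "\<alpha> t = 0")
    case True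
    then show ?thesis using KT_box[OF kt, of t 1] by simp
  next
    case False
    then have "T t 1 < T (Suc t) 1" using le by (intro KT_first_column_less[OF kt]) auto
    moreover have "T (Suc t) 1 \<le> Suc t" using f[rule_format, of "Suc t"] by simp
    ultimately show ?thesis by simp
  qed
  show "T \<in> SSKT \<alpha> ((\<lambda>r. r)(t := Suc t)) \<longleftrightarrow> T \<in> SSKT \<alpha> (\<lambda>r. r)"
    unfolding SSKT_iff[OF wc]
  proof (intro iffI conjI allI; elim conjE)
    fix r assume "KT \<alpha> T" and f: "\<forall>r. T r 1 \<le> ((\<lambda>r. r)(t := Suc t)) r"
    then show "T r 1 \<le> r" using * f[rule_format, of r] by (cases "r = t") auto
  next
    fix r assume "\<forall>r. T r 1 \<le> r"
    then have "T r 1 \<le> r" by blast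
    then show "T r 1 \<le> ((\<lambda>r. r)(t := Suc t)) r" by (cases "r = t") auto
  qed
qed

definition yamanouchi :: "(nat \<Rightarrow> nat) \<Rightarrow> tableau" where
  "yamanouchi \<mu> r c = (if 1 \<le> c \<and> c \<le> \<mu> r then r else 0)"

text \<open>In a partition shape the rows below \<open>r\<close> reach every column of row
  \<open>r\<close> and inductively use up 1, ..., r - 1 there; the flag leaves only
  \<open>r\<close>.\<close>

lemma SSKT_partition:
  assumes "is_partition \<mu>"
  shows "SSKT \<mu> (\<lambda>r. r) = {yamanouchi \<mu>}"
proof -
  have wc: "weak_composition \<mu>" and dec: "\<And>i. 1 \<le> i \<Longrightarrow> \<mu> (Suc i) \<le> \<mu> i" using assms by (auto simp: is_partition_def)
  have mono: "\<mu> b \<le> \<mu> a" if "1 \<le> a" "a \<le> b" for a b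
    using that(2,1) by (induction rule: dec_induct) (use dec le_trans in \<open>auto, blast\<close>)
  have r0: "r \<noteq> 0" if "1 \<le> c" "c \<le> \<mu> r" for r c using that wc by (cases r) (auto simp: weak_composition_def)
  have kty: "KT \<mu> (yamanouchi \<mu>)" unfolding KT_def yamanouchi_def using r0 by auto
  have fy: "\<forall>r. yamanouchi \<mu> r 1 \<le> r" by (simp add: yamanouchi_def)
  have unique: "T = yamanouchi \<mu>" if kt: "KT \<mu> T" and f: "\<forall>r. T r 1 \<le> r" for T
  proof (intro ext)
    fix r c
    show "T r c = yamanouchi \<mu> r c"
    proof (induction r rule: less_induct)
      case (less r)
      show ?case
      proof (cases "1 \<le> c \<and> c \<le> \<mu> r")
        case True
        have "T a c = a" if "1 \<le> a" "a < r" for a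
          using less[OF that(2)] mono[of a r] that True by (simp add: yamanouchi_def)
        moreover have "T r c \<le> r" using KT_row_mono[OF kt, of 1 c r] f True le_trans by blast
        moreover have "T r c \<noteq> 0" using KT_box[OF kt, of r c] True by simp
        moreover have "T r c \<noteq> T a c" if "a \<noteq> r" for a using KT_col[OF kt calculation(3), of a] that by auto
        ultimately have "T r c = r" by (metis le_neq_implies_less less_one not_le nat_neq_iff)
        then show ?thesis using True by (simp add: yamanouchi_def)
      next
        case False
        then show ?thesis using KT_box[OF kt, of r c] unfolding yamanouchi_def by (cases "T r c = 0") auto
      qed
    qed
  qed
  show ?thesis
  proof (intro equalityI subsetI)
    fix T assume "T \<in> SSKT \<mu> (\<lambda>r. r)"
    then show "T \<in> {yamanouchi \<mu>}" using unique SSKT_iff[OF wc] by simp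
  next
    fix T assume "T \<in> {yamanouchi \<mu>}"
    then show "T \<in> SSKT \<mu> (\<lambda>r. r)" using kty fy SSKT_iff[OF wc] by simp
  qed
qed

section \<open>Demazure operators on sets of words\<close>

lemma arrow_words:
  assumes "arrow i V W" "i \<in> {1..<n}"
  shows "V \<in> words n N \<longleftrightarrow> W \<in> words n N"
proof -
  obtain xs ys where "V = xs @ i # ys" "W = xs @ Suc i # ys" using assms(1) by (auto simp: arrow_def)
  moreover have "i \<in> {1..n}" "Suc i \<in> {1..n}" using assms(2) by auto
  ultimately show ?thesis by (simp add: words_def)
qed

lemma raise_pow_0: "raise_pow C i 0 b = Some b"
  by (simp add: raise_pow_def)

lemma raise_pow_Suc: "raise_pow C i (Suc k) b = (case raise C i b of None \<Rightarrow> None | Some c \<Rightarrow> raise_pow C i k c)"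
proof -
  have "((\<lambda>x. Option.bind x (raise C i)) ^^ k) None = None" by (induction k) auto
  then show ?thesis by (cases "raise C i b") (simp_all add: raise_pow_def funpow_Suc_right del: funpow.simps)
qed

text \<open>Raising an element of \<open>Y\<close> ends at the top of its string, which lies in
  \<open>X\<close>. Conversely, whatever can be raised into \<open>X\<close> lies in a string of
  \<open>Y\<close>.\<close>

lemma dem_step_demazure_op:
  assumes ds: "dem_step t X Y" and Y: "Y \<subseteq> words n N" and t: "t \<in> {1..<n}"
  shows "demazure_op (RF_crystal n (word_perm (odds N))) t (enc n ` X) = enc n ` Y"
proof -
  let ?C = "RF_crystal n (word_perm (odds N))"
  have XY: "X \<subseteq> Y" and a: "\<And>V W. arrow t V W \<Longrightarrow> V \<in> Y \<longleftrightarrow> W \<in> Y" and top: "\<And>W. W \<in> Y \<Longrightarrow> eps t W = 0 \<Longrightarrow> W \<in> X"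
    using ds by (auto simp: dem_step_def)
  have sub: "V \<in> Y" if "V \<in> words n N" "raise_pow ?C t k (enc n V) = Some c" "c \<in> enc n ` X" for k V c
    using that(1,2)
  proof (induction k arbitrary: V)
    case 0
    then have "enc n V \<in> enc n ` X" using that(3) by (simp add: raise_pow_0)
    then obtain V' where "V' \<in> X" "enc n V = enc n V'" by blast
    then have "V \<in> X" using inj_onD[OF inj_on_enc, of n V V' N] 0 XY Y by auto
    then show ?case using XY by blast
  next
    case (Suc k)
    show ?case
    proof (cases "eps t V = 0")
      case True
      then show ?thesis using Suc.prems RF_e_enc(1)[OF t True] by (simp add: raise_pow_Suc RF_crystal_def)
    next
      case False
      then obtain V' where V': "arrow t V' V" using arrow_into by blast
      then have "raise_pow ?C t k (enc n V') = Some c"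
        using Suc.prems RF_e_enc(2)[OF t V'] by (simp add: raise_pow_Suc RF_crystal_def)
      then have "V' \<in> Y" using Suc.IH[of V'] arrow_words[OF V' t] Suc.prems(1) by blast
      then show ?thesis using a[OF V'] by blast
    qed
  qed
  have sup: "\<exists>k. \<exists>c\<in>enc n ` X. raise_pow ?C t k (enc n W) = Some c" if "W \<in> Y" for W
    using that
  proof (induction "eps t W" arbitrary: W)
    case 0
    then show ?case using top[of W] raise_pow_0[of ?C t "enc n W"] by auto
  next
    case (Suc e)
    then have "eps t W \<noteq> 0" by simp
    then obtain V where V: "arrow t V W" using arrow_into by blast
    then have "e = eps t V" "V \<in> Y" using arrow_eps[OF V] Suc a[OF V] by auto
    then obtain k c where "c \<in> enc n ` X" "raise_pow ?C t k (enc n V) = Some c" using Suc.hyps(1)[of V] by blast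
    then have "raise_pow ?C t (Suc k) (enc n W) = Some c"
      using RF_e_enc(2)[OF t V] by (simp add: raise_pow_Suc RF_crystal_def)
    then show ?case using \<open>c \<in> enc n ` X\<close> by blast
  qed
  have el: "elems ?C = enc n ` words n N" by (simp add: RF_crystal_def RF_odds)
  show ?thesis
  proof (intro equalityI subsetI)
    fix b assume "b \<in> demazure_op ?C t (enc n ` X)"
    then obtain V k c where "V \<in> words n N" "b = enc n V" "c \<in> enc n ` X" "raise_pow ?C t k b = Some c"
      unfolding demazure_op_def el by blast
    then show "b \<in> enc n ` Y" using sub by blast
  next
    fix b assume "b \<in> enc n ` Y"
    then show "b \<in> demazure_op ?C t (enc n ` X)" unfolding demazure_op_def el using sup Y by blast
  qed
qed

section \<open>Characters\<close>

lemma lookup_Abs: "finite {x. f x \<noteq> 0} \<Longrightarrow> Poly_Mapping.lookup (Abs_poly_mapping f) = f"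
  by simp

lemma lookup_map_key_transpose:
  "Poly_Mapping.lookup (Poly_Mapping.map_key (transpose i (Suc i)) p) k = Poly_Mapping.lookup p (transpose i (Suc i) k)"
  by (simp add: map_key.rep_eq)

lemma map_key_transpose_involutory:
  "Poly_Mapping.map_key (transpose i (Suc i)) (Poly_Mapping.map_key (transpose i (Suc i)) p) = p"
  by (rule poly_mapping_eqI) (simp add: lookup_map_key_transpose)

lemma inj_map_key_transpose: "inj (Poly_Mapping.map_key (transpose i (Suc i)))"
  by (rule injI) (metis map_key_transpose_involutory)

lemma swap_vars_add: "swap_vars i (p + q) = swap_vars i p + swap_vars i q"
  unfolding swap_vars_def by (rule map_key_plus[OF inj_map_key_transpose])

lemma swap_vars_0: "swap_vars i 0 = 0"
  using swap_vars_add[of i 0 0] by simp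

lemma swap_vars_sum: "swap_vars i (sum f A) = (\<Sum>x\<in>A. swap_vars i (f x))"
  by (induction A rule: infinite_finite_induct) (simp_all add: swap_vars_0 swap_vars_add)

lemma finite_support_transpose:
  "finite {x. (\<beta> :: nat \<Rightarrow> nat) x \<noteq> 0} \<Longrightarrow> finite {x. (\<beta> \<circ> transpose i (Suc i)) x \<noteq> 0}"
proof -
  assume "finite {x. \<beta> x \<noteq> 0}"
  then have "finite (transpose i (Suc i) -` {x. \<beta> x \<noteq> 0})" by (rule finite_vimageI) simp
  then show ?thesis by (simp add: vimage_def)
qed

lemma swap_vars_monomial:
  assumes "finite {x. (\<beta> :: nat \<Rightarrow> nat) x \<noteq> 0}"
  shows "swap_vars i (monomial \<beta>) = monomial (\<beta> \<circ> transpose i (Suc i))"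
proof -
  let ?f = "Poly_Mapping.map_key (transpose i (Suc i)) :: (nat \<Rightarrow>\<^sub>0 nat) \<Rightarrow> _"
  have "swap_vars i (monomial \<beta>) = Poly_Mapping.map_key ?f (Poly_Mapping.single (?f (?f (Abs_poly_mapping \<beta>))) 1)"
    unfolding swap_vars_def monomial_def map_key_transpose_involutory ..
  also have "\<dots> = Poly_Mapping.single (?f (Abs_poly_mapping \<beta>)) 1"
    by (rule map_key_single[OF inj_map_key_transpose])
  also have "?f (Abs_poly_mapping \<beta>) = Abs_poly_mapping (\<beta> \<circ> transpose i (Suc i))"
    by (rule poly_mapping_eqI)
      (simp only: lookup_map_key_transpose lookup_Abs[OF assms] lookup_Abs[OF finite_support_transpose[OF assms]] o_apply)
  finally show ?thesis by (simp add: monomial_def)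
qed

lemma var_times_monomial:
  assumes "finite {x. (\<beta> :: nat \<Rightarrow> nat) x \<noteq> 0}"
  shows "var i * monomial \<beta> = monomial (\<beta>(i := Suc (\<beta> i)))"
proof -
  have "{x. (\<beta>(i := Suc (\<beta> i))) x \<noteq> 0} \<subseteq> insert i {x. \<beta> x \<noteq> 0}" by auto
  then have fin: "finite {x. (\<beta>(i := Suc (\<beta> i))) x \<noteq> 0}" by (rule finite_subset) (use assms in simp)
  have "Poly_Mapping.single i 1 + Abs_poly_mapping \<beta> = Abs_poly_mapping (\<beta>(i := Suc (\<beta> i)))"
    by (rule poly_mapping_eqI) (simp only: lookup_add lookup_Abs[OF assms] lookup_Abs[OF fin], simp add: lookup_single when_def)
  then show ?thesis unfolding var_def monomial_def mult_single by simp
qed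

lemma var_diff_nonzero: "var i - var (Suc i) \<noteq> 0"
proof
  assume "var i - var (Suc i) = 0"
  then have "var i = var (Suc i)" by simp
  then have "Poly_Mapping.lookup (var i) (Poly_Mapping.single i 1) = Poly_Mapping.lookup (var (Suc i)) (Poly_Mapping.single i 1)"
    by simp
  moreover have "Poly_Mapping.single i (1::nat) \<noteq> Poly_Mapping.single (Suc i) 1"
    by (metis lookup_single_eq lookup_single_not_eq n_not_Suc_n zero_neq_one)
  ultimately show False by (simp add: var_def lookup_single when_def)
qed

text \<open>\<open>divided_difference\<close> is a definite description; the polynomial ring has no
  zero divisors, so any solution is the only one.\<close>

lemma pi_op_eqI:
  assumes "(var i - var (Suc i)) * g = var i * f - swap_vars i (var i * f)"
  shows "pi_op i f = g"
  unfolding pi_op_def divided_difference_def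
proof (rule the_equality)
  fix h assume "(var i - var (Suc i)) * h = var i * f - swap_vars i (var i * f)"
  then have "(var i - var (Suc i)) * h = (var i - var (Suc i)) * g" using assms by simp
  then show "h = g" using var_diff_nonzero by simp
qed (rule assms)

definition wmon :: "nat list \<Rightarrow> mpoly" where
  "wmon W = monomial (count_list W)"

lemma finite_count_list: "finite {x. count_list W x \<noteq> 0}"
  by (rule finite_subset[of _ "set W"]) (auto simp: count_list_0_iff)

section \<open>Strings and the operator \<open>pi_op\<close>\<close>

definition fword :: "nat \<Rightarrow> nat list \<Rightarrow> nat list" where
  "fword i V = (SOME W. arrow i V W)"

lemma arrow_fword: "phi i V \<noteq> 0 \<Longrightarrow> arrow i V (fword i V)"
  unfolding fword_def using arrow_from by (rule someI_ex)

lemma fword_eq: "arrow i V W \<Longrightarrow> fword i V = W"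
  unfolding fword_def using arrow_unique_target by blast

definition string :: "nat \<Rightarrow> nat list \<Rightarrow> nat \<Rightarrow> nat list" where
  "string i b j = (fword i ^^ j) b"

lemma string_0 [simp]: "string i b 0 = b" by (simp add: string_def)

lemma string_Suc: "string i b (Suc j) = fword i (string i b j)" by (simp add: string_def)

lemma string_eps_phi:
  assumes "eps i b = 0" "j \<le> phi i b"
  shows "eps i (string i b j) = j \<and> phi i (string i b j) = phi i b - j"
  using assms(2)
proof (induction j)
  case (Suc j)
  then have "arrow i (string i b j) (string i b (Suc j))" unfolding string_Suc by (intro arrow_fword) simp
  then show ?case using Suc arrow_eps arrow_phi by fastforce
qed (simp add: assms(1))

lemma string_arrow:
  assumes "eps i b = 0" "j < phi i b"
  shows "arrow i (string i b j) (string i b (Suc j))"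
  unfolding string_Suc using string_eps_phi[OF assms(1), of j] assms(2) by (intro arrow_fword) simp

lemma string_count:
  assumes "eps i b = 0" "j \<le> phi i b"
  shows "int (count_list (string i b j) x) = int (count_list b x) - int j * unit_wt i x + int j * unit_wt (Suc i) x"
  using assms(2)
proof (induction j)
  case (Suc j)
  then show ?case using arrow_count[OF string_arrow[OF assms(1), of j], of x] by (simp add: algebra_simps)
qed simp

text \<open>The coordinates of a word are the top of its string and \<open>eps\<close>, its distance
  from the top.\<close>

lemma string_bij:
  assumes ds: "dem_step t X Y"
  shows "bij_betw (\<lambda>(b, j). string t b j) (SIGMA b:{b \<in> Y. eps t b = 0}. {0..phi t b}) Y"
proof (rule bij_betwI')
  have a: "\<And>V W. arrow t V W \<Longrightarrow> V \<in> Y \<longleftrightarrow> W \<in> Y" using ds by (auto simp: dem_step_def)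
  let ?S = "SIGMA b:{b \<in> Y. eps t b = 0}. {0..phi t b}"
  have inj: "b = b'" if "eps t b = 0" "eps t b' = 0" "j \<le> phi t b" "j \<le> phi t b'" "string t b j = string t b' j" for b b' j
    using that(3-)
  proof (induction j)
    case (Suc j)
    have "string t b j = string t b' j"
      using string_arrow[OF that(1), of j] string_arrow[OF that(2), of j] Suc.prems by (metis Suc_le_eq arrow_unique_source)
    then show ?case using Suc by simp
  qed simp
  fix x y assume x: "x \<in> ?S" and y: "y \<in> ?S"
  obtain b j b' j' where xy: "x = (b, j)" "y = (b', j')" by fastforce
  show "(case x of (b, j) \<Rightarrow> string t b j) = (case y of (b, j) \<Rightarrow> string t b j) \<longleftrightarrow> x = y"
  proof
    assume eq: "(case x of (b, j) \<Rightarrow> string t b j) = (case y of (b, j) \<Rightarrow> string t b j)"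
    have e: "eps t b = 0" "eps t b' = 0" "j \<le> phi t b" "j' \<le> phi t b'" using x y xy by auto
    have s: "string t b j = string t b' j'" using eq xy by simp
    have "j = j'" using string_eps_phi[OF e(1,3)] string_eps_phi[OF e(2,4)] s by simp
    then show "x = y" using inj[OF e(1-3)] e s xy by simp
  qed simp
next
  have a: "\<And>V W. arrow t V W \<Longrightarrow> V \<in> Y \<longleftrightarrow> W \<in> Y" using ds by (auto simp: dem_step_def)
  let ?S = "SIGMA b:{b \<in> Y. eps t b = 0}. {0..phi t b}"
  {
    fix x assume "x \<in> ?S"
    then obtain b j where x: "x = (b, j)" "b \<in> Y" "eps t b = 0" "j \<le> phi t b" by auto
    from x(4) have "string t b j \<in> Y"
    proof (induction j)
      case (Suc j)
      then show ?case using a[OF string_arrow[OF x(3), of j]] by simp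
    qed (simp add: x)
    then show "(case x of (b, j) \<Rightarrow> string t b j) \<in> Y" using x by simp
  next
    fix W assume "W \<in> Y"
    then have "\<exists>b\<in>Y. eps t b = 0 \<and> eps t W \<le> phi t b \<and> W = string t b (eps t W)"
    proof (induction "eps t W" arbitrary: W)
      case 0
      then show ?case by (intro bexI[of _ W]) (auto simp: sym[OF 0(1)])
    next
      case (Suc e)
      then obtain V where V: "arrow t V W" using arrow_into[of t W] by auto
      have e: "e = eps t V" "V \<in> Y" using arrow_eps[OF V] Suc a[OF V] by auto
      then obtain b where b: "b \<in> Y" "eps t b = 0" "eps t V \<le> phi t b" "V = string t b (eps t V)" using Suc.hyps(1)[of V] by blast
      have "phi t V = phi t b - eps t V" using string_eps_phi[OF b(2,3)] b(4) by simp
      then have "eps t W \<le> phi t b" using arrow_phi[OF V] arrow_eps[OF V] by simp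
      moreover have "W = string t b (Suc (eps t V))" unfolding string_Suc using fword_eq[OF V] b(4) by simp
      ultimately show ?case using b arrow_eps[OF V] by auto
    qed
    then obtain b where "b \<in> Y" "eps t b = 0" "eps t W \<le> phi t b" "W = string t b (eps t W)" by blast
    then show "\<exists>x\<in>?S. W = (case x of (b, j) \<Rightarrow> string t b j)" by (intro bexI[of _ "(b, eps t W)"]) auto
  }
qed

text \<open>For \<open>j \<le> phi t b\<close> this is \<open>var t\<close> times the monomial at
  distance \<open>j\<close> below the top \<open>b\<close>; \<open>j = Suc (phi t b)\<close> adds
  \<open>var (Suc t)\<close> times the last one. Exchanging the variables reverses this range of
  indices, on which the subtraction does not truncate.\<close>

definition gmon :: "nat \<Rightarrow> nat list \<Rightarrow> nat \<Rightarrow> mpoly" where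
  "gmon t b j = monomial ((count_list b)(t := Suc (count_list b t) - j, Suc t := count_list b (Suc t) + j))"

lemma finite_support_upd: "finite {x. (f :: nat \<Rightarrow> nat) x \<noteq> 0} \<Longrightarrow> finite {x. (f(a := u, b := v)) x \<noteq> 0}"
  by (rule finite_subset[of _ "insert a (insert b {x. f x \<noteq> 0})"]) auto

lemma string_top_count:
  assumes "eps t b = 0"
  shows "count_list b t = count_list b (Suc t) + phi t b"
  using eps_phi[of t b] assms by (simp add: wexcess_def)

lemma wmon_string:
  assumes b: "eps t b = 0" "j \<le> phi t b"
  shows "wmon (string t b j) = monomial ((count_list b)(t := count_list b t - j, Suc t := count_list b (Suc t) + j))"
proof -
  have "count_list (string t b j) x = ((count_list b)(t := count_list b t - j, Suc t := count_list b (Suc t) + j)) x" for x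
    using string_count[OF b, of x] string_top_count[OF b(1)] b(2) by (auto simp: unit_wt_def)
  then show ?thesis unfolding wmon_def by (intro arg_cong[of _ _ monomial] ext)
qed

lemma var_string:
  assumes b: "eps t b = 0" "j \<le> phi t b"
  shows "var t * wmon (string t b j) = gmon t b j" "var (Suc t) * wmon (string t b j) = gmon t b (Suc j)"
proof -
  note fin = finite_support_upd[OF finite_count_list]
  have j: "j \<le> count_list b t" using string_top_count[OF b(1)] b(2) by simp
  show "var t * wmon (string t b j) = gmon t b j"
    unfolding wmon_string[OF b] gmon_def var_times_monomial[OF fin]
    using j by (intro arg_cong[of _ _ monomial] ext) (simp add: Suc_diff_le)
  show "var (Suc t) * wmon (string t b j) = gmon t b (Suc j)"
    unfolding wmon_string[OF b] gmon_def var_times_monomial[OF fin]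
    by (intro arg_cong[of _ _ monomial] ext) simp
qed

lemma swap_gmon:
  assumes b: "eps t b = 0" "j \<le> Suc (phi t b)"
  shows "swap_vars t (gmon t b j) = gmon t b (Suc (phi t b) - j)"
  unfolding gmon_def swap_vars_monomial[OF finite_support_upd[OF finite_count_list]]
  using b(2) string_top_count[OF b(1)]
  by (intro arg_cong[of _ _ monomial] ext) (simp add: transpose_def)

text \<open>String by string both sides equal the first \<open>gmon\<close> minus the last. On the
  side of \<open>Y\<close> this is a telescoping sum. On the side of \<open>X\<close> it is
  immediate if only the top is present; for a whole string the index reversal cancels the inner
  terms.\<close>

lemma pi_op_dem_step:
  assumes ds: "dem_step t X Y"
  shows "pi_op t (\<Sum>W\<in>X. wmon W) = (\<Sum>W\<in>Y. wmon W)"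
proof (rule pi_op_eqI)
  define B where "B = {b \<in> Y. eps t b = 0}"
  have fin: "finite Y" and XY: "X \<subseteq> Y" and a: "\<And>V W. arrow t V W \<Longrightarrow> V \<in> Y \<longleftrightarrow> W \<in> Y"
    and top: "\<And>W. W \<in> Y \<Longrightarrow> eps t W = 0 \<Longrightarrow> W \<in> X"
    and up: "\<And>V W. arrow t V W \<Longrightarrow> V \<in> X \<Longrightarrow> eps t V \<noteq> 0 \<Longrightarrow> W \<in> X"
    and down: "\<And>V W. arrow t V W \<Longrightarrow> W \<in> X \<Longrightarrow> V \<in> X"
    using ds by (auto simp: dem_step_def)
  have finB: "finite B" using fin by (simp add: B_def)
  have sumY: "(\<Sum>W\<in>Y. h W) = (\<Sum>b\<in>B. \<Sum>j = 0..phi t b. h (string t b j))" for h :: "nat list \<Rightarrow> mpoly"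
  proof -
    have "(\<Sum>W\<in>Y. h W) = (\<Sum>x\<in>(SIGMA b:B. {0..phi t b}). h (case x of (b, j) \<Rightarrow> string t b j))"
      using sum.reindex_bij_betw[OF string_bij[OF ds], of h] by (simp add: B_def)
    also have "\<dots> = (\<Sum>(b, j)\<in>(SIGMA b:B. {0..phi t b}). h (string t b j))"
      by (rule sum.cong) auto
    also have "\<dots> = (\<Sum>b\<in>B. \<Sum>j = 0..phi t b. h (string t b j))"
      using finB by (intro sum.Sigma[symmetric]) auto
    finally show ?thesis .
  qed
  let ?A = "\<lambda>b. \<Sum>j = 0..phi t b. if string t b j \<in> X then gmon t b j else 0"
  have "(\<Sum>W\<in>X. wmon W) = (\<Sum>W\<in>Y. if W \<in> X then wmon W else 0)"
    using fin XY by (simp add: sum.If_cases Int_absorb1)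
  then have "var t * (\<Sum>W\<in>X. wmon W) = (\<Sum>b\<in>B. \<Sum>j = 0..phi t b. var t * (if string t b j \<in> X then wmon (string t b j) else 0))"
    by (simp only: sumY sum_distrib_left)
  also have "\<dots> = (\<Sum>b\<in>B. ?A b)"
    by (intro sum.cong refl) (auto simp: B_def var_string(1))
  finally have lhs: "var t * (\<Sum>W\<in>X. wmon W) = (\<Sum>b\<in>B. ?A b)" .
  have tele: "(\<Sum>j = 0..p. f j) - (\<Sum>j = 0..p. f (Suc j)) = f 0 - f (Suc p)" for f :: "nat \<Rightarrow> mpoly" and p
    by (induction p) (simp_all add: algebra_simps)
  have Ab: "?A b - swap_vars t (?A b) = gmon t b 0 - gmon t b (Suc (phi t b))" if b: "b \<in> B" for b
  proof -
    let ?p = "phi t b"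
    have e: "eps t b = 0" "b \<in> Y" using b by (auto simp: B_def)
    show ?thesis
    proof (cases "\<forall>j\<in>{0..?p}. string t b j \<in> X")
      case True
      then have A: "?A b = (\<Sum>j = 0..?p. gmon t b j)" by (intro sum.cong) auto
      have "swap_vars t (?A b) = (\<Sum>j = 0..?p. gmon t b (Suc ?p - j))"
        unfolding A swap_vars_sum using swap_gmon[OF e(1)] by (intro sum.cong) auto
      also have "\<dots> = (\<Sum>j = 0..?p. gmon t b (Suc j))"
        by (rule sum.reindex_bij_witness[where i = "\<lambda>j. ?p - j" and j = "\<lambda>j. ?p - j"]) (auto simp: Suc_diff_le)
      finally show ?thesis using tele[of "gmon t b" ?p] A by simp
    next
      case False
      \<comment> \<open>One element of \<open>X\<close> below the top spreads to the top by
        \<open>down\<close> and to the bottom by \<open>up\<close>, so the whole string would lie in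
        \<open>X\<close>.\<close>
      have no: "string t b j \<notin> X" if "1 \<le> j" "j \<le> ?p" for j
      proof
        assume j: "string t b j \<in> X"
        have "string t b k \<in> X" if "k \<le> j" for k
          using that
        proof (induction rule: inc_induct)
          case (step k)
          then show ?case using down[OF string_arrow[OF e(1), of k]] \<open>j \<le> ?p\<close> by simp
        qed (rule j)
        moreover have "string t b k \<in> X" if "j \<le> k" "k \<le> ?p" for k
          using that
        proof (induction rule: dec_induct)
          case (step k)
          then show ?case
            using up[OF string_arrow[OF e(1), of k]] string_eps_phi[OF e(1), of k] \<open>1 \<le> j\<close> by simp
        qed (rule j)
        ultimately show False using False linear by (metis atLeastAtMost_iff)
      qed
      have "?A b = (if string t b 0 \<in> X then gmon t b 0 else 0) +
          (\<Sum>j = Suc 0..?p. if string t b j \<in> X then gmon t b j else 0)"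
        by (rule sum.atLeast_Suc_atMost) simp
      also have "(\<Sum>j = Suc 0..?p. if string t b j \<in> X then gmon t b j else 0) = 0"
        using no by (intro sum.neutral) auto
      finally have "?A b = gmon t b 0" using top[OF e(2,1)] by simp
      then show ?thesis using swap_gmon[OF e(1), of 0] by simp
    qed
  qed
  have "(var t - var (Suc t)) * (\<Sum>W\<in>Y. wmon W) =
      (\<Sum>b\<in>B. \<Sum>j = 0..phi t b. (var t - var (Suc t)) * wmon (string t b j))"
    by (simp only: sumY sum_distrib_left)
  also have "\<dots> = (\<Sum>b\<in>B. \<Sum>j = 0..phi t b. gmon t b j - gmon t b (Suc j))"
    by (intro sum.cong refl) (simp add: B_def left_diff_distrib var_string)
  also have "\<dots> = (\<Sum>b\<in>B. gmon t b 0 - gmon t b (Suc (phi t b)))"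
    unfolding sum_subtractf[where A = "{0.._}"] tele ..
  also have "\<dots> = (\<Sum>b\<in>B. ?A b - swap_vars t (?A b))" using Ab by (intro sum.cong) auto
  also have "\<dots> = (\<Sum>b\<in>B. ?A b) - swap_vars t (\<Sum>b\<in>B. ?A b)" unfolding swap_vars_sum sum_subtractf ..
  finally show "(var t - var (Suc t)) * (\<Sum>W\<in>Y. wmon W) = var t * (\<Sum>W\<in>X. wmon W) - swap_vars t (var t * (\<Sum>W\<in>X. wmon W))"
    unfolding lhs .
qed

lemma flagged_key_poly_words:
  assumes wc: "weak_composition \<alpha>" and m: "\<And>r. \<alpha> r \<le> m"
  shows "flagged_key_poly \<alpha> \<phi> = (\<Sum>W\<in>tword m ` SSKT \<alpha> \<phi>. wmon W)"
proof -
  have "flagged_key_poly \<alpha> \<phi> = (\<Sum>T\<in>SSKT \<alpha> \<phi>. wmon (tword m T))"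
    unfolding flagged_key_poly_def wmon_def
    by (intro sum.cong refl) (simp add: SSKT_iff[OF wc] tableau_wt_tword[OF wc _ m])
  then show ?thesis by (simp add: sum.reindex[OF inj_on_tword[OF wc m]])
qed

lemma laurent_of_superset:
  assumes "finite S" "Poly_Mapping.keys p \<subseteq> S"
  shows "laurent_of p = (\<Sum>m\<in>S. Poly_Mapping.single (Poly_Mapping.map int m) (Poly_Mapping.lookup p m))"
  unfolding laurent_of_def using assms by (intro sum.mono_neutral_left) (auto simp: in_keys_iff)

lemma laurent_of_add: "laurent_of (p + q) = laurent_of p + laurent_of q"
proof -
  let ?S = "Poly_Mapping.keys p \<union> Poly_Mapping.keys q"
  have "Poly_Mapping.keys (p + q) \<subseteq> ?S" by (rule keys_add)
  then show ?thesis
    using laurent_of_superset[of ?S p] laurent_of_superset[of ?S q] laurent_of_superset[of ?S "p + q"]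
    by (simp add: lookup_add single_add sum.distrib)
qed

lemma laurent_of_sum: "laurent_of (sum f A) = (\<Sum>x\<in>A. laurent_of (f x))"
proof -
  have "laurent_of 0 = 0" by (simp add: laurent_of_def)
  then show ?thesis by (induction A rule: infinite_finite_induct) (simp_all add: laurent_of_add)
qed

lemma laurent_of_monomial:
  assumes "finite {x. (\<beta> :: nat \<Rightarrow> nat) x \<noteq> 0}"
  shows "laurent_of (monomial \<beta>) = monomial (\<lambda>j. int (\<beta> j))"
proof -
  have fin: "finite {x. int (\<beta> x) \<noteq> 0}" using assms by simp
  have "laurent_of (monomial \<beta>) = Poly_Mapping.single (Poly_Mapping.map int (Abs_poly_mapping \<beta>)) 1"
    by (simp add: laurent_of_def monomial_def)
  also have "Poly_Mapping.map int (Abs_poly_mapping \<beta>) = Abs_poly_mapping (\<lambda>j. int (\<beta> j))"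
    by (rule poly_mapping_eqI) (simp only: Poly_Mapping.map.rep_eq lookup_Abs[OF assms] lookup_Abs[OF fin], simp add: when_def)
  finally show ?thesis by (simp add: monomial_def)
qed

lemma character_SSKT_crystal:
  assumes wc: "weak_composition \<alpha>"
  shows "character (SSKT_crystal \<alpha> \<phi>) = laurent_of (flagged_key_poly \<alpha> \<phi>)"
proof -
  obtain m where m: "\<And>r. \<alpha> r \<le> m" by (rule weak_composition_bound[OF wc]) blast
  have "finite {x. tableau_wt T x \<noteq> 0}" if "T \<in> SSKT \<alpha> \<phi>" for T
    using that SSKT_iff[OF wc] tableau_wt_tword[OF wc _ m] finite_count_list by metis
  then show ?thesis
    unfolding character_def flagged_key_poly_def SSKT_crystal_def
    by (simp add: laurent_of_sum laurent_of_monomial)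
qed

section \<open>Sorting words\<close>

text \<open>The pairs that are out of order for a partition. Equal parts do not count, so
  \<open>ninv\<close> is the least length of a sorting word.\<close>

definition inversions :: "(nat \<Rightarrow> nat) \<Rightarrow> (nat \<times> nat) set" where
  "inversions \<beta> = {(a, b). 1 \<le> a \<and> a < b \<and> \<beta> a < \<beta> b}"

definition ninv :: "(nat \<Rightarrow> nat) \<Rightarrow> nat" where
  "ninv \<beta> = card (inversions \<beta>)"

lemma finite_inversions:
  assumes "weak_composition \<beta>"
  shows "finite (inversions \<beta>)"
proof -
  have "inversions \<beta> \<subseteq> (\<Union>b\<in>{b. \<beta> b \<noteq> 0}. {..<b} \<times> {b})" by (auto simp: inversions_def)
  moreover have "finite (\<Union>b\<in>{b. \<beta> b \<noteq> 0}. {..<b} \<times> {b})" using assms by (auto simp: weak_composition_def)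
  ultimately show ?thesis by (rule finite_subset)
qed

text \<open>Applying the transposition to both coordinates matches the inversions other than the
  pair \<open>(t, Suc t)\<close>.\<close>

lemma ninv_transpose:
  assumes wc: "weak_composition \<beta>" and t: "1 \<le> t"
  shows "ninv (\<beta> \<circ> transpose t (Suc t)) + of_bool (\<beta> t < \<beta> (Suc t)) = ninv \<beta> + of_bool (\<beta> (Suc t) < \<beta> t)"
proof -
  let ?s = "transpose t (Suc t)" and ?\<gamma> = "\<beta> \<circ> transpose t (Suc t)"
  let ?f = "map_prod ?s ?s"
  have sub: "?f ` (inversions \<gamma> - {(t, Suc t)}) \<subseteq> inversions (\<gamma> \<circ> ?s) - {(t, Suc t)}" for \<gamma>
  proof (rule image_subsetI)
    fix x assume x: "x \<in> inversions \<gamma> - {(t, Suc t)}"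
    obtain a b where ab: "x = (a, b)" by fastforce
    have *: "1 \<le> a" "a < b" "\<gamma> a < \<gamma> b" "(a, b) \<noteq> (t, Suc t)" using x ab by (auto simp: inversions_def)
    then have "1 \<le> ?s a" "?s a < ?s b" using t by (auto simp: transpose_def)
    moreover have "(?s a, ?s b) \<noteq> (t, Suc t)" using * by (auto simp: transpose_def split: if_splits)
    ultimately show "?f x \<in> inversions (\<gamma> \<circ> ?s) - {(t, Suc t)}" using * ab by (simp add: inversions_def)
  qed
  have inv: "?\<gamma> \<circ> ?s = \<beta>" by (simp add: comp_assoc)
  have "bij_betw ?f (inversions \<beta> - {(t, Suc t)}) (inversions ?\<gamma> - {(t, Suc t)})"
    using sub[of \<beta>] sub[of ?\<gamma>] unfolding inv by (intro bij_betw_byWitness[where f' = ?f]) (auto simp: map_prod_def)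
  then have eq: "card (inversions \<beta> - {(t, Suc t)}) = card (inversions ?\<gamma> - {(t, Suc t)})" by (rule bij_betw_same_card)
  have "ninv \<gamma> = card (inversions \<gamma> - {(t, Suc t)}) + of_bool (\<gamma> t < \<gamma> (Suc t))" if "weak_composition \<gamma>" for \<gamma>
  proof (cases "\<gamma> t < \<gamma> (Suc t)")
    case True
    then have "(t, Suc t) \<in> inversions \<gamma>" using t by (simp add: inversions_def)
    then show ?thesis using card.remove[OF finite_inversions[OF that]] True by (simp add: ninv_def)
  next
    case False
    then have "(t, Suc t) \<notin> inversions \<gamma>" by (simp add: inversions_def)
    then show ?thesis using False by (simp add: ninv_def)
  qed
  from this[OF wc] this[OF weak_composition_transpose[OF wc t]] eq show ?thesis by simp
qed

lemma ninv_partition: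
  assumes "is_partition \<mu>"
  shows "ninv \<mu> = 0"
proof -
  have dec: "\<And>i. 1 \<le> i \<Longrightarrow> \<mu> (Suc i) \<le> \<mu> i" using assms by (auto simp: is_partition_def)
  have mono: "\<mu> b \<le> \<mu> a" if "a \<le> b" "1 \<le> a" for a b
    using that
  proof (induction rule: dec_induct)
    case (step b)
    then show ?case using dec[of b] by simp
  qed simp
  have "inversions \<mu> = {}"
  proof (rule ccontr)
    assume "inversions \<mu> \<noteq> {}"
    then obtain a b where "1 \<le> a" "a < b" "\<mu> a < \<mu> b" by (auto simp: inversions_def)
    then show False using mono[of a b] by simp
  qed
  then show ?thesis by (simp add: ninv_def)
qed

lemma ninv_le_length:
  assumes "weak_composition \<beta>" "\<forall>i\<in>set js. 1 \<le> i" "is_partition (\<beta> \<circ> word_perm js)"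
  shows "ninv \<beta> \<le> length js"
  using assms
proof (induction js arbitrary: \<beta>)
  case Nil
  then show ?case using ninv_partition by simp
next
  case (Cons t js)
  have "ninv (\<beta> \<circ> transpose t (Suc t)) \<le> length js"
    using Cons.prems by (intro Cons.IH weak_composition_transpose) (auto simp: comp_assoc)
  moreover have "ninv \<beta> \<le> Suc (ninv (\<beta> \<circ> transpose t (Suc t)))"
    using ninv_transpose[of \<beta> t] Cons.prems by (auto simp: of_bool_def split: if_splits)
  ultimately show ?case by simp
qed

text \<open>Bubble sort: each exchange of an adjacent ascent removes one inversion. The larger part
  of an ascent is nonzero, hence at a position up to \<open>n\<close>, and the letters stay below
  \<open>n\<close>.\<close>

lemma sorting_word_exists:
  assumes "weak_composition \<beta>" "\<forall>r>n. \<beta> r = 0"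
  shows "\<exists>js. set js \<subseteq> {1..<n} \<and> is_partition (\<beta> \<circ> word_perm js) \<and> length js = ninv \<beta>"
  using assms
proof (induction "ninv \<beta>" arbitrary: \<beta>)
  case 0
  have "is_partition \<beta>"
    unfolding is_partition_def
  proof (intro conjI allI impI)
    fix i :: nat assume i: "1 \<le> i"
    have "inversions \<beta> = {}" using 0(1) finite_inversions[OF 0(2)] by (simp add: ninv_def)
    then have "(i, Suc i) \<notin> inversions \<beta>" by simp
    then show "\<beta> (Suc i) \<le> \<beta> i" using i by (simp add: inversions_def not_less)
  qed (rule 0)
  then show ?case using 0 by (intro exI[of _ "[]"]) simp
next
  case (Suc e)
  have "\<exists>t\<ge>1. \<beta> t < \<beta> (Suc t)"
  proof (rule ccontr)
    assume "\<not> ?thesis"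
    then have "is_partition \<beta>" using Suc.prems(1) by (auto simp: is_partition_def not_less)
    then show False using ninv_partition Suc.hyps(2) by simp
  qed
  then obtain t where t: "1 \<le> t" "\<beta> t < \<beta> (Suc t)" by blast
  have tn: "t < n" using t Suc.prems(2)[rule_format, of "Suc t"] by (cases "Suc t > n") auto
  let ?\<gamma> = "\<beta> \<circ> transpose t (Suc t)"
  have e: "e = ninv ?\<gamma>" using ninv_transpose[OF Suc.prems(1) t(1)] t(2) Suc.hyps(2) by simp
  have "\<forall>r>n. ?\<gamma> r = 0" using Suc.prems(2) tn by (auto simp: transpose_def)
  then obtain js where js: "set js \<subseteq> {1..<n}" "is_partition (?\<gamma> \<circ> word_perm js)" "length js = ninv ?\<gamma>"
    using Suc.hyps(1)[OF e weak_composition_transpose[OF Suc.prems(1) t(1)]] by blast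
  then show ?case using t tn e Suc.hyps(2) by (intro exI[of _ "t # js"]) (auto simp: comp_assoc)
qed

section \<open>Key polynomials\<close>

lemma word_perm_S_infinity:
  assumes "\<forall>i\<in>set js. 1 \<le> i"
  shows "word_perm js \<in> S_infinity"
proof -
  let ?K = "Suc (Max (insert 0 (set js)))"
  have p: "word_perm js permutes {1..?K}"
    using assms by (intro word_perm_permutes) (auto simp: Max_ge le_SucI)
  then have "word_perm js permutes {1..}" by (rule permutes_subset) auto
  moreover have "{i. word_perm js i \<noteq> i} \<subseteq> {1..?K}" using p by (auto simp: permutes_def)
  then have "finite {i. word_perm js i \<noteq> i}" by (rule finite_subset) simp
  ultimately show ?thesis by (simp add: S_infinity_def)
qed

lemma transposition_word:
  fixes a :: nat
  assumes "1 \<le> a"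
  shows "\<exists>js. word_for (transpose a (a + Suc d)) js"
proof (induction d)
  case 0
  have "word_for (transpose a (a + Suc 0)) [a]" using assms by (simp add: word_for_def)
  then show ?case by blast
next
  case (Suc d)
  then obtain js where js: "word_for (transpose a (a + Suc d)) js" by blast
  let ?b = "a + Suc d"
  \<comment> \<open>Conjugation by the adjacent transposition at \<open>?b\<close> moves one end of
    the exchange a step further.\<close>
  have "transpose a (Suc ?b) = transpose ?b (Suc ?b) \<circ> transpose a ?b \<circ> transpose ?b (Suc ?b)"
    by (auto simp: fun_eq_iff transpose_def)
  then have "word_for (transpose a (a + Suc (Suc d))) (?b # js @ [?b])"
    using js assms by (auto simp: word_for_def word_perm_append comp_assoc)
  then show ?case by blast
qed

text \<open>This makes \<open>perm_length\<close> a genuine minimum for every competitor in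
  \<open>minimal_sorting\<close>.\<close>

lemma S_infinity_word:
  assumes "w \<in> S_infinity"
  shows "\<exists>js. word_for w js"
proof -
  have p: "w permutes {1..}" and fin: "finite {i. w i \<noteq> i}" using assms by (auto simp: S_infinity_def)
  have perm: "w permutes {i. w i \<noteq> i}"
    using p unfolding permutes_def by (metis (mono_tags, lifting) mem_Collect_eq)
  have pos: "1 \<le> i" if "w i \<noteq> i" for i using p that unfolding permutes_def by force
  obtain S where S: "w permutes S" "finite S" "\<And>i. i \<in> S \<Longrightarrow> 1 \<le> i"
    using perm fin pos by blast
  from S(1,2) show ?thesis
  proof (induction rule: permutes_induct)
    case id
    show ?case by (rule exI[of _ "[]"]) (simp add: word_for_def id_def)
  next
    case (swap a b p)
    then obtain js where js: "word_for p js" by blast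
    have ab: "1 \<le> a" "1 \<le> b" using S(3) swap.hyps(1,2) by simp_all
    have "\<exists>is. word_for (transpose a b) is"
    proof (cases "a < b")
      case True
      then show ?thesis using transposition_word[OF ab(1), of "b - Suc a"] by simp
    next
      case False
      then have "b < a" using swap by simp
      then show ?thesis using transposition_word[OF ab(2), of "a - Suc b"] by (simp add: transpose_commute)
    qed
    then obtain ks where "word_for (transpose a b) ks" by blast
    then have "word_for (transpose a b \<circ> p) (ks @ js)" using js by (auto simp: word_for_def word_perm_append)
    then show ?case by blast
  qed
qed

lemma reduced_word_exists:
  assumes "word_for w js"
  shows "\<exists>ks. reduced_word w ks" "perm_length w \<le> length js"
proof -
  have "\<exists>m ks. word_for w ks \<and> length ks = m" using assms by blast
  then have "\<exists>ks. word_for w ks \<and> length ks = perm_length w" unfolding perm_length_def by (rule LeastI_ex)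
  then show "\<exists>ks. reduced_word w ks" by (auto simp: reduced_word_def)
  show "perm_length w \<le> length js" unfolding perm_length_def using assms by (intro Least_le) blast
qed

lemma perm_length_ge_ninv:
  assumes wc: "weak_composition \<beta>" and w: "word_for w js" and p: "is_partition (\<beta> \<circ> w)"
  shows "ninv \<beta> \<le> perm_length w"
proof -
  obtain ks where "reduced_word w ks" using reduced_word_exists(1)[OF w] by blast
  then show ?thesis using ninv_le_length[OF wc, of ks] p by (auto simp: reduced_word_def word_for_def)
qed

lemma weak_composition_above:
  assumes "weak_composition \<beta>"
  obtains n where "\<forall>r>n. \<beta> r = 0"
proof -
  have "finite {r. \<beta> r \<noteq> 0}" using assms by (simp add: weak_composition_def)
  then have "r \<le> Max (insert 0 {r. \<beta> r \<noteq> 0})" if "\<beta> r \<noteq> 0" for r using that by (intro Max_ge) auto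
  then show ?thesis using that not_le by blast
qed

lemma tableau_wt_yamanouchi:
  assumes "is_partition \<mu>"
  shows "tableau_wt (yamanouchi \<mu>) = \<mu>"
proof -
  have wc: "weak_composition \<mu>" using assms by (simp add: is_partition_def)
  obtain m where m: "\<And>r. \<mu> r \<le> m" by (rule weak_composition_bound[OF wc]) blast
  have kt: "KT \<mu> (yamanouchi \<mu>)" using SSKT_partition[OF assms] SSKT_iff[OF wc] by blast
  have 0: "\<mu> 0 = 0" using wc by (simp add: weak_composition_def)
  have "{c \<in> {1..m}. x \<in> colset (yamanouchi \<mu>) c} = {1..\<mu> x}" for x
    using m[of x] 0 by (cases "x = 0") (auto simp: in_colset yamanouchi_def)
  then show ?thesis
    unfolding tableau_wt_tword[OF wc kt m] tword_def
    using count_list_colword[of "colset (yamanouchi \<mu>)", OF finite_colset[OF wc kt]] by (auto simp: fun_eq_iff)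
qed

lemma pi_op_flagged:
  assumes wc: "weak_composition \<alpha>" and t: "1 \<le> t"
    and \<phi>: "\<phi> j = t" "\<And>r. 1 \<le> r \<Longrightarrow> r < j \<Longrightarrow> \<phi> r < t" "\<And>r. j < r \<Longrightarrow> t < \<phi> r"
  shows "pi_op t (flagged_key_poly \<alpha> \<phi>) = flagged_key_poly \<alpha> (\<phi>(j := Suc t))"
proof -
  obtain m where m: "\<And>r. \<alpha> r \<le> m" by (rule weak_composition_bound[OF wc]) blast
  have "dem_step t (tword m ` SSKT \<alpha> \<phi>) (tword m ` SSKT \<alpha> (\<phi>(j := Suc t)))"
    by (rule SSKT_dem_step[OF wc _ t]) (use m \<phi> in blast)+
  then show ?thesis unfolding flagged_key_poly_words[OF wc m] by (rule pi_op_dem_step)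
qed

text \<open>All minimal sorting words are covered because \<open>key_poly\<close> picks the
  permutation and its reduced word by choice. Minimality forces every letter to act at an ascent, so
  undoing it is an exchange as in \<open>SSKT_swap_words\<close>.\<close>

lemma pi_word_key:
  assumes "weak_composition \<alpha>" "\<forall>i\<in>set js. 1 \<le> i" "is_partition (\<alpha> \<circ> word_perm js)" "length js = ninv \<alpha>"
  shows "pi_word js (monomial (\<alpha> \<circ> word_perm js)) = flagged_key_poly \<alpha> (\<lambda>r. r)"
  using assms
proof (induction js arbitrary: \<alpha>)
  case Nil
  then show ?case by (simp add: pi_word_def flagged_key_poly_def SSKT_partition tableau_wt_yamanouchi)
next
  case (Cons t js)
  let ?\<beta> = "\<alpha> \<circ> transpose t (Suc t)"
  have t: "1 \<le> t" using Cons.prems by simp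
  have wc: "weak_composition ?\<beta>" by (rule weak_composition_transpose[OF Cons.prems(1) t])
  have eq: "\<alpha> \<circ> word_perm (t # js) = ?\<beta> \<circ> word_perm js" by (simp only: word_perm_Cons comp_assoc)
  have p: "is_partition (?\<beta> \<circ> word_perm js)" using Cons.prems(3) unfolding eq .
  have "ninv ?\<beta> \<le> length js" using Cons.prems p by (intro ninv_le_length wc) auto
  then have lt: "\<alpha> t < \<alpha> (Suc t)" and len: "length js = ninv ?\<beta>"
    using ninv_transpose[OF Cons.prems(1) t] Cons.prems(4) by (auto simp: of_bool_def split: if_splits)
  have IH: "pi_word js (monomial (?\<beta> \<circ> word_perm js)) = flagged_key_poly ?\<beta> (\<lambda>r. r)"
    by (rule Cons.IH[OF wc _ p len]) (use Cons.prems(2) in simp)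
  obtain m where m: "\<And>r. \<alpha> r \<le> m" by (rule weak_composition_bound[OF Cons.prems(1)]) blast
  have m': "?\<beta> r \<le> m" for r using m by simp
  have inv: "?\<beta> \<circ> transpose t (Suc t) = \<alpha>" by (simp add: comp_assoc)
  have "pi_word (t # js) f = pi_op t (pi_word js f)" for f by (simp add: pi_word_def)
  then have "pi_word (t # js) (monomial (\<alpha> \<circ> word_perm (t # js))) = pi_op t (flagged_key_poly ?\<beta> (\<lambda>r. r))"
    unfolding eq IH[symmetric] .
  also have "\<dots> = flagged_key_poly ?\<beta> ((\<lambda>r. r)(t := Suc t))"
    by (rule pi_op_flagged[OF wc t]) auto
  also have "\<dots> = flagged_key_poly \<alpha> (\<lambda>r. r)"
    unfolding flagged_key_poly_words[OF wc m'] flagged_key_poly_words[OF Cons.prems(1) m]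
    using SSKT_swap_words[OF wc t, of m] lt unfolding inv by (simp add: transpose_def)
  finally show ?case .
qed

text \<open>Whatever permutation is chosen, its length is \<open>ninv \<alpha>\<close>: bubble sort
  gives the upper bound, and every sorting permutation has at least this length.\<close>

lemma key_poly_eq:
  assumes wc: "weak_composition \<alpha>"
  shows "key_poly \<alpha> = flagged_key_poly \<alpha> (\<lambda>r. r)"
proof -
  obtain n where n: "\<forall>r>n. \<alpha> r = 0" by (rule weak_composition_above[OF wc])
  obtain is0 where is0: "set is0 \<subseteq> {1..<n}" "is_partition (\<alpha> \<circ> word_perm is0)" "length is0 = ninv \<alpha>"
    using sorting_word_exists[OF wc n] by blast
  let ?w0 = "word_perm is0"
  have w0: "?w0 \<in> S_infinity" "word_for ?w0 is0" using is0(1) by (auto simp: word_for_def intro!: word_perm_S_infinity)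
  have len0: "perm_length ?w0 \<le> ninv \<alpha>" using reduced_word_exists(2)[OF w0(2)] is0(3) by simp
  have ge: "ninv \<alpha> \<le> perm_length v" if "v \<in> S_infinity" "is_partition (\<alpha> \<circ> v)" for v
    using S_infinity_word[OF that(1)] perm_length_ge_ninv[OF wc _ that(2)] by blast
  have "minimal_sorting \<alpha> ?w0"
    unfolding minimal_sorting_def using w0 is0 ge len0 le_trans by blast
  then have "\<exists>w. minimal_sorting \<alpha> w" by blast
  then have min: "minimal_sorting \<alpha> (SOME w. minimal_sorting \<alpha> w)" by (rule someI_ex)
  define w where "w = (SOME w. minimal_sorting \<alpha> w)"
  have w: "w \<in> S_infinity" "is_partition (\<alpha> \<circ> w)" "perm_length w \<le> perm_length ?w0"
    using min w0(1) is0(2) unfolding w_def minimal_sorting_def by blast+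
  define js where "js = (SOME js. reduced_word w js)"
  have "\<exists>js. reduced_word w js" using S_infinity_word[OF w(1)] reduced_word_exists(1) by blast
  then have js: "reduced_word w js" unfolding js_def by (rule someI_ex)
  have wjs: "word_perm js = w" "\<forall>i\<in>set js. 1 \<le> i" using js by (auto simp: reduced_word_def word_for_def)
  have "length js = ninv \<alpha>" using js w(3) len0 ge[OF w(1,2)] by (simp add: reduced_word_def)
  then have "pi_word js (monomial (\<alpha> \<circ> word_perm js)) = flagged_key_poly \<alpha> (\<lambda>r. r)"
    using wjs w(2) by (intro pi_word_key[OF wc]) auto
  then show ?thesis unfolding key_poly_def pi_perm_def Let_def w_def[symmetric] js_def[symmetric] wjs(1) .
qed

lemma SSKT_cong:
  assumes wc: "weak_composition \<alpha>" and "\<And>r. \<alpha> r \<noteq> 0 \<Longrightarrow> \<phi> r = \<psi> r"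
  shows "SSKT \<alpha> \<phi> = SSKT \<alpha> \<psi>"
proof -
  have "T r 1 \<le> \<phi> r \<longleftrightarrow> T r 1 \<le> \<psi> r" if "KT \<alpha> T" for T r
    using assms(2)[of r] KT_box[OF that, of r 1] by (cases "T r 1 = 0") auto
  then show ?thesis using SSKT_iff[OF wc] by blast
qed

text \<open>An intermediate stage: rows above \<open>j\<close> have reached their final bounds, row
  \<open>j\<close> has reached \<open>u\<close>, and the rows below still carry the identity
  flag.\<close>

definition low_flag :: "(nat \<Rightarrow> nat) \<Rightarrow> nat \<Rightarrow> nat \<Rightarrow> nat \<Rightarrow> nat" where
  "low_flag \<phi> j u r = (if r < j then r else if r = j then u else \<phi> r)"

lemma low_flag_start: "low_flag \<phi> j j = low_flag \<phi> (Suc j) (\<phi> (Suc j))"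
  by (auto simp: fun_eq_iff low_flag_def)

lemma low_flag_upd: "(low_flag \<phi> j u)(j := v) = low_flag \<phi> j v"
  by (auto simp: fun_eq_iff low_flag_def)

lemma low_flag_step:
  assumes fl: "is_flag \<phi>" and j: "1 \<le> j" and u: "j \<le> u" "u < \<phi> j"
  shows "low_flag \<phi> j u j = u" "\<And>r. 1 \<le> r \<Longrightarrow> r < j \<Longrightarrow> low_flag \<phi> j u r < u" "\<And>r. j < r \<Longrightarrow> u < low_flag \<phi> j u r"
proof -
  show "u < low_flag \<phi> j u r" if "j < r" for r
  proof -
    have "\<phi> j \<le> \<phi> r" using fl j that by (simp add: is_flag_def)
    then show ?thesis using u that by (simp add: low_flag_def)
  qed
qed (use u in \<open>auto simp: low_flag_def\<close>)

text \<open>The bounds of the rows are raised from the top row downwards, so that every single increase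
  is one to which \<open>SSKT_dem_step\<close> applies.\<close>

lemma low_flag_chain:
  assumes fl: "is_flag \<phi>" and base: "P (low_flag \<phi> (Suc k) (\<phi> (Suc k)))"
    and step: "\<And>j u. 1 \<le> j \<Longrightarrow> j \<le> k \<Longrightarrow> j \<le> u \<Longrightarrow> u < \<phi> j \<Longrightarrow> P (low_flag \<phi> j u) \<Longrightarrow> P (low_flag \<phi> j (Suc u))"
  shows "P (low_flag \<phi> 1 (\<phi> 1))"
proof -
  have "P (low_flag \<phi> i (\<phi> i))" if "i \<le> Suc k" "1 \<le> i" for i
    using that
  proof (induction rule: inc_induct)
    case base
    show ?case by (rule assms(2))
  next
    case (step i)
    have "P (low_flag \<phi> i u)" if "i \<le> u" "u \<le> \<phi> i" for u
      using that
    proof (induction rule: dec_induct)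
      case base
      then show ?case using step low_flag_start[of \<phi> i] by simp
    next
      case (step v)
      then show ?case using assms(3)[of i v] \<open>1 \<le> i\<close> \<open>i < Suc k\<close> by simp
    qed
    moreover have "i \<le> \<phi> i" using fl step by (simp add: is_flag_def)
    ultimately show ?case by simp
  qed
  then show ?thesis by simp
qed

lemma low_flag_ends:
  assumes wc: "weak_composition \<alpha>" and k: "comp_length \<alpha> = k"
  shows "SSKT \<alpha> (low_flag \<phi> (Suc k) (\<phi> (Suc k))) = SSKT \<alpha> (\<lambda>r. r)" "SSKT \<alpha> (low_flag \<phi> 1 (\<phi> 1)) = SSKT \<alpha> \<phi>"
    "\<alpha> r \<noteq> 0 \<Longrightarrow> 1 \<le> r \<and> r \<le> k"
proof -
  obtain n where n: "\<forall>r>n. \<alpha> r = 0" by (rule weak_composition_above[OF wc])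
  then have "\<forall>r>k. \<alpha> r = 0" unfolding k[symmetric] comp_length_def by (rule LeastI)
  then have above: "\<alpha> r = 0" if "k < r" for r using that by blast
  have supp: "1 \<le> r \<and> r \<le> k" if "\<alpha> r \<noteq> 0" for r
    using that wc above[of r] by (cases "r = 0"; cases "k < r") (simp_all add: weak_composition_def)
  then show "\<alpha> r \<noteq> 0 \<Longrightarrow> 1 \<le> r \<and> r \<le> k" .
  show "SSKT \<alpha> (low_flag \<phi> (Suc k) (\<phi> (Suc k))) = SSKT \<alpha> (\<lambda>r. r)"
    using supp by (intro SSKT_cong[OF wc]) (auto simp: low_flag_def le_imp_less_Suc)
  show "SSKT \<alpha> (low_flag \<phi> 1 (\<phi> 1)) = SSKT \<alpha> \<phi>"
    using supp by (intro SSKT_cong[OF wc]) (auto simp: low_flag_def)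
qed

text \<open>In \<open>pi_down\<close> the index \<open>j\<close> acts first; each successive
  operator raises the bound of row \<open>j\<close> by one.\<close>

lemma pi_down_flagged:
  assumes wc: "weak_composition \<alpha>" and fl: "is_flag \<phi>" and j: "1 \<le> j"
  shows "pi_down (\<phi> j) j (flagged_key_poly \<alpha> (low_flag \<phi> (Suc j) (\<phi> (Suc j)))) = flagged_key_poly \<alpha> (low_flag \<phi> j (\<phi> j))"
proof -
  have "pi_down u j (flagged_key_poly \<alpha> (low_flag \<phi> j j)) = flagged_key_poly \<alpha> (low_flag \<phi> j u)"
    if "j \<le> u" "u \<le> \<phi> j" for u
    using that
  proof (induction rule: dec_induct)
    case base
    then show ?case by (simp add: pi_down_def pi_word_def)
  next
    case (step u)
    have "pi_down (Suc u) j f = pi_op u (pi_down u j f)" for f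
      using step(1) by (simp add: pi_down_def pi_word_def)
    then have "pi_down (Suc u) j (flagged_key_poly \<alpha> (low_flag \<phi> j j)) =
        pi_op u (flagged_key_poly \<alpha> (low_flag \<phi> j u))" using step by simp
    also have "\<dots> = flagged_key_poly \<alpha> ((low_flag \<phi> j u)(j := Suc u))"
      using step j by (intro pi_op_flagged[OF wc] low_flag_step[OF fl j]) auto
    finally show ?case by (simp only: low_flag_upd)
  qed
  moreover have "j \<le> \<phi> j" using fl j by (simp add: is_flag_def)
  ultimately show ?thesis by (simp add: low_flag_start)
qed

lemma flagged_key_poly_formula:
  assumes wc: "weak_composition \<alpha>" and k: "comp_length \<alpha> = k" and fl: "is_flag \<phi>"
  shows "flagged_key_poly \<alpha> \<phi> = foldr (\<lambda>j. pi_down (\<phi> j) j) [1..<Suc k] (key_poly \<alpha>)"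
proof -
  have "foldr (\<lambda>j. pi_down (\<phi> j) j) [i..<Suc k] (flagged_key_poly \<alpha> (low_flag \<phi> (Suc k) (\<phi> (Suc k)))) =
      flagged_key_poly \<alpha> (low_flag \<phi> i (\<phi> i))"
    if "i \<le> Suc k" "1 \<le> i" for i
    using that
  proof (induction rule: inc_induct)
    case (step i)
    then show ?case using pi_down_flagged[OF wc fl, of i] by (simp add: upt_conv_Cons del: upt_Suc)
  qed simp
  from this[of 1] have "foldr (\<lambda>j. pi_down (\<phi> j) j) [1..<Suc k] (flagged_key_poly \<alpha> (low_flag \<phi> (Suc k) (\<phi> (Suc k)))) =
    flagged_key_poly \<alpha> (low_flag \<phi> 1 (\<phi> 1))" by simp
  then show ?thesis
    unfolding key_poly_eq[OF wc] flagged_key_poly_def low_flag_ends(1,2)[OF wc k] by (rule sym)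
qed

section \<open>The Demazure crystal\<close>

text \<open>The invariant of the induction. The word \<open>js\<close> both sorts
  \<open>\<beta>\<close> to \<open>\<mu>\<close> and lists the Demazure operators; its length
  \<open>ninv \<beta>\<close> is what later makes it reduced.\<close>

definition demazure_words :: "nat \<Rightarrow> nat \<Rightarrow> (nat \<Rightarrow> nat) \<Rightarrow> nat list set \<Rightarrow> bool" where
  "demazure_words n m \<mu> S \<longleftrightarrow> (\<exists>\<beta> js. weak_composition \<beta> \<and> (\<forall>r>n. \<beta> r = 0) \<and> (\<forall>r. \<beta> r \<le> m) \<and>
     csize m \<beta> = csize m \<mu> \<and> set js \<subseteq> {1..<n} \<and> \<beta> \<circ> word_perm js = \<mu> \<and> length js = ninv \<beta> \<and>
     S = tword m ` SSKT \<beta> (\<lambda>r. r) \<and>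
     enc n ` S = foldr (demazure_op (RF_crystal n (word_perm (odds (csize m \<mu>))))) js
       (enc n ` tword m ` SSKT \<mu> (\<lambda>r. r)))"

lemma SSKT_words_subset:
  assumes "weak_composition \<beta>" "\<And>r. \<beta> r \<noteq> 0 \<Longrightarrow> \<phi> r \<le> n"
  shows "tword m ` SSKT \<beta> \<phi> \<subseteq> words n (csize m \<beta>)"
proof (rule image_subsetI)
  fix T assume "T \<in> SSKT \<beta> \<phi>"
  then show "tword m T \<in> words n (csize m \<beta>)" by (rule tword_in_words[OF assms(1)]) (rule assms(2))
qed

lemma demazure_words_step:
  assumes S: "demazure_words n m \<mu> S" and t: "t \<in> {1..<n}" and ds: "dem_step t S S'"
    and S': "S' \<subseteq> words n (csize m \<mu>)"
  shows "demazure_words n m \<mu> S'"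
proof -
  let ?D = "demazure_op (RF_crystal n (word_perm (odds (csize m \<mu>))))"
  obtain \<beta> js where b: "weak_composition \<beta>" "\<forall>r>n. \<beta> r = 0" "\<forall>r. \<beta> r \<le> m"
     "csize m \<beta> = csize m \<mu>" "set js \<subseteq> {1..<n}" "\<beta> \<circ> word_perm js = \<mu>" "length js = ninv \<beta>"
     "S = tword m ` SSKT \<beta> (\<lambda>r. r)" "enc n ` S = foldr ?D js (enc n ` tword m ` SSKT \<mu> (\<lambda>r. r))"
    using S unfolding demazure_words_def by blast
  have t1: "1 \<le> t" using t by simp
  have m: "\<beta> r \<le> m" for r using b(3) by blast
  let ?S = "tword m ` SSKT \<beta> ((\<lambda>r. r)(t := Suc t))"
  have ds': "dem_step t S ?S" unfolding b(8) by (rule SSKT_dem_step[OF b(1) m t1]) auto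
  have "((\<lambda>r. r)(t := Suc t)) r \<le> n" if "\<beta> r \<noteq> 0" for r
    using b(2) that t by (cases "r \<le> n") auto
  then have "?S \<subseteq> words n (csize m \<beta>)" by (rule SSKT_words_subset[OF b(1)])
  then have sub: "?S \<subseteq> words n (csize m \<mu>)" unfolding b(4) .
  have enc': "enc n ` S' = ?D t (enc n ` S)" by (rule dem_step_demazure_op[OF ds S' t, symmetric])
  also have "\<dots> = enc n ` ?S" by (rule dem_step_demazure_op[OF ds' sub t])
  \<comment> \<open>Both sets are the image of \<open>S\<close> under the same Demazure operator, so
    the given step is the one that raises row \<open>t\<close> of the identity flag in shape
    \<open>\<beta>\<close>.\<close>
  finally have eq: "S' = ?S" using inj_on_image_eq_iff[OF inj_on_enc S' sub] by simp
  show ?thesis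
  proof (cases "\<beta> t \<le> \<beta> (Suc t)")
    case True
    then have "S' = S" using eq SSKT_raise_flag_trivial[OF b(1) True] b(8) by simp
    then show ?thesis using S by simp
  next
    \<comment> \<open>The exchange creates one inversion, so prefixing \<open>t\<close> keeps the
      length of the word equal to the number of inversions.\<close>
    case False
    let ?\<gamma> = "\<beta> \<circ> transpose t (Suc t)"
    have "S' = tword m ` SSKT ?\<gamma> (\<lambda>r. r)" using eq SSKT_swap_words[OF b(1) t1] False by simp
    moreover have "enc n ` S' = foldr ?D (t # js) (enc n ` tword m ` SSKT \<mu> (\<lambda>r. r))" using enc' b(9) by simp
    moreover have "?\<gamma> \<circ> word_perm (t # js) = \<mu>"
    proof -
      have "?\<gamma> \<circ> word_perm (t # js) = \<beta> \<circ> (transpose t (Suc t) \<circ> transpose t (Suc t)) \<circ> word_perm js"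
        by (simp only: word_perm_Cons comp_assoc)
      then show ?thesis using b(6) by simp
    qed
    moreover have "length (t # js) = ninv ?\<gamma>" using ninv_transpose[OF b(1) t1] False b(7) by simp
    moreover have "\<forall>r>n. ?\<gamma> r = 0" using b(2) t by (auto simp: transpose_def)
    moreover have "\<forall>r. ?\<gamma> r \<le> m" using m by simp
    moreover have "csize m ?\<gamma> = csize m \<mu>" using csize_transpose b(4) by simp
    moreover have "set (t # js) \<subseteq> {1..<n}" using b(5) t by simp
    moreover have "weak_composition ?\<gamma>" by (rule weak_composition_transpose[OF b(1) t1])
    ultimately show ?thesis unfolding demazure_words_def by blast
  qed
qed

lemma csize_word_perm:
  "csize m (\<beta> \<circ> word_perm js) = csize m \<beta>"
proof (induction js arbitrary: \<beta>)
  case (Cons t js)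
  have "\<beta> \<circ> word_perm (t # js) = (\<beta> \<circ> transpose t (Suc t)) \<circ> word_perm js" by (simp only: word_perm_Cons comp_assoc)
  then show ?case using Cons csize_transpose by metis
qed simp

text \<open>The set for \<open>\<alpha>\<close> is reached from that for the partition by undoing
  the letters of a minimal sorting word from the last one back; each undoing exchanges a
  descent.\<close>

lemma demazure_words_start:
  assumes wc: "weak_composition \<alpha>" and n: "\<forall>r>n. \<alpha> r = 0" and m: "\<And>r. \<alpha> r \<le> m"
    and js: "set js \<subseteq> {1..<n}" "is_partition (\<alpha> \<circ> word_perm js)" "length js = ninv \<alpha>"
  shows "demazure_words n m (\<alpha> \<circ> word_perm js) (tword m ` SSKT \<alpha> (\<lambda>r. r))"
  using assms
proof (induction js arbitrary: \<alpha>)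
  case Nil
  then show ?case unfolding demazure_words_def by (intro exI[of _ \<alpha>] exI[of _ "[]"]) simp
next
  case (Cons t js)
  let ?\<beta> = "\<alpha> \<circ> transpose t (Suc t)"
  have t: "1 \<le> t" "t \<in> {1..<n}" using Cons.prems(4) by simp_all
  have wc: "weak_composition ?\<beta>" by (rule weak_composition_transpose[OF Cons.prems(1) t(1)])
  have eq: "\<alpha> \<circ> word_perm (t # js) = ?\<beta> \<circ> word_perm js" by (simp only: word_perm_Cons comp_assoc)
  have p: "is_partition (?\<beta> \<circ> word_perm js)" using Cons.prems(5) unfolding eq .
  have "ninv ?\<beta> \<le> length js" using Cons.prems(4) p by (intro ninv_le_length wc) auto
  then have lt: "\<alpha> t < \<alpha> (Suc t)" and len: "length js = ninv ?\<beta>"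
    using ninv_transpose[OF Cons.prems(1) t(1)] Cons.prems(6) by (auto simp: of_bool_def split: if_splits)
  have m': "?\<beta> r \<le> m" for r using Cons.prems(3) by simp
  have n': "\<forall>r>n. ?\<beta> r = 0" using Cons.prems(2) t by (auto simp: transpose_def)
  have IH: "demazure_words n m (?\<beta> \<circ> word_perm js) (tword m ` SSKT ?\<beta> (\<lambda>r. r))"
    by (rule Cons.IH[OF wc n' m' _ p len]) (use Cons.prems(4) in simp)
  have inv: "?\<beta> \<circ> transpose t (Suc t) = \<alpha>" by (simp add: comp_assoc)
  have sw: "tword m ` SSKT ?\<beta> ((\<lambda>r. r)(t := Suc t)) = tword m ` SSKT \<alpha> (\<lambda>r. r)"
    using SSKT_swap_words[OF wc t(1), of m] lt unfolding inv by (simp add: transpose_def)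
  have "r \<le> n" if "\<alpha> r \<noteq> 0" for r using Cons.prems(2) that by (cases "r \<le> n") auto
  then have "tword m ` SSKT \<alpha> (\<lambda>r. r) \<subseteq> words n (csize m \<alpha>)" by (rule SSKT_words_subset[OF Cons.prems(1)])
  moreover have "csize m \<alpha> = csize m (?\<beta> \<circ> word_perm js)" by (simp only: csize_word_perm csize_transpose)
  ultimately have sub: "tword m ` SSKT \<alpha> (\<lambda>r. r) \<subseteq> words n (csize m (?\<beta> \<circ> word_perm js))" by simp
  have "dem_step t (tword m ` SSKT ?\<beta> (\<lambda>r. r)) (tword m ` SSKT \<alpha> (\<lambda>r. r))"
    unfolding sw[symmetric] by (rule SSKT_dem_step[OF wc m' t(1)]) auto
  from demazure_words_step[OF IH t(2) this sub] show ?case unfolding eq .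
qed

text \<open>The tableau is alone in a set closed under raising, so a raising step would fix it,
  whereas such a step lowers \<open>eps\<close> by one.\<close>

lemma yamanouchi_highest:
  assumes p: "is_partition \<mu>" and m: "\<And>r. \<mu> r \<le> m" and i: "1 \<le> i"
  shows "eps i (tword m (yamanouchi \<mu>)) = 0"
proof -
  have wc: "weak_composition \<mu>" using p by (simp add: is_partition_def)
  have y: "yamanouchi \<mu> \<in> SSKT \<mu> (\<lambda>r. r)" using SSKT_partition[OF p] by simp
  then have kt: "KT \<mu> (yamanouchi \<mu>)" using SSKT_iff[OF wc] by simp
  have "tableau_e i (yamanouchi \<mu>) = None"
  proof (cases "tableau_e i (yamanouchi \<mu>)")
    case (Some U)
    have "U \<in> SSKT \<mu> (\<lambda>r. r)" by (rule SSKT_e_closed[OF wc y i Some]) simp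
    then have "U = yamanouchi \<mu>" using SSKT_partition[OF p] by simp
    then show ?thesis using arrow_eps[OF tableau_e_arrow[OF wc kt i Some m]] by simp
  qed
  then show ?thesis using tableau_e_None_iff[OF wc kt i m] by simp
qed

lemma demazure_words_subset:
  assumes S: "demazure_words n m \<mu> S" and p: "is_partition \<mu>" and m: "\<And>r. \<mu> r \<le> m" and n: "\<forall>r>n. \<mu> r = 0"
  shows "demazure_subset n (RF_crystal n (word_perm (odds (csize m \<mu>)))) (enc n ` S)"
proof -
  let ?C = "RF_crystal n (word_perm (odds (csize m \<mu>)))"
  obtain \<beta> js where b: "weak_composition \<beta>" "set js \<subseteq> {1..<n}" "\<beta> \<circ> word_perm js = \<mu>" "length js = ninv \<beta>"
     "enc n ` S = foldr (demazure_op ?C) js (enc n ` tword m ` SSKT \<mu> (\<lambda>r. r))"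
    using S unfolding demazure_words_def by blast
  have wc: "weak_composition \<mu>" using p by (simp add: is_partition_def)
  let ?u = "enc n (tword m (yamanouchi \<mu>))"
  have "r \<le> n" if "\<mu> r \<noteq> 0" for r using n that by (cases "r \<le> n") auto
  then have "tword m (yamanouchi \<mu>) \<in> words n (csize m \<mu>)"
    using SSKT_partition[OF p] by (intro tword_in_words[OF wc, of _ "\<lambda>r. r"]) auto
  then have "highest_weight n ?C ?u"
    unfolding highest_weight_def
    using RF_e_enc(1)[OF _ yamanouchi_highest[OF p m]] by (simp add: RF_crystal_def RF_odds)
  moreover have "word_perm js permutes {1..n}" using b(2) by (intro word_perm_permutes) auto
  \<comment> \<open>The number of inversions is a lower bound for the length of any permutation
    sorting \<open>\<beta>\<close>, and \<open>js\<close> attains it.\<close>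
  moreover have "reduced_word (word_perm js) js"
  proof -
    have wf: "word_for (word_perm js) js" using b(2) by (auto simp: word_for_def)
    have "ninv \<beta> \<le> perm_length (word_perm js)" using perm_length_ge_ninv[OF b(1) wf] p b(3) by simp
    then show ?thesis using wf reduced_word_exists(2)[OF wf] b(4) by (simp add: reduced_word_def)
  qed
  moreover have "enc n ` S = foldr (demazure_op ?C) js {?u}" using b(5) SSKT_partition[OF p] by simp
  ultimately show ?thesis unfolding demazure_subset_def by blast
qed

section \<open>Crystal axioms and the isomorphism\<close>

lemma tableau_e_inj:
  assumes wc: "weak_composition \<alpha>" and i: "1 \<le> i" and "T \<in> SSKT \<alpha> \<phi>" "T' \<in> SSKT \<alpha> \<phi>"
    "tableau_e i T = Some U" "tableau_e i T' = Some U"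
  shows "T = T'"
proof -
  obtain m where m: "\<And>r. \<alpha> r \<le> m" by (rule weak_composition_bound[OF wc]) blast
  have kt: "KT \<alpha> T" "KT \<alpha> T'" using assms SSKT_iff[OF wc] by auto
  have "tword m T = tword m T'"
    by (rule arrow_unique_target[OF tableau_e_arrow[OF wc kt(1) i assms(5) m] tableau_e_arrow[OF wc kt(2) i assms(6) m]])
  then show ?thesis by (rule tword_KT_unique[OF wc kt m])
qed

lemma tableau_f_Some_iff:
  assumes wc: "weak_composition \<alpha>" and i: "1 \<le> i"
  shows "tableau_f (SSKT \<alpha> \<phi>) i U = Some T \<longleftrightarrow> T \<in> SSKT \<alpha> \<phi> \<and> tableau_e i T = Some U"
proof
  assume f: "tableau_f (SSKT \<alpha> \<phi>) i U = Some T"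
  then have wexcess: "\<exists>T\<in>SSKT \<alpha> \<phi>. tableau_e i T = Some U" by (auto simp: tableau_f_def split: if_splits)
  then have T: "T = (THE T. T \<in> SSKT \<alpha> \<phi> \<and> tableau_e i T = Some U)" using f by (simp add: tableau_f_def)
  have "\<exists>!T. T \<in> SSKT \<alpha> \<phi> \<and> tableau_e i T = Some U" using wexcess tableau_e_inj[OF wc i] by blast
  then show "T \<in> SSKT \<alpha> \<phi> \<and> tableau_e i T = Some U" unfolding T by (rule theI')
next
  assume T: "T \<in> SSKT \<alpha> \<phi> \<and> tableau_e i T = Some U"
  then have "(THE T. T \<in> SSKT \<alpha> \<phi> \<and> tableau_e i T = Some U) = T"
    using tableau_e_inj[OF wc i] by (intro the_equality) auto
  then show "tableau_f (SSKT \<alpha> \<phi>) i U = Some T" using T by (auto simp: tableau_f_def)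
qed

lemma SSKT_flag_closed:
  assumes "weak_composition \<alpha>" "is_flag \<phi>" "T \<in> SSKT \<alpha> \<phi>" "1 \<le> i" "tableau_e i T = Some U"
  shows "U \<in> SSKT \<alpha> \<phi>"
proof (rule SSKT_e_closed[OF assms(1,3,4,5)])
  fix a b :: nat assume "1 \<le> a" "a < b" "Suc i \<le> \<phi> a"
  moreover have "\<phi> a \<le> \<phi> b" using assms(2) calculation by (simp add: is_flag_def)
  ultimately show "Suc i \<le> \<phi> b" by simp
qed

lemma gl_crystal_SSKT:
  assumes wc: "weak_composition \<alpha>" and fl: "is_flag \<phi>" and n: "\<And>r. \<alpha> r \<noteq> 0 \<Longrightarrow> \<phi> r \<le> n"
  shows "gl_crystal n (SSKT_crystal \<alpha> \<phi>)"
proof -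
  obtain m where m: "\<And>r. \<alpha> r \<le> m" by (rule weak_composition_bound[OF wc]) blast
  have wt: "tableau_wt T = count_list (tword m T)" if "T \<in> SSKT \<alpha> \<phi>" for T
    using tableau_wt_tword[OF wc _ m] that SSKT_iff[OF wc] by blast
  have "tableau_wt T j = 0" if "T \<in> SSKT \<alpha> \<phi>" "j \<notin> {1..n}" for T j
  proof -
    have "tword m T \<in> words n (csize m \<alpha>)" by (rule tword_in_words[OF wc that(1)]) (rule n)
    then have "j \<notin> set (tword m T)" using that(2) by (auto simp: words_def)
    then show ?thesis by (simp add: wt[OF that(1)] count_list_0_iff)
  qed
  moreover have "int (tableau_wt U j) = int (tableau_wt T j) + unit_wt i j - unit_wt (Suc i) j"
    if "T \<in> SSKT \<alpha> \<phi>" "1 \<le> i" "tableau_e i T = Some U" for T U i j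
  proof -
    have "KT \<alpha> T" using that(1) SSKT_iff[OF wc] by blast
    then show ?thesis
      using arrow_count[OF tableau_e_arrow[OF wc _ that(2,3) m]] wt[OF that(1)]
        wt[OF SSKT_flag_closed[OF wc fl that]] by simp
  qed
  ultimately show ?thesis
    unfolding gl_crystal_def SSKT_crystal_def
    using finite_SSKT[OF wc] SSKT_flag_closed[OF wc fl] tableau_f_Some_iff[OF wc]
    by (auto simp: elem_set)
qed

lemma SSKT_isomorphic:
  assumes wc: "weak_composition \<alpha>" and fl: "is_flag \<phi>" and n: "\<And>r. \<alpha> r \<noteq> 0 \<Longrightarrow> \<phi> r \<le> n" and m: "\<And>r. \<alpha> r \<le> m"
    and N: "N = csize m \<alpha>"
  shows "crystal_isomorphic n (SSKT_crystal \<alpha> \<phi>)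
    (subcrystal (RF_crystal n (word_perm (odds N))) (enc n ` tword m ` SSKT \<alpha> \<phi>))"
proof -
  let ?B = "SSKT \<alpha> \<phi>" and ?\<theta> = "enc n \<circ> tword m"
  let ?X = "enc n ` tword m ` ?B"
  have sub: "tword m ` ?B \<subseteq> words n N" unfolding N using SSKT_words_subset[OF wc n] .
  have kt: "KT \<alpha> T" if "T \<in> ?B" for T using that SSKT_iff[OF wc] by blast
  have "inj_on ?\<theta> ?B"
    using comp_inj_on[OF inj_on_tword[OF wc m] inj_on_subset[OF inj_on_enc sub]] .
  then have bij: "bij_betw ?\<theta> ?B ?X" by (simp add: bij_betw_def image_comp)
  have wt: "RF_wt (?\<theta> T) = (\<lambda>j. int (tableau_wt T j))" if T: "T \<in> ?B" for T
  proof
    fix j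
    have "tword m T \<in> words n N" using sub T by blast
    then have "count_list (tword m T) j = 0" if "j \<notin> {1..n}" using that by (auto simp: words_def count_list_0_iff)
    then show "RF_wt (?\<theta> T) j = int (tableau_wt T j)"
      using tableau_wt_tword[OF wc kt[OF T] m] by (auto simp: RF_wt_enc)
  qed
  have raise: "restrict_op ?X (RF_e i) (?\<theta> T) = map_option ?\<theta> (tableau_e i T)" if T: "T \<in> ?B" and i: "i \<in> {1..<n}" for T i
  proof (cases "tableau_e i T")
    case None
    then have "eps i (tword m T) = 0" using tableau_e_None_iff[OF wc kt[OF T] _ m] i by simp
    then show ?thesis using None RF_e_enc(1)[OF i] by (simp add: restrict_op_def)
  next
    case (Some U)
    have "arrow i (tword m U) (tword m T)" using tableau_e_arrow[OF wc kt[OF T] _ Some m] i by simp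
    moreover have "U \<in> ?B" using SSKT_flag_closed[OF wc fl T _ Some] i by simp
    ultimately show ?thesis using Some RF_e_enc(2)[OF i] by (simp add: restrict_op_def)
  qed
  have lower: "restrict_op ?X (RF_f i) (?\<theta> U) = map_option ?\<theta> (tableau_f ?B i U)" if U: "U \<in> ?B" and i: "i \<in> {1..<n}" for U i
  proof (cases "tableau_f ?B i U")
    case (Some T)
    then have T: "T \<in> ?B" "tableau_e i T = Some U" using tableau_f_Some_iff[OF wc] i by auto
    have "arrow i (tword m U) (tword m T)" using tableau_e_arrow[OF wc kt[OF T(1)] _ T(2) m] i by simp
    then show ?thesis using Some T RF_f_enc(2)[OF i] by (simp add: restrict_op_def)
  next
    case None
    have "restrict_op ?X (RF_f i) (?\<theta> U) = None"
    proof (cases "phi i (tword m U) = 0")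
      case True
      then show ?thesis using RF_f_enc(1)[OF i] by (simp add: restrict_op_def)
    next
      case False
      then obtain W where W: "arrow i (tword m U) W" using arrow_from by blast
      \<comment> \<open>Otherwise \<open>W\<close> is the word of some flagged \<open>T\<close>, and
        \<open>T\<close> raises to a tableau with the word of \<open>U\<close>, that is to
        \<open>U\<close>; then \<open>tableau_f\<close> would be defined at
        \<open>U\<close>.\<close>
      have "enc n W \<notin> ?X"
      proof
        assume "enc n W \<in> ?X"
        then obtain T where T: "T \<in> ?B" "enc n W = enc n (tword m T)" by blast
        have "W \<in> words n N" using arrow_words[OF W i] sub U by blast
        then have "W = tword m T" using inj_onD[OF inj_on_enc T(2)] sub T(1) by blast
        then obtain U' where U': "tableau_e i T = Some U'" "tword m U' = tword m U"
          using tableau_e_arrow_iff[OF wc kt[OF T(1)] _ m, of i "tword m U"] W i by auto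
        have "KT \<alpha> U'" using tableau_e_KT[OF wc kt[OF T(1)] _ U'(1)] i by simp
        then have "U' = U" using tword_KT_unique[OF wc _ kt[OF U] m U'(2)] by blast
        then have "tableau_f ?B i U = Some T" using tableau_f_Some_iff[OF wc] i T(1) U'(1) by simp
        then show False using None by simp
      qed
      then show ?thesis using RF_f_enc(2)[OF i W] by (simp add: restrict_op_def)
    qed
    then show ?thesis using None by simp
  qed
  show ?thesis
    unfolding crystal_isomorphic_def SSKT_crystal_def subcrystal_def RF_crystal_def
    by (intro exI[of _ ?\<theta>]) (use bij wt raise lower in simp)
qed

theorem theorem4p13:
  fixes \<alpha> \<phi> :: "nat \<Rightarrow> nat" and k n :: nat
  assumes "weak_composition \<alpha>" and "comp_length \<alpha> = k"
    and "is_flag \<phi>"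
    and "k = 0 \<or> \<phi> k \<le> n"
  shows "demazure_crystal n (SSKT_crystal \<alpha> \<phi>) \<and>
         character (SSKT_crystal \<alpha> \<phi>) = laurent_of (flagged_key_poly \<alpha> \<phi>) \<and>
         flagged_key_poly \<alpha> \<phi> = foldr (\<lambda>j. pi_down (\<phi> j) j) [1..<Suc k] (key_poly \<alpha>)"
proof (intro conjI)
  note wc = assms(1) and fl = assms(3)
  show "character (SSKT_crystal \<alpha> \<phi>) = laurent_of (flagged_key_poly \<alpha> \<phi>)" by (rule character_SSKT_crystal[OF wc])
  show "flagged_key_poly \<alpha> \<phi> = foldr (\<lambda>j. pi_down (\<phi> j) j) [1..<Suc k] (key_poly \<alpha>)"
    by (rule flagged_key_poly_formula[OF assms(1-3)])
  have supp: "1 \<le> r \<and> r \<le> k" if "\<alpha> r \<noteq> 0" for r using low_flag_ends(3)[OF assms(1,2) that] .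
  have le: "\<phi> r \<le> n" if "1 \<le> r" "r \<le> k" for r
  proof -
    have "\<phi> r \<le> \<phi> k" using fl that by (simp add: is_flag_def)
    then show ?thesis using assms(4) that by auto
  qed
  have bound: "\<phi> r \<le> n" if "\<alpha> r \<noteq> 0" for r using le supp[OF that] by blast
  have ge: "r \<le> \<phi> r" if "1 \<le> r" for r using fl that by (simp add: is_flag_def)
  have supp_n: "r \<le> n" if "\<alpha> r \<noteq> 0" for r using supp[OF that] ge[of r] bound[OF that] by linarith
  have above: "\<forall>r>n. \<alpha> r = 0" using supp_n by (meson not_le)
  obtain m where m: "\<And>r. \<alpha> r \<le> m" by (rule weak_composition_bound[OF wc]) blast
  obtain js where js: "set js \<subseteq> {1..<n}" "is_partition (\<alpha> \<circ> word_perm js)" "length js = ninv \<alpha>"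
    using sorting_word_exists[OF wc above] by blast
  define \<mu> where "\<mu> = \<alpha> \<circ> word_perm js"
  \<comment> \<open>Permuting rows preserves both the bound \<open>m\<close> and the number of
    boxes, so all shapes that occur share one ambient crystal.\<close>
  have N: "csize m \<mu> = csize m \<alpha>" by (simp only: \<mu>_def csize_word_perm)
  have "demazure_words n m \<mu> (tword m ` SSKT \<alpha> (low_flag \<phi> 1 (\<phi> 1)))"
  proof (rule low_flag_chain[OF fl, where P = "\<lambda>\<psi>. demazure_words n m \<mu> (tword m ` SSKT \<alpha> \<psi>)" and k = k])
    show "demazure_words n m \<mu> (tword m ` SSKT \<alpha> (low_flag \<phi> (Suc k) (\<phi> (Suc k))))"
      unfolding low_flag_ends(1)[OF assms(1,2)] \<mu>_def by (rule demazure_words_start[OF wc above m js])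
  next
    fix j u assume j: "1 \<le> j" "j \<le> k" "j \<le> u" "u < \<phi> j"
      and IH: "demazure_words n m \<mu> (tword m ` SSKT \<alpha> (low_flag \<phi> j u))"
    \<comment> \<open>All bounds up to row \<open>k\<close> are at most \<open>n\<close>, so each
      operator used has an index of type gl_n.\<close>
    have un: "u \<in> {1..<n}" using j le[of j] by simp
    have "dem_step u (tword m ` SSKT \<alpha> (low_flag \<phi> j u)) (tword m ` SSKT \<alpha> ((low_flag \<phi> j u)(j := Suc u)))"
      using un by (intro SSKT_dem_step[OF wc m] low_flag_step[OF fl j(1,3,4)]) simp
    moreover have "tword m ` SSKT \<alpha> ((low_flag \<phi> j u)(j := Suc u)) \<subseteq> words n (csize m \<mu>)"
      unfolding N low_flag_upd
    proof (rule SSKT_words_subset[OF wc])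
      fix r assume r: "\<alpha> r \<noteq> 0"
      show "low_flag \<phi> j (Suc u) r \<le> n" using supp_n[OF r] bound[OF r] un by (simp add: low_flag_def)
    qed
    ultimately show "demazure_words n m \<mu> (tword m ` SSKT \<alpha> (low_flag \<phi> j (Suc u)))"
      using demazure_words_step[OF IH un] unfolding low_flag_upd by blast
  qed
  then have "demazure_words n m \<mu> (tword m ` SSKT \<alpha> \<phi>)" unfolding low_flag_ends(2)[OF assms(1,2)] .
  moreover have "\<mu> r \<le> m" for r using m by (simp add: \<mu>_def)
  moreover have "\<forall>r>n. \<mu> r = 0"
  proof (intro allI impI)
    fix r assume "n < r"
    moreover have "word_perm js permutes {1..n}" using js(1) by (intro word_perm_permutes) auto
    ultimately have "word_perm js r = r" by (simp add: permutes_not_in)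
    then show "\<mu> r = 0" using above \<open>n < r\<close> by (simp add: \<mu>_def)
  qed
  ultimately have "demazure_subset n (RF_crystal n (word_perm (odds (csize m \<alpha>)))) (enc n ` tword m ` SSKT \<alpha> \<phi>)"
    using demazure_words_subset[of n m \<mu>] js(2) N unfolding \<mu>_def by metis
  moreover have "crystal_isomorphic n (SSKT_crystal \<alpha> \<phi>)
      (subcrystal (RF_crystal n (word_perm (odds (csize m \<alpha>)))) (enc n ` tword m ` SSKT \<alpha> \<phi>))"
    by (rule SSKT_isomorphic[OF wc fl bound m refl])
  moreover have "gl_crystal n (SSKT_crystal \<alpha> \<phi>)" by (rule gl_crystal_SSKT[OF wc fl bound])
  ultimately show "demazure_crystal n (SSKT_crystal \<alpha> \<phi>)"
    unfolding demazure_crystal_def using odds_S_infinity by blast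
qed

end
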